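(* Let $P\in\mathcal{P}$ be a Boone-Higman property that is inherited by subgroups. Then exactly one of the following holds: (1) $P$ is not strongly undecidable. In this case, there is a comeager set $\mathcal{X}_P\subset\mathcal{G}_P$ such that for each group $G\in\mathcal{X}_P$, the set of (isomorphism types of) finitely generated subgroups of $G$ coincides with the set of (isomorphism types of) finitely generated groups satisfying $P$ that also have a solvable word problem. (2) $P$ is strongly undecidable. In this case, there is a comeager set $\mathcal{X}_P\subset\mathcal{G}_P$ such that for each group $G\in\mathcal{X}_P$, the set of (isomorphism types of) finitely generated subgroups of $G$ contains all finitely generated groups satisfying $P$ that also have a solvable word problem, but also contains a finitely generated group with $P$ that has an unsolvable word problem.
   Context: An enumerated group is a group whose underlying set is $\mathbf{N}=\{1,2,3,\ldots\}$. The set $\mathcal{G}$ of enumerated groups is identified, via (multiplication, inversion, identity), with a subset of $\mathbf{N}^{\mathbf{N}\times\mathbf{N}}\times\mathbf{N}^{\mathbf{N}}\times\mathbf{N}$ (product topology, $\mathbf{N}$ discrete) and given the subspace topology; it is a Polish space. For a property $P$ of groups, $\mathcal{G}_P\subset\mathcal{G}$ is the subspace of enumerated groups satisfying $P$. A subset of a space is comeager if it contains a countable intersection of dense open subsets of that space. $\mathcal{P}$ is the following set of properties of groups: amenability; having no subgroup isomorphic to the free group $\mathbf{F}_2$; left orderability (existence of a left-invariant total order); local indicability (every nontrivial finitely generated subgroup has an infinite cyclic quotient); biorderability (existence of a total order invariant under left and right translation); the unique product property (for all nonempty finite subsets $X,Y$ there is an element that can be written as $xy$ with $x\in X,y\in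 Y$ in exactly one way); torsion-freeness; soficity; not satisfying a law (for every nontrivial freely reduced word $w$ there is a tuple $\vec a$ in the group with $w(\vec a)\neq e$). For each $P\in\mathcal{P}$ the space $\mathcal{G}_P$ is Polish. A property $P$ is a Boone-Higman property if every (finitely generated) group $G$ that has a solvable word problem and satisfies $P$ embeds in a simple subgroup of a finitely presented group $H$ that also satisfies $P$. A property $P$ is strongly undecidable if there exist a finitely presented group $G$ and a finite subset $X\subset G$ such that: (i) there is a group $H$ satisfying $P$ and a surjective homomorphism $\phi:G\to H$ whose restriction to $X$ is injective; and (ii) if $H$ is a group satisfying $P$ for which there exists a surjective homomorphism $\phi:G\to H$ whose restriction to $X$ is injective, then $H$ has an unsolvable word problem. *)

theory Defs
  imports
    "HOL-Analysis.Elementary_Metric_Spaces"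
    "HOL-Analysis.Function_Topology"
    "HOL-Algebra.Elementary_Groups"
    "HOL-Combinatorics.Permutations"
    "HOL-Library.Nat_Bijection"
begin

section \<open>Computability\<close>

datatype recf =
    Zero
  | Succ
  | Proj nat
  | Comp recf "recf list"
  | PrimRec recf recf
  | Mu recf

text \<open>
  \<open>computes f xs y\<close>: the partial recursive function denoted by \<open>f\<close> is defined at the
  arguments \<open>xs\<close> and has the value \<open>y\<close> there. Primitive recursion and minimisation run over the
  first argument.
\<close>

inductive computes :: "recf \<Rightarrow> nat list \<Rightarrow> nat \<Rightarrow> bool" where
  zero: "computes Zero xs 0"
| succ: "computes Succ (x # xs) (Suc x)"
| proj: "i < length xs \<Longrightarrow> computes (Proj i) xs (xs ! i)"
| comp: "\<lbrakk>list_all2 (\<lambda>g y. computes g xs y) gs ys; computes f ys z\<rbrakk> \<Longrightarrow> computes (Comp f gs) xs z"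
| prim_0: "computes f xs y \<Longrightarrow> computes (PrimRec f g) (0 # xs) y"
| prim_Suc: "\<lbrakk>computes (PrimRec f g) (n # xs) r; computes g (n # r # xs) y\<rbrakk>
    \<Longrightarrow> computes (PrimRec f g) (Suc n # xs) y"
| mu: "\<lbrakk>computes f (n # xs) 0; \<And>m. m < n \<Longrightarrow> \<exists>y>0. computes f (m # xs) y\<rbrakk>
    \<Longrightarrow> computes (Mu f) xs n"

definition decidable_set :: "nat set \<Rightarrow> bool" where
  "decidable_set A \<longleftrightarrow> (\<exists>f. \<forall>n. computes f [n] (if n \<in> A then 1 else 0))"


section \<open>Words and free groups\<close>

text \<open>The letter \<open>(i, True)\<close> stands for the generator $x_i$ and \<open>(i, False)\<close> for its inverse.\<close>

type_synonym letter = "nat \<times> bool"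
type_synonym gword = "letter list"

definition inv_letter :: "letter \<Rightarrow> letter" where
  "inv_letter l = (fst l, \<not> snd l)"

definition reduced :: "gword \<Rightarrow> bool" where
  "reduced w \<longleftrightarrow> (\<forall>i. Suc i < length w \<longrightarrow> w ! Suc i \<noteq> inv_letter (w ! i))"

definition words_over :: "nat \<Rightarrow> gword set" where
  "words_over n = {w. set w \<subseteq> {..<n} \<times> UNIV}"

fun cons_reduce :: "letter \<Rightarrow> gword \<Rightarrow> gword" where
  "cons_reduce l [] = [l]"
| "cons_reduce l (l' # w) = (if l' = inv_letter l then w else l # l' # w)"

text \<open>For reduced words \<open>u\<close> and \<open>v\<close>, \<open>foldr cons_reduce u v\<close> is the free reduction of \<open>u @ v\<close>.\<close>

definition free_group :: "nat \<Rightarrow> gword monoid" where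
  "free_group n = \<lparr>carrier = {w \<in> words_over n. reduced w},
    monoid.mult = (\<lambda>u v. foldr cons_reduce u v), one = []\<rparr>"

definition word_eval :: "('a, 'b) monoid_scheme \<Rightarrow> (nat \<Rightarrow> 'a) \<Rightarrow> gword \<Rightarrow> 'a" where
  "word_eval G a w =
    foldr (\<lambda>(i, b) r. (if b then a i else inv\<^bsub>G\<^esub> (a i)) \<otimes>\<^bsub>G\<^esub> r) w \<one>\<^bsub>G\<^esub>"


section \<open>Finite generation, finite presentation, word problem, simplicity\<close>

definition finitely_generated :: "('a, 'b) monoid_scheme \<Rightarrow> bool" where
  "finitely_generated G \<longleftrightarrow> (\<exists>S\<subseteq>carrier G. finite S \<and> generate G S = carrier G)"

definition normal_closure :: "('a, 'b) monoid_scheme \<Rightarrow> 'a set \<Rightarrow> 'a set" where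
  "normal_closure G R = \<Inter>{N. N \<lhd> G \<and> R \<subseteq> N}"

definition finitely_presented :: "('a, 'b) monoid_scheme \<Rightarrow> bool" where
  "finitely_presented G \<longleftrightarrow> (\<exists>n R. finite R \<and> R \<subseteq> carrier (free_group n) \<and>
    G \<cong> (free_group n Mod normal_closure (free_group n) R))"

fun letter_code :: "letter \<Rightarrow> nat" where
  "letter_code (i, b) = (if b then 2 * i else 2 * i + 1)"

definition word_code :: "gword \<Rightarrow> nat" where
  "word_code w = list_encode (map letter_code w)"

text \<open>
  Solvability of the word problem does not depend on the choice of the finite generating tuple.
  A group with solvable word problem is finitely generated by definition.
\<close>

definition solvable_word_problem :: "('a, 'b) monoid_scheme \<Rightarrow> bool" where
  "solvable_word_problem G \<longleftrightarrow> (\<exists>n a. a ` {..<n} \<subseteq> carrier G \<and>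
    generate G (a ` {..<n}) = carrier G \<and>
    decidable_set (word_code ` {w \<in> words_over n. word_eval G a w = \<one>\<^bsub>G\<^esub>}))"

text \<open>
  The library locale \<open>simple_group\<close> demands \<open>order G > 1\<close> and hence excludes all infinite groups,
  because the cardinality of an infinite set is \<open>0\<close>.
\<close>

definition is_simple_grp :: "('a, 'b) monoid_scheme \<Rightarrow> bool" where
  "is_simple_grp G \<longleftrightarrow> group G \<and> carrier G \<noteq> {\<one>\<^bsub>G\<^esub>} \<and>
    (\<forall>N. N \<lhd> G \<longrightarrow> N = carrier G \<or> N = {\<one>\<^bsub>G\<^esub>})"


section \<open>Properties of groups\<close>

text \<open>
  Amenability: existence of a left-invariant mean on the bounded real functions on the group.
  Positivity and linearity make \<open>m f\<close> depend only on the values of \<open>f\<close> on the carrier.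
\<close>

definition amenable :: "('a, 'b) monoid_scheme \<Rightarrow> bool" where
  "amenable G \<longleftrightarrow> (let B = {f :: 'a \<Rightarrow> real. bounded (f ` carrier G)} in
    \<exists>m :: ('a \<Rightarrow> real) \<Rightarrow> real.
      (\<forall>f\<in>B. \<forall>h\<in>B. m (\<lambda>x. f x + h x) = m f + m h) \<and>
      (\<forall>f\<in>B. \<forall>c. m (\<lambda>x. c * f x) = c * m f) \<and>
      (\<forall>f\<in>B. (\<forall>x\<in>carrier G. 0 \<le> f x) \<longrightarrow> 0 \<le> m f) \<and>
      m (\<lambda>x. 1) = 1 \<and>
      (\<forall>f\<in>B. \<forall>g\<in>carrier G. m (\<lambda>x. f (g \<otimes>\<^bsub>G\<^esub> x)) = m f))"

definition no_free_subgroup :: "('a, 'b) monoid_scheme \<Rightarrow> bool" where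
  "no_free_subgroup G \<longleftrightarrow> \<not> (\<exists>K. subgroup K G \<and> G\<lparr>carrier := K\<rparr> \<cong> free_group 2)"

definition left_orderable :: "('a, 'b) monoid_scheme \<Rightarrow> bool" where
  "left_orderable G \<longleftrightarrow> (\<exists>R. linear_order_on (carrier G) R \<and>
    (\<forall>a\<in>carrier G. \<forall>b\<in>carrier G. \<forall>c\<in>carrier G.
      (a, b) \<in> R \<longrightarrow> (c \<otimes>\<^bsub>G\<^esub> a, c \<otimes>\<^bsub>G\<^esub> b) \<in> R))"

definition biorderable :: "('a, 'b) monoid_scheme \<Rightarrow> bool" where
  "biorderable G \<longleftrightarrow> (\<exists>R. linear_order_on (carrier G) R \<and>
    (\<forall>a\<in>carrier G. \<forall>b\<in>carrier G. \<forall>c\<in>carrier G.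
      (a, b) \<in> R \<longrightarrow> (c \<otimes>\<^bsub>G\<^esub> a, c \<otimes>\<^bsub>G\<^esub> b) \<in> R \<and> (a \<otimes>\<^bsub>G\<^esub> c, b \<otimes>\<^bsub>G\<^esub> c) \<in> R))"

definition locally_indicable :: "('a, 'b) monoid_scheme \<Rightarrow> bool" where
  "locally_indicable G \<longleftrightarrow> (\<forall>K. subgroup K G \<and> finitely_generated (G\<lparr>carrier := K\<rparr>) \<and> K \<noteq> {\<one>\<^bsub>G\<^esub>}
    \<longrightarrow> (\<exists>N. N \<lhd> G\<lparr>carrier := K\<rparr> \<and> (G\<lparr>carrier := K\<rparr> Mod N) \<cong> integer_group))"

definition unique_product :: "('a, 'b) monoid_scheme \<Rightarrow> bool" where
  "unique_product G \<longleftrightarrow> (\<forall>X Y. finite X \<and> X \<noteq> {} \<and> X \<subseteq> carrier G \<and>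
      finite Y \<and> Y \<noteq> {} \<and> Y \<subseteq> carrier G
    \<longrightarrow> (\<exists>z. \<exists>!p. p \<in> X \<times> Y \<and> fst p \<otimes>\<^bsub>G\<^esub> snd p = z))"

definition torsion_free :: "('a, 'b) monoid_scheme \<Rightarrow> bool" where
  "torsion_free G \<longleftrightarrow>
    (\<forall>x\<in>carrier G. \<forall>n::nat. n > 0 \<and> x [^]\<^bsub>G\<^esub> n = \<one>\<^bsub>G\<^esub> \<longrightarrow> x = \<one>\<^bsub>G\<^esub>)"

definition hamming_dist :: "nat \<Rightarrow> (nat \<Rightarrow> nat) \<Rightarrow> (nat \<Rightarrow> nat) \<Rightarrow> real" where
  "hamming_dist n p q = real (card {i. i < n \<and> p i \<noteq> q i}) / real n"

definition sofic :: "('a, 'b) monoid_scheme \<Rightarrow> bool" where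
  "sofic G \<longleftrightarrow> (\<forall>F \<epsilon>. finite F \<and> F \<subseteq> carrier G \<and> \<epsilon> > 0 \<longrightarrow>
    (\<exists>n>0. \<exists>\<phi>. (\<forall>g\<in>carrier G. \<phi> g permutes {..<n}) \<and>
      (\<forall>g\<in>F. \<forall>h\<in>F. hamming_dist n (\<phi> (g \<otimes>\<^bsub>G\<^esub> h)) (\<phi> g \<circ> \<phi> h) < \<epsilon>) \<and>
      (\<forall>g\<in>F - {\<one>\<^bsub>G\<^esub>}. hamming_dist n (\<phi> g) id > 1 - \<epsilon>)))"

definition satisfies_no_law :: "('a, 'b) monoid_scheme \<Rightarrow> bool" where
  "satisfies_no_law G \<longleftrightarrow> (\<forall>w. reduced w \<and> w \<noteq> [] \<longrightarrow>
    (\<exists>a. range a \<subseteq> carrier G \<and> word_eval G a w \<noteq> \<one>\<^bsub>G\<^esub>))"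

text \<open>
  A property of groups is represented by a predicate on groups whose carrier is a subset of
  \<open>nat\<close>. Up to isomorphism these are all countable groups; enumerated groups, finitely generated
  groups, and the subgroups and quotients of either are countable. The predicates below are
  invariant under isomorphism.
\<close>

definition group_properties :: "(nat monoid \<Rightarrow> bool) set" where
  "group_properties = {amenable, no_free_subgroup, left_orderable, locally_indicable, biorderable,
    unique_product, torsion_free, sofic, satisfies_no_law}"

definition subgroup_inherited :: "(nat monoid \<Rightarrow> bool) \<Rightarrow> bool" where
  "subgroup_inherited P \<longleftrightarrow>
    (\<forall>G K. group G \<and> P G \<and> subgroup K G \<longrightarrow> P (G\<lparr>carrier := K\<rparr>))"

definition boone_higman :: "(nat monoid \<Rightarrow> bool) \<Rightarrow> bool" where
  "boone_higman P \<longleftrightarrow>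
    (\<forall>G. group G \<and> finitely_generated G \<and> solvable_word_problem G \<and> P G \<longrightarrow>
      (\<exists>H S. group H \<and> finitely_presented H \<and> P H \<and>
        subgroup S H \<and> is_simple_grp (H\<lparr>carrier := S\<rparr>) \<and> mon G (H\<lparr>carrier := S\<rparr>) \<noteq> {}))"

definition strongly_undecidable :: "(nat monoid \<Rightarrow> bool) \<Rightarrow> bool" where
  "strongly_undecidable P \<longleftrightarrow>
    (\<exists>(G :: nat monoid) X. group G \<and> finitely_presented G \<and> finite X \<and> X \<subseteq> carrier G \<and>
      (\<exists>H \<phi>. group H \<and> P H \<and> \<phi> \<in> epi G H \<and> inj_on \<phi> X) \<and>
      (\<forall>H. group H \<and> P H \<and> (\<exists>\<phi>. \<phi> \<in> epi G H \<and> inj_on \<phi> X) \<longrightarrow> \<not> solvable_word_problem H))"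


section \<open>The space of enumerated groups\<close>

text \<open>
  The countably infinite underlying set of an enumerated group is the type \<open>nat\<close>, which starts
  at \<open>0\<close>; its topology is discrete. Function types carry the product topology.
\<close>

type_synonym enumeration = "(nat \<times> nat \<Rightarrow> nat) \<times> (nat \<Rightarrow> nat) \<times> nat"

definition group_of :: "enumeration \<Rightarrow> nat monoid" where
  "group_of = (\<lambda>(m, i, e). \<lparr>carrier = UNIV, monoid.mult = (\<lambda>x y. m (x, y)), one = e\<rparr>)"

definition enumerated_groups :: "enumeration set" where
  "enumerated_groups = {(m, i, e). group (group_of (m, i, e)) \<and>
    (\<forall>x. i x = inv\<^bsub>group_of (m, i, e)\<^esub> x)}"

definition enumerated_groups_with :: "(nat monoid \<Rightarrow> bool) \<Rightarrow> enumeration set" where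
  "enumerated_groups_with P = {E \<in> enumerated_groups. P (group_of E)}"

definition comeager_in :: "'a topology \<Rightarrow> 'a set \<Rightarrow> bool" where
  "comeager_in T X \<longleftrightarrow> X \<subseteq> topspace T \<and>
    (\<exists>U :: nat \<Rightarrow> 'a set. (\<forall>n. openin T (U n) \<and> T closure_of U n = topspace T) \<and>
      (\<Inter>n. U n) \<subseteq> X)"


section \<open>Isomorphism types\<close>

definition iso_type :: "nat monoid \<Rightarrow> nat monoid set" where
  "iso_type H = {H'. group H' \<and> H' \<cong> H}"

definition fg_subgroup_types :: "nat monoid \<Rightarrow> nat monoid set set" where
  "fg_subgroup_types G =
    iso_type ` {G\<lparr>carrier := K\<rparr> | K. subgroup K G \<and> finitely_generated (G\<lparr>carrier := K\<rparr>)}"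

definition solvable_fg_types :: "(nat monoid \<Rightarrow> bool) \<Rightarrow> nat monoid set set" where
  "solvable_fg_types P =
    iso_type ` {H. group H \<and> finitely_generated H \<and> P H \<and> solvable_word_problem H}"

definition unsolvable_fg_types :: "(nat monoid \<Rightarrow> bool) \<Rightarrow> nat monoid set set" where
  "unsolvable_fg_types P =
    iso_type ` {H. group H \<and> finitely_generated H \<and> P H \<and> \<not> solvable_word_problem H}"

end

theory Submission
  imports Defs "HOL-Algebra.Weak_Morphisms" "HOL-Analysis.Elementary_Normed_Spaces"
begin

text \<open>
  The two cases exclude each other, so the content is the existence of the comeager sets. The
  proof rests on one family of sets of enumerated groups. For finite lists \<open>R\<close> and \<open>T\<close> of words,
  \<open>solving_set S R T\<close> consists of the groups that contain a tuple at which the words in \<open>R\<close> are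
  trivial and the words in \<open>T\<close> are not. It is open, because evaluating a word at a fixed tuple
  involves finitely many values of the operations. It is dense as soon as some countable group
  \<open>K\<close> with the property \<open>P\<close> contains such a tuple (\<open>dense_solving_set\<close>): a basic open set prescribes
  a finite part of the multiplication table of some enumerated group $E$; the group
  $E \times K$ has \<open>P\<close> again, because each of the properties passes to direct products
  (\<open>group_properties_direct_product\<close>), and it can be enumerated so that the finitely many
  elements $(x, 1)$ that matter keep their old names $x$ (\<open>extend_partial_enumeration\<close>). As there are
  only countably many pairs of lists of words, a generic group lies in all the dense sets of this form.

  Groups with solvable word problem embed generically: let $H$ embed in a simple subgroup $S$ of a
  finitely presented group $K$ with \<open>P\<close>. Let \<open>R\<close> be the relators of $K$ and let \<open>T\<close> consist of one word
  for a nontrivial element of $S$. A tuple as above in $E$ defines a homomorphism from $K$ to $E$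
  that is not trivial on $S$, hence is injective on $S$ and on $H$ (\<open>generic_embedding\<close>).

  If \<open>P\<close> is strongly undecidable, let \<open>R\<close> be the relators of the witnessing group $G$ and let \<open>T\<close>
  express that the elements of the finite set $X$ are distinct. Then a solution in $E$ generates a
  quotient of $G$ in which $X$ survives; it inherits \<open>P\<close> from $E$, so its word problem is
  unsolvable (\<open>generic_unsolvable_subgroup\<close>).

  If \<open>P\<close> is not strongly undecidable, the finite table that defines a basic open set is read as a
  finite presentation. The enumerated groups in the open set provide quotients with \<open>P\<close> in
  which the generators remain distinct; hence there is such a quotient $H$ with solvable word
  problem (\<open>solvable_approximation\<close>). Embed $H$ in a simple subgroup of a finitely
  presented group $K$ with \<open>P\<close> and enumerate $E \times K$ so that the name $x$ is given to the image of
  the generator $x$ in the second factor. The elements below $N$ now lie in a copy of $H$, and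
  finitely many equations together with one inequation force this to remain
  true in a whole neighbourhood (\<open>dense_interior_solvable\<close>). So in a generic group each
  finitely generated subgroup lies in a subgroup with solvable word problem.

  Computability enters at one point only: solvability of the word problem passes to finitely
  generated groups that embed (\<open>solvable_word_problem_mon\<close>), because substituting fixed words for letters is
  a recursive operation on codes of words.
\<close>

section \<open>Recursive functions on codes of lists\<close>

text \<open>
  Recursive functions are handled as functions on lists of arguments, so that the closure
  properties below can be applied without exhibiting programs.
\<close>

definition recursive_fun :: "nat \<Rightarrow> (nat list \<Rightarrow> nat) \<Rightarrow> bool" where
  "recursive_fun k F \<longleftrightarrow> (\<exists>f. \<forall>xs. length xs = k \<longrightarrow> computes f xs (F xs))"

lemma recursive_fun_cong:
  assumes "recursive_fun k F" "\<And>xs. length xs = k \<Longrightarrow> F xs = G xs"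
  shows "recursive_fun k G"
  using assms unfolding recursive_fun_def by metis

lemma recursive_fun_const: "recursive_fun k (\<lambda>xs. c)"
proof (induction c)
  case 0
  show ?case unfolding recursive_fun_def using computes.zero by blast
next
  case (Suc c)
  then obtain f where "\<And>xs. length xs = k \<Longrightarrow> computes f xs c"
    unfolding recursive_fun_def by blast
  then have "computes (Comp Succ [f]) xs (Suc c)" if "length xs = k" for xs
    using that by (intro computes.comp[where ys = "[c]"]) (auto intro: computes.succ)
  then show ?case unfolding recursive_fun_def by blast
qed

lemma recursive_fun_proj: "i < k \<Longrightarrow> recursive_fun k (\<lambda>xs. xs ! i)"
  unfolding recursive_fun_def using computes.proj by metis

lemma recursive_fun_comp:
  assumes "recursive_fun (length gs) F" "\<And>g. g \<in> set gs \<Longrightarrow> recursive_fun k g"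
  shows "recursive_fun k (\<lambda>xs. F (map (\<lambda>g. g xs) gs))"
proof -
  from assms(1) obtain f where f: "\<And>xs. length xs = length gs \<Longrightarrow> computes f xs (F xs)"
    unfolding recursive_fun_def by blast
  from assms(2) obtain h where h: "\<And>g xs. g \<in> set gs \<Longrightarrow> length xs = k \<Longrightarrow> computes (h g) xs (g xs)"
    unfolding recursive_fun_def by metis
  have "computes (Comp f (map h gs)) xs (F (map (\<lambda>g. g xs) gs))" if "length xs = k" for xs
    by (rule computes.comp[OF _ f]) (auto simp: list_all2_conv_all_nth h that)
  then show ?thesis unfolding recursive_fun_def by blast
qed

lemma recursive_fun_comp1:
  "recursive_fun 1 F \<Longrightarrow> recursive_fun k A \<Longrightarrow> recursive_fun k (\<lambda>xs. F [A xs])"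
  using recursive_fun_comp[of "[A]" F k] by simp

lemma recursive_fun_comp2:
  "recursive_fun 2 F \<Longrightarrow> recursive_fun k A \<Longrightarrow> recursive_fun k B \<Longrightarrow>
    recursive_fun k (\<lambda>xs. F [A xs, B xs])"
  using recursive_fun_comp[of "[A, B]" F k] by (auto simp: numeral_2_eq_2)

lemma recursive_fun_drop:
  assumes "recursive_fun k F"
  shows "recursive_fun (m + k) (\<lambda>xs. F (drop m xs))"
proof (rule recursive_fun_cong)
  show "recursive_fun (m + k) (\<lambda>xs. F (map (\<lambda>g. g xs) (map (\<lambda>i ys. ys ! (m + i)) [0..<k])))"
    by (rule recursive_fun_comp) (auto intro!: recursive_fun_proj assms)
next
  fix xs :: "nat list" assume "length xs = m + k"
  then have "map (\<lambda>g. g xs) (map (\<lambda>i ys. ys ! (m + i)) [0..<k]) = drop m xs"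
    by (intro nth_equalityI) auto
  then show "F (map (\<lambda>g. g xs) (map (\<lambda>i ys. ys ! (m + i)) [0..<k])) = F (drop m xs)" by simp
qed

lemma recursive_fun_primrec:
  assumes "recursive_fun k F" "recursive_fun (Suc (Suc k)) G"
  shows "recursive_fun (Suc k) (\<lambda>xs. rec_nat (F (tl xs)) (\<lambda>n r. G (n # r # tl xs)) (hd xs))"
proof -
  from assms obtain f g where
    f: "\<And>xs. length xs = k \<Longrightarrow> computes f xs (F xs)" and
    g: "\<And>xs. length xs = Suc (Suc k) \<Longrightarrow> computes g xs (G xs)"
    unfolding recursive_fun_def by blast
  have *: "computes (PrimRec f g) (n # ys) (rec_nat (F ys) (\<lambda>n r. G (n # r # ys)) n)"
    if "length ys = k" for n ys
  proof (induction n)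
    case 0
    show ?case using f[OF that] by (auto intro: computes.prim_0)
  next
    case (Suc n)
    then show ?case using g[of "n # _ # ys"] that by (auto intro!: computes.prim_Suc[OF Suc])
  qed
  show ?thesis unfolding recursive_fun_def
    by (rule exI[of _ "PrimRec f g"]) (use * in \<open>auto simp: length_Suc_conv\<close>)
qed

lemma recursive_fun_Least:
  assumes F: "recursive_fun (Suc k) F" and ex: "\<And>xs. length xs = k \<Longrightarrow> \<exists>n. F (n # xs) = 0"
  shows "recursive_fun k (\<lambda>xs. LEAST n. F (n # xs) = 0)"
proof -
  from F obtain f where f: "\<And>xs. length xs = Suc k \<Longrightarrow> computes f xs (F xs)"
    unfolding recursive_fun_def by blast
  have "computes (Mu f) xs (LEAST n. F (n # xs) = 0)" if "length xs = k" for xs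
  proof (rule computes.mu)
    have "F ((LEAST n. F (n # xs) = 0) # xs) = 0"
      using LeastI_ex[OF ex[OF that]] .
    with f[of "(LEAST n. F (n # xs) = 0) # xs"] that
    show "computes f ((LEAST n. F (n # xs) = 0) # xs) 0" by simp
  next
    fix m assume "m < (LEAST n. F (n # xs) = 0)"
    then have "F (m # xs) > 0" using not_less_Least by fastforce
    with f[of "m # xs"] that show "\<exists>y>0. computes f (m # xs) y" by auto
  qed
  then show ?thesis unfolding recursive_fun_def by blast
qed

lemma recursive_fun_Suc: "recursive_fun k A \<Longrightarrow> recursive_fun k (\<lambda>xs. Suc (A xs))"
proof -
  have "recursive_fun 1 (\<lambda>xs. Suc (hd xs))"
    unfolding recursive_fun_def by (rule exI[of _ Succ]) (auto simp: length_Suc_conv intro: computes.succ)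
  from recursive_fun_comp1[OF this] show "recursive_fun k A \<Longrightarrow> recursive_fun k (\<lambda>xs. Suc (A xs))"
    by simp
qed

lemma recursive_fun_pred:
  assumes "recursive_fun k A"
  shows "recursive_fun k (\<lambda>xs. A xs - 1)"
proof -
  have 1: "rec_nat 0 (\<lambda>n r. n) m = m - 1" for m by (cases m) auto
  have "recursive_fun (Suc (Suc 0)) (\<lambda>xs. xs ! 0)" by (rule recursive_fun_proj) simp
  from recursive_fun_primrec[OF recursive_fun_const[of 0 0] this]
  have "recursive_fun 1 (\<lambda>xs. hd xs - 1)" by (simp add: 1)
  from recursive_fun_comp1[OF this assms] show ?thesis by simp
qed

lemma recursive_fun_add:
  assumes "recursive_fun k A" "recursive_fun k B"
  shows "recursive_fun k (\<lambda>xs. A xs + B xs)"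
proof -
  have 1: "rec_nat b (\<lambda>n r. Suc r) a = a + b" for a b :: nat by (induction a) auto
  have "recursive_fun (Suc 1) (\<lambda>xs. rec_nat (tl xs ! 0) (\<lambda>n r. Suc ((n # r # tl xs) ! 1)) (hd xs))"
    by (rule recursive_fun_primrec) (auto intro!: recursive_fun_proj recursive_fun_Suc)
  from recursive_fun_comp2[OF this[unfolded Suc_1] assms] show ?thesis by (simp add: 1)
qed

lemma recursive_fun_diff:
  assumes "recursive_fun k A" "recursive_fun k B"
  shows "recursive_fun k (\<lambda>xs. A xs - B xs)"
proof -
  have 1: "rec_nat b (\<lambda>n r. r - Suc 0) a = b - a" for a b :: nat by (induction a) auto
  have "recursive_fun (Suc 1) (\<lambda>xs. rec_nat (tl xs ! 0) (\<lambda>n r. (n # r # tl xs) ! 1 - 1) (hd xs))"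
    by (rule recursive_fun_primrec) (auto intro!: recursive_fun_proj recursive_fun_pred simp del: One_nat_def)
  from recursive_fun_comp2[OF this[unfolded Suc_1] assms(2,1)] show ?thesis by (simp add: 1)
qed

lemma recursive_fun_triangle:
  assumes "recursive_fun k A"
  shows "recursive_fun k (\<lambda>xs. triangle (A xs))"
proof -
  have 1: "rec_nat 0 (\<lambda>n r. Suc n + r) a = triangle a" for a :: nat
    by (induction a) (auto simp: triangle_Suc)
  have "recursive_fun (Suc 0) (\<lambda>xs. rec_nat 0 (\<lambda>n r. Suc ((n # r # tl xs) ! 0) + ((n # r # tl xs) ! 1)) (hd xs))"
    by (rule recursive_fun_primrec[where F = "\<lambda>xs. 0"])
      (intro recursive_fun_const recursive_fun_add recursive_fun_Suc recursive_fun_proj; simp)+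
  from recursive_fun_comp1[OF this[folded One_nat_def] assms] show ?thesis using 1 by simp
qed

text \<open>
  A case distinction is a primitive recursion whose step ignores the previous value.
\<close>

lemma recursive_fun_case_nat:
  assumes "recursive_fun k N" "recursive_fun k A" "recursive_fun (Suc k) B"
  shows "recursive_fun k (\<lambda>xs. case N xs of 0 \<Rightarrow> A xs | Suc m \<Rightarrow> B (m # xs))"
proof -
  have B: "recursive_fun (Suc (Suc k)) (\<lambda>xs. B (hd xs # drop 2 xs))"
  proof (rule recursive_fun_cong)
    show "recursive_fun (Suc (Suc k)) (\<lambda>xs. B (map (\<lambda>g. g xs)
        ((\<lambda>ys. ys ! 0) # map (\<lambda>i ys. ys ! (2 + i)) [0..<k])))"
      by (rule recursive_fun_comp) (auto intro!: recursive_fun_proj assms)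
  next
    fix xs :: "nat list" assume "length xs = Suc (Suc k)"
    then have "map (\<lambda>g. g xs) ((\<lambda>ys. ys ! 0) # map (\<lambda>i ys. ys ! (2 + i)) [0..<k]) = hd xs # drop 2 xs"
      by (intro nth_equalityI) (auto simp: hd_conv_nth nth_Cons length_Suc_conv split: nat.splits)
    then show "B (map (\<lambda>g. g xs) ((\<lambda>ys. ys ! 0) # map (\<lambda>i ys. ys ! (2 + i)) [0..<k])) =
      B (hd xs # drop 2 xs)" by simp
  qed
  have "recursive_fun (Suc k) (\<lambda>xs. rec_nat (A (tl xs)) (\<lambda>n r. B (n # tl xs)) (hd xs))" (is "recursive_fun _ ?R")
    using recursive_fun_primrec[OF assms(2) B] by simp
  then have "recursive_fun k (\<lambda>xs. ?R (map (\<lambda>g. g xs) (N # map (\<lambda>i ys. ys ! i) [0..<k])))"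
    by (intro recursive_fun_comp) (auto intro!: recursive_fun_proj assms)
  then show ?thesis
  proof (rule recursive_fun_cong)
    fix xs :: "nat list" assume "length xs = k"
    then have "map (\<lambda>g. g xs) (map (\<lambda>i ys. ys ! i) [0..<k]) = xs" by (intro nth_equalityI) auto
    then show "?R (map (\<lambda>g. g xs) (N # map (\<lambda>i ys. ys ! i) [0..<k])) =
      (case N xs of 0 \<Rightarrow> A xs | Suc m \<Rightarrow> B (m # xs))" by (simp split: nat.splits)
  qed
qed

lemma triangle_mono: "a \<le> b \<Longrightarrow> triangle a \<le> triangle b"
  unfolding triangle_def by (intro div_le_mono mult_le_mono) auto

text \<open>
  The code of $(x, y)$ is the triangular number of $x + y$ plus $x$, and it lies below the next
  triangular number. So the sum $x + y$ can be found by minimisation, and $x$ and $y$ are then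
  obtained by subtraction.
\<close>

lemma triangle_root:
  "(LEAST s. triangle (Suc s) > prod_encode (x, y)) = x + y"
proof (rule Least_equality)
  show "triangle (Suc (x + y)) > prod_encode (x, y)" by (simp add: prod_encode_def triangle_Suc)
next
  fix s assume s: "prod_encode (x, y) < triangle (Suc s)"
  show "x + y \<le> s"
  proof (rule ccontr)
    assume "\<not> x + y \<le> s"
    then have "triangle (Suc s) \<le> triangle (x + y)" by (intro triangle_mono) auto
    with s show False by (simp add: prod_encode_def)
  qed
qed

lemma recursive_fun_prod_decode:
  assumes "recursive_fun k A"
  shows "recursive_fun k (\<lambda>xs. fst (prod_decode (A xs)))" "recursive_fun k (\<lambda>xs. snd (prod_decode (A xs)))"
proof -
  let ?R = "\<lambda>p. LEAST s. triangle (Suc s) > p"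
  have R: "?R p = fst (prod_decode p) + snd (prod_decode p)" for p
    using triangle_root[of "fst (prod_decode p)" "snd (prod_decode p)"] by simp
  have p: "p = triangle (fst (prod_decode p) + snd (prod_decode p)) + fst (prod_decode p)" for p
    using prod_decode_inverse[of p] by (simp add: prod_encode_def split_beta)
  have "recursive_fun 1 (\<lambda>xs. LEAST s. Suc ((s # xs) ! 1) - triangle (Suc ((s # xs) ! 0)) = 0)"
  proof (rule recursive_fun_Least)
    show "recursive_fun (Suc 1) (\<lambda>xs. Suc (xs ! 1) - triangle (Suc (xs ! 0)))"
      by (intro recursive_fun_diff recursive_fun_Suc recursive_fun_triangle recursive_fun_proj) auto
    show "\<exists>n. Suc ((n # xs) ! 1) - triangle (Suc ((n # xs) ! 0)) = 0" for xs
      by (rule exI[of _ "xs ! 0"]) (simp add: triangle_Suc)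
  qed
  from recursive_fun_comp1[OF this assms]
  have 1: "recursive_fun k (\<lambda>xs. ?R (A xs))"
    by (simp add: less_Suc_eq_le)
  have 2: "recursive_fun k (\<lambda>xs. A xs - triangle (?R (A xs)))"
    by (intro recursive_fun_diff assms recursive_fun_triangle 1)
  have 3: "A xs - triangle (?R (A xs)) = fst (prod_decode (A xs))" for xs
    unfolding R by (subst p) simp
  from 2 show f: "recursive_fun k (\<lambda>xs. fst (prod_decode (A xs)))" unfolding 3 .
  have "recursive_fun k (\<lambda>xs. ?R (A xs) - fst (prod_decode (A xs)))"
    by (intro recursive_fun_diff 1 f)
  then show "recursive_fun k (\<lambda>xs. snd (prod_decode (A xs)))" unfolding R by simp
qed

lemma recursive_fun_prod_encode:
  assumes "recursive_fun k A" "recursive_fun k B"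
  shows "recursive_fun k (\<lambda>xs. prod_encode (A xs, B xs))"
  unfolding prod_encode_def by (auto intro!: recursive_fun_add recursive_fun_triangle assms)

lemma recursive_fun_list_encode_append:
  assumes "recursive_fun k (\<lambda>xs. list_encode (A xs))"
  shows "recursive_fun k (\<lambda>xs. list_encode (us @ A xs))"
  by (induction us) (auto intro!: recursive_fun_Suc recursive_fun_prod_encode recursive_fun_const assms)

text \<open>
  A function given by a finite table and a default value is a nest of case distinctions. The
  table is attached to a list here because that is the form in which the words substituted for
  letters are used.
\<close>

lemma recursive_fun_table_append:
  assumes "recursive_fun k N" "recursive_fun k C"
  shows "recursive_fun k (\<lambda>xs. list_encode ((if N xs < length T then T ! N xs else d) @ list_decode (C xs)))"
  using assms
proof (induction T arbitrary: k N C)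
  case Nil
  then show ?case by (auto intro!: recursive_fun_list_encode_append)
next
  case (Cons t T)
  let ?B = "\<lambda>ys. list_encode ((if ys ! 0 < length T then T ! (ys ! 0) else d) @ list_decode (C (drop 1 ys)))"
  have "recursive_fun (1 + k) (\<lambda>ys. C (drop 1 ys))"
    by (rule recursive_fun_drop[OF Cons.prems(2)])
  then have B: "recursive_fun (Suc k) ?B"
    by (intro Cons.IH recursive_fun_proj) auto
  have "recursive_fun k (\<lambda>xs. case N xs of 0 \<Rightarrow> list_encode (t @ list_decode (C xs)) | Suc m \<Rightarrow> ?B (m # xs))"
    by (rule recursive_fun_case_nat[OF Cons.prems(1) _ B])
      (auto intro!: recursive_fun_list_encode_append Cons.prems)
  then show ?case
    by (rule recursive_fun_cong) (auto split: nat.splits)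
qed

definition code_tl :: "nat \<Rightarrow> nat" where
  "code_tl c = list_encode (tl (list_decode c))"

lemma recursive_fun_code_tl:
  assumes "recursive_fun k A"
  shows "recursive_fun k (\<lambda>xs. code_tl (A xs))"
proof -
  have "recursive_fun k (\<lambda>xs. case A xs of 0 \<Rightarrow> 0 | Suc p \<Rightarrow> snd (prod_decode ((p # xs) ! 0)))"
    by (intro recursive_fun_case_nat recursive_fun_prod_decode recursive_fun_proj recursive_fun_const assms) auto
  moreover have "(case c of 0 \<Rightarrow> 0 | Suc p \<Rightarrow> snd (prod_decode p)) = code_tl c" for c
    by (auto simp: code_tl_def split: nat.splits prod.splits)
  ultimately show ?thesis unfolding nth_Cons_0 by simp
qed

lemma recursive_fun_code_drop:
  assumes "recursive_fun k N" "recursive_fun k A"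
  shows "recursive_fun k (\<lambda>xs. list_encode (drop (N xs) (list_decode (A xs))))"
proof -
  have 1: "rec_nat c (\<lambda>n r. code_tl r) m = list_encode (drop m (list_decode c))" for c m
    by (induction m) (auto simp: code_tl_def drop_Suc tl_drop)
  have "recursive_fun (Suc 1) (\<lambda>xs. rec_nat (tl xs ! 0) (\<lambda>n r. code_tl ((n # r # tl xs) ! 1)) (hd xs))"
    by (rule recursive_fun_primrec) (auto intro!: recursive_fun_proj recursive_fun_code_tl)
  from recursive_fun_comp2[OF this[unfolded Suc_1] assms] show ?thesis by (simp add: 1)
qed

lemma length_le_list_encode: "length xs \<le> list_encode xs"
proof (induction xs)
  case (Cons x xs)
  then show ?case using le_prod_encode_2[of "list_encode xs" x] by simp
qed simp

text \<open>
  Letters are taken from the front of the list and their images are put in front of the result,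
  so the images appear in reverse order. This spares a separate loop for reversing a list: if the
  letters are sent to words for the inverses of their values, then the result stands for
  the inverse of the substituted word, and one is trivial if and only if the other is.
\<close>

lemma recursive_fun_substitute:
  fixes T :: "nat list list" and d :: "nat list"
  defines "U \<equiv> \<lambda>l. if l < length T then T ! l else d"
  shows "recursive_fun 1 (\<lambda>xs. list_encode (concat (rev (map U (list_decode (xs ! 0))))))"
proof -
  let ?step = "\<lambda>n r c. case list_encode (drop n (list_decode c)) of 0 \<Rightarrow> r
    | Suc p \<Rightarrow> list_encode (U (fst (prod_decode p)) @ list_decode r)"
  have step: "?step n r c = list_encode ((if n < length (list_decode c) then U (list_decode c ! n) else []) @ list_decode r)" for n r c
  proof (cases "n < length (list_decode c)")
    case True
    then show ?thesis by (simp flip: Cons_nth_drop_Suc)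
  qed auto
  have iter: "rec_nat 0 (\<lambda>n r. ?step n r c) n = list_encode (concat (rev (map U (take n (list_decode c)))))" for n c
  proof (induction n)
    case (Suc n)
    have "rec_nat 0 (\<lambda>n r. ?step n r c) (Suc n) = ?step n (rec_nat 0 (\<lambda>n r. ?step n r c) n) c"
      by (rule nat.rec)
    also have "\<dots> = ?step n (list_encode (concat (rev (map U (take n (list_decode c)))))) c"
      by (simp only: Suc)
    also have "\<dots> = list_encode (concat (rev (map U (take (Suc n) (list_decode c)))))"
      unfolding step by (cases "n < length (list_decode c)") (auto simp: take_Suc_conv_app_nth)
    finally show ?case .
  qed simp
  have "recursive_fun (Suc 1) (\<lambda>xs. rec_nat 0 (\<lambda>n r. ?step ((n # r # tl xs) ! 0) ((n # r # tl xs) ! 1) ((n # r # tl xs) ! 2)) (hd xs))"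
  proof (rule recursive_fun_primrec[where F = "\<lambda>xs. 0"])
    have "recursive_fun (Suc (Suc (Suc 1))) (\<lambda>xs. list_encode (U (fst (prod_decode (xs ! 0))) @ list_decode (xs ! 2)))"
      unfolding U_def
      by (intro recursive_fun_table_append recursive_fun_prod_decode recursive_fun_proj) auto
    then have "recursive_fun (Suc (Suc 1)) (\<lambda>xs. case list_encode (drop (xs ! 0) (list_decode (xs ! 2))) of 0 \<Rightarrow> xs ! 1
       | Suc p \<Rightarrow> list_encode (U (fst (prod_decode ((p # xs) ! 0))) @ list_decode ((p # xs) ! 2)))"
      by (intro recursive_fun_case_nat recursive_fun_code_drop recursive_fun_proj) auto
    then show "recursive_fun (Suc (Suc 1)) (\<lambda>xs. ?step (xs ! 0) (xs ! 1) (xs ! 2))"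
      by (rule recursive_fun_cong) (simp split: nat.split)
  qed (rule recursive_fun_const)
  then have 2: "recursive_fun 2 (\<lambda>xs. rec_nat 0 (\<lambda>n r. ?step n r (tl xs ! 0)) (hd xs))"
    by (simp add: numeral_2_eq_2 cong: nat.case_cong)
  have "recursive_fun 1 (\<lambda>xs. rec_nat 0 (\<lambda>n r. ?step n r (xs ! 0)) (xs ! 0))"
    using recursive_fun_comp2[OF 2, of 1 "\<lambda>xs. xs ! 0" "\<lambda>xs. xs ! 0"] recursive_fun_proj[of 0 1]
    by simp
  (* the code of a list bounds its length, so that many rounds exhaust the list *)
  then show ?thesis
    unfolding iter using length_le_list_encode[of "list_decode _"] by simp
qed

lemma decidable_set_vimage:
  assumes "decidable_set A" "recursive_fun 1 (\<lambda>xs. F (xs ! 0))"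
  shows "decidable_set (F -` A)"
proof -
  from assms obtain f g where "\<And>n. computes f [n] (if n \<in> A then 1 else 0)"
    "\<And>n. computes g [n] (F n)"
    unfolding decidable_set_def recursive_fun_def by (metis One_nat_def length_Cons list.size(3) nth_Cons_0)
  then have "computes (Comp f [g]) [n] (if n \<in> F -` A then 1 else 0)" for n
    by (intro computes.comp[where ys = "[F n]"]) auto
  then show ?thesis unfolding decidable_set_def by blast
qed

section \<open>Words and free groups\<close>

lemma word_eval_Nil [simp]: "word_eval G a [] = \<one>\<^bsub>G\<^esub>"
  by (simp add: word_eval_def)

lemma word_eval_Cons [simp]:
  "word_eval G a ((i, b) # w) = (if b then a i else inv\<^bsub>G\<^esub> (a i)) \<otimes>\<^bsub>G\<^esub> word_eval G a w"
  by (simp add: word_eval_def)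

lemma words_over_Nil [simp]: "[] \<in> words_over n"
  and words_over_Cons [simp]: "(i, b) # w \<in> words_over n \<longleftrightarrow> i < n \<and> w \<in> words_over n"
  and words_over_append [simp]: "u @ v \<in> words_over n \<longleftrightarrow> u \<in> words_over n \<and> v \<in> words_over n"
  by (auto simp: words_over_def)

context group
begin

lemma word_eval_closed:
  assumes "a ` {..<n} \<subseteq> carrier G" "w \<in> words_over n"
  shows "word_eval G a w \<in> carrier G"
  using assms(2)
proof (induction w)
  case (Cons l w)
  obtain i b where l: "l = (i, b)" by force
  then have "a i \<in> carrier G" using Cons.prems assms(1) by auto
  with Cons show ?case by (auto simp: l)
qed simp

lemma word_eval_append:
  assumes "a ` {..<n} \<subseteq> carrier G" "u \<in> words_over n" "v \<in> words_over n"
  shows "word_eval G a (u @ v) = word_eval G a u \<otimes> word_eval G a v"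
  using assms(2)
proof (induction u)
  case (Cons l u)
  obtain i b where l: "l = (i, b)" by force
  have "a i \<in> carrier G" using Cons.prems assms(1) l by auto
  with Cons show ?case
    using word_eval_closed[OF assms(1)] assms(3) by (auto simp: l m_assoc)
qed (use word_eval_closed[OF assms(1,3)] in auto)

lemma word_eval_inverse:
  assumes "a ` {..<n} \<subseteq> carrier G" "w \<in> words_over n"
  shows "word_eval G a (rev (map inv_letter w)) = inv (word_eval G a w)"
    and "rev (map inv_letter w) \<in> words_over n"
  using assms(2)
proof (induction w)
  case Nil
  { case 1 show ?case by simp }
  { case 2 show ?case by simp }
next
  case (Cons l w)
  obtain i b where l: "l = (i, b)" by force
  { case 2 with Cons(2) show ?case by (auto simp: l inv_letter_def) }
  { case 1
    then have ai: "a i \<in> carrier G" using assms(1) l by auto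
    with 1 Cons show ?case
      using word_eval_closed[OF assms(1)]
      by (auto simp: l inv_letter_def word_eval_append[OF assms(1)] inv_mult_group) }
qed

lemma generate_words:
  assumes "a ` {..<n} \<subseteq> carrier G"
  shows "generate G (a ` {..<n}) = word_eval G a ` words_over n"
proof
  show "generate G (a ` {..<n}) \<subseteq> word_eval G a ` words_over n"
  proof
    fix x assume "x \<in> generate G (a ` {..<n})"
    then show "x \<in> word_eval G a ` words_over n"
    proof induction
      case one
      show ?case by (rule image_eqI[of _ _ "[]"]) auto
    next
      case (incl h)
      then obtain i where "i < n" "h = a i" by auto
      with assms show ?case by (intro image_eqI[of _ _ "[(i, True)]"]) auto
    next
      case (inv h)
      then obtain i where "i < n" "h = a i" by auto
      with assms show ?case by (intro image_eqI[of _ _ "[(i, False)]"]) auto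
    next
      case (eng h1 h2)
      then obtain u v where "u \<in> words_over n" "v \<in> words_over n" "h1 = word_eval G a u" "h2 = word_eval G a v"
        by auto
      then show ?case using assms by (intro image_eqI[of _ _ "u @ v"]) (auto simp: word_eval_append)
    qed
  qed
  show "word_eval G a ` words_over n \<subseteq> generate G (a ` {..<n})"
  proof (intro image_subsetI)
    fix w assume "w \<in> words_over n"
    then show "word_eval G a w \<in> generate G (a ` {..<n})"
    proof (induction w)
      case (Cons l w)
      obtain i b where l: "l = (i, b)" by force
      show ?case using Cons
        by (auto simp: l intro!: generate.eng intro: generate.incl generate.inv)
    qed (simp add: generate.one)
  qed
qed

end

lemma word_eval_hom:
  assumes "group G" "group H" "f \<in> hom G H" "a ` {..<n} \<subseteq> carrier G" "w \<in> words_over n"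
  shows "f (word_eval G a w) = word_eval H (\<lambda>i. f (a i)) w"
proof -
  interpret f: group_hom G H f using assms by (simp add: group_hom_def group_hom_axioms_def)
  show ?thesis using assms(5)
  proof (induction w)
    case (Cons l w)
    obtain i b where l: "l = (i, b)" by force
    then have "a i \<in> carrier G" "word_eval G a w \<in> carrier G"
      using assms(4) Cons.prems f.G.word_eval_closed[OF assms(4)] by auto
    with Cons show ?case by (auto simp: l)
  qed simp
qed

lemma inv_letter_inv_letter [simp]: "inv_letter (inv_letter l) = l"
  by (simp add: inv_letter_def)

lemma inv_letter_eq_iff [simp]: "inv_letter l = inv_letter m \<longleftrightarrow> l = m"
  by (metis inv_letter_inv_letter)

lemma reduced_Nil [simp]: "reduced []"
  by (simp add: reduced_def)

lemma reduced_Cons: "reduced (l # w) \<longleftrightarrow> reduced w \<and> (w = [] \<or> hd w \<noteq> inv_letter l)"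
proof (cases w)
  case (Cons m v)
  have all_nat: "(\<forall>i. Q i) \<longleftrightarrow> Q 0 \<and> (\<forall>i. Q (Suc i))" for Q :: "nat \<Rightarrow> bool"
    by (auto elim: nat_induct)
  show ?thesis
    unfolding reduced_def Cons by (subst all_nat) (simp add: conj_commute)
qed (simp add: reduced_def)

lemma reduced_append:
  "reduced (u @ v) \<longleftrightarrow> reduced u \<and> reduced v \<and> (u = [] \<or> v = [] \<or> hd v \<noteq> inv_letter (last u))"
  by (induction u) (auto simp: reduced_Cons)

lemma reduced_cons_reduce: "reduced w \<Longrightarrow> reduced (cons_reduce l w)"
  by (cases w) (auto simp: reduced_Cons)

lemma reduced_foldr: "reduced v \<Longrightarrow> reduced (foldr cons_reduce u v)"
  by (induction u) (auto intro: reduced_cons_reduce)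

lemma foldr_cons_reduce_reduced: "reduced (u @ v) \<Longrightarrow> foldr cons_reduce u v = u @ v"
proof (induction u)
  case (Cons l u)
  then show ?case by (cases "u @ v") (auto simp: reduced_Cons)
qed simp

text \<open>
  A letter acts on the reduced words by a permutation, and the inverse letter acts by the inverse
  permutation. This is what makes the multiplication of reduced words associative.
\<close>

lemma cons_reduce_cancel:
  "reduced w \<Longrightarrow> cons_reduce l (cons_reduce (inv_letter l) w) = w"
  by (cases w; cases "tl w") (auto simp: reduced_Cons)

lemma foldr_cons_reduce_cons_reduce:
  "reduced x \<Longrightarrow> reduced w \<Longrightarrow>
    foldr cons_reduce (cons_reduce l x) w = cons_reduce l (foldr cons_reduce x w)"
proof (cases x)
  case (Cons m y)
  assume "reduced w"
  with Cons show ?thesis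
    using cons_reduce_cancel[of "foldr cons_reduce y w" l] reduced_foldr[of w y] by auto
qed auto

lemma foldr_cons_reduce_assoc:
  "reduced v \<Longrightarrow> reduced w \<Longrightarrow>
    foldr cons_reduce (foldr cons_reduce u v) w = foldr cons_reduce u (foldr cons_reduce v w)"
  by (induction u) (auto simp: foldr_cons_reduce_cons_reduce reduced_foldr)

lemma reduced_inverse: "reduced w \<Longrightarrow> reduced (rev (map inv_letter w))"
  by (induction w) (auto simp: reduced_append reduced_Cons last_rev hd_map)

lemma foldr_cons_reduce_inverse: "foldr cons_reduce (rev (map inv_letter w)) w = []"
proof -
  have "foldr cons_reduce (rev (map inv_letter w)) (w @ v) = v" for v
    by (induction w) auto
  from this[of "[]"] show ?thesis by simp
qed

lemma cons_reduce_words_over: "(i, b) # w \<in> words_over n \<Longrightarrow> cons_reduce (i, b) w \<in> words_over n"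
  by (cases w) (auto simp: words_over_def)

lemma foldr_cons_reduce_words_over:
  "u \<in> words_over n \<Longrightarrow> v \<in> words_over n \<Longrightarrow> foldr cons_reduce u v \<in> words_over n"
  by (induction u) (auto intro!: cons_reduce_words_over)

lemma carrier_free_group: "carrier (free_group n) = {w \<in> words_over n. reduced w}"
  and mult_free_group: "u \<otimes>\<^bsub>free_group n\<^esub> v = foldr cons_reduce u v"
  and one_free_group: "\<one>\<^bsub>free_group n\<^esub> = []"
  by (auto simp: free_group_def)

lemmas free_group_simps = carrier_free_group mult_free_group one_free_group

lemma words_over_inverse: "w \<in> words_over n \<Longrightarrow> rev (map inv_letter w) \<in> words_over n"
  by (auto simp: words_over_def inv_letter_def)

text \<open>
  The inverse word is a left inverse because its letters cancel those of the word one by one.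
\<close>

lemma group_free_group: "group (free_group n)"
proof (rule groupI)
  fix x assume "x \<in> carrier (free_group n)"
  then show "\<exists>y\<in>carrier (free_group n). y \<otimes>\<^bsub>free_group n\<^esub> x = \<one>\<^bsub>free_group n\<^esub>"
    by (intro bexI[of _ "rev (map inv_letter x)"])
      (auto simp: free_group_simps foldr_cons_reduce_inverse reduced_inverse words_over_inverse)
qed (auto simp: free_group_simps foldr_cons_reduce_words_over reduced_foldr foldr_cons_reduce_assoc)

lemma (in group) word_eval_foldr_cons_reduce:
  assumes "a ` {..<n} \<subseteq> carrier G" "u \<in> words_over n" "v \<in> words_over n"
  shows "word_eval G a (foldr cons_reduce u v) = word_eval G a u \<otimes> word_eval G a v"
proof -
  have 1: "word_eval G a (cons_reduce l w) = word_eval G a (l # w)" if "l # w \<in> words_over n" for l w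
  proof (cases w)
    case (Cons m y)
    obtain i b where l: "l = (i, b)" by force
    then have "a i \<in> carrier G" "word_eval G a y \<in> carrier G"
      using assms(1) that word_eval_closed[OF assms(1), of y] by (cases m; auto simp: Cons)+
    then show ?thesis
      using m_assoc[of "inv a i" "a i" "word_eval G a y"] m_assoc[of "a i" "inv a i" "word_eval G a y"]
      by (auto simp: Cons l inv_letter_def)
  qed simp
  show ?thesis using assms(2)
  proof (induction u)
    case (Cons l u)
    obtain i b where l: "l = (i, b)" by force
    then have "a i \<in> carrier G"
      using assms(1) Cons.prems by auto
    moreover have "word_eval G a (foldr cons_reduce (l # u) v) = word_eval G a (l # foldr cons_reduce u v)"
      using 1[of l "foldr cons_reduce u v"] Cons.prems assms(3) by (simp add: l foldr_cons_reduce_words_over)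
    ultimately show ?case
      using Cons word_eval_closed[OF assms(1)] assms(3) by (auto simp: l m_assoc)
  qed (use word_eval_closed[OF assms(1,3)] in auto)
qed

lemma (in group) word_eval_free_group_hom:
  assumes "a ` {..<n} \<subseteq> carrier G"
  shows "word_eval G a \<in> hom (free_group n) G"
  using assms by (intro homI) (auto simp: free_group_simps word_eval_closed word_eval_foldr_cons_reduce)

lemma inv_free_group_letter:
  assumes "i < n"
  shows "inv\<^bsub>free_group n\<^esub> [(i, b)] = [inv_letter (i, b)]"
proof -
  interpret group "free_group n" by (rule group_free_group)
  show ?thesis using assms
    by (intro inv_equality) (auto simp: free_group_simps reduced_Cons inv_letter_def)
qed

lemma word_eval_free_group:
  assumes "w \<in> carrier (free_group n)"
  shows "word_eval (free_group n) (\<lambda>i. [(i, True)]) w = w"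
proof -
  have inv: "inv\<^bsub>free_group n\<^esub> [(i, True)] = [(i, False)]" if "i < n" for i
    using inv_free_group_letter[OF that] by (simp add: inv_letter_def)
  show ?thesis using assms
  proof (induction w)
    case (Cons l w)
    obtain i b where l: "l = (i, b)" by force
    then show ?case using Cons foldr_cons_reduce_reduced[of "[l]" w]
      by (auto simp: inv free_group_simps reduced_Cons)
  qed (simp add: free_group_simps)
qed

section \<open>Presentations\<close>

text \<open>
  A presentation is expressed by the kernel of the evaluation at the generators \<open>k\<close>, and not by an
  isomorphism with a quotient of the free group: maps out of \<open>K\<close> are constructed from words, and
  this needs to know just which words have equal values.
\<close>

definition presentation :: "('a, 'b) monoid_scheme \<Rightarrow> nat \<Rightarrow> gword set \<Rightarrow> (nat \<Rightarrow> 'a) \<Rightarrow> bool" where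
  "presentation K n R k \<longleftrightarrow> k ` {..<n} \<subseteq> carrier K \<and> generate K (k ` {..<n}) = carrier K \<and>
    R \<subseteq> carrier (free_group n) \<and>
    (\<forall>w\<in>carrier (free_group n). word_eval K k w = \<one>\<^bsub>K\<^esub> \<longleftrightarrow> w \<in> normal_closure (free_group n) R)"

lemma normal_closure_normal:
  assumes "group F" "R \<subseteq> carrier F"
  shows "normal_closure F R \<lhd> F" "R \<subseteq> normal_closure F R"
proof -
  interpret group F by fact
  have ne: "carrier F \<in> {N. N \<lhd> F \<and> R \<subseteq> N}"
    using assms normal_self by auto
  have "subgroup (normal_closure F R) F"
    unfolding normal_closure_def
    by (rule subgroups_Inter) (use ne in \<open>auto dest: normal_imp_subgroup\<close>)
  then show "normal_closure F R \<lhd> F"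
    unfolding normal_inv_iff normal_closure_def using normal_inv_iff by auto
  show "R \<subseteq> normal_closure F R" by (auto simp: normal_closure_def)
qed

lemma normal_closure_minimal: "N \<lhd> F \<Longrightarrow> R \<subseteq> N \<Longrightarrow> normal_closure F R \<subseteq> N"
  by (auto simp: normal_closure_def)

lemma (in group) word_eval_normal_closure:
  assumes "b ` {..<n} \<subseteq> carrier G" "R \<subseteq> carrier (free_group n)" "\<And>r. r \<in> R \<Longrightarrow> word_eval G b r = \<one>"
    and "w \<in> normal_closure (free_group n) R"
  shows "word_eval G b w = \<one>"
proof -
  interpret h: group_hom "free_group n" G "word_eval G b"
    using group_free_group word_eval_free_group_hom[OF assms(1)]
    by (simp add: group_hom_def group_hom_axioms_def is_group)
  have "normal_closure (free_group n) R \<subseteq> kernel (free_group n) G (word_eval G b)"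
    by (rule normal_closure_minimal) (use assms(2,3) h.normal_kernel in \<open>auto simp: kernel_def\<close>)
  with assms(4) show ?thesis by (auto simp: kernel_def)
qed

lemma (in group) generate_reduced_words:
  assumes "a ` {..<n} \<subseteq> carrier G"
  shows "generate G (a ` {..<n}) = word_eval G a ` carrier (free_group n)"
proof -
  have "word_eval G a w \<in> word_eval G a ` carrier (free_group n)" if "w \<in> words_over n" for w
    using that word_eval_foldr_cons_reduce[OF assms that, of "[]"] word_eval_closed[OF assms that]
    by (intro image_eqI[of _ _ "foldr cons_reduce w []"])
      (auto simp: free_group_simps reduced_foldr foldr_cons_reduce_words_over)
  then show ?thesis unfolding generate_words[OF assms] by (auto simp: free_group_simps)
qed

text \<open>
  Von Dyck's theorem. Each element of \<open>K\<close> is the value of a word, and it is sent to the value of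
  the same word in \<open>L\<close>. The choice of the word does not matter: two choices differ by an
  element of the normal closure of \<open>R\<close>, which is contained in the kernel of the evaluation in \<open>L\<close>.
\<close>

lemma von_Dyck:
  assumes K: "group K" "presentation K n R k" and L: "group L" "b ` {..<n} \<subseteq> carrier L"
    and R: "\<And>r. r \<in> R \<Longrightarrow> word_eval L b r = \<one>\<^bsub>L\<^esub>"
  obtains h where "h \<in> hom K L" "\<And>w. w \<in> words_over n \<Longrightarrow> h (word_eval K k w) = word_eval L b w"
proof -
  let ?F = "free_group n"
  interpret K: group K by fact
  interpret L: group L by fact
  interpret F: group ?F by (rule group_free_group)
  have k: "k ` {..<n} \<subseteq> carrier K" and RF: "R \<subseteq> carrier ?F"
    and gen: "carrier K = word_eval K k ` carrier ?F"
    and ker: "\<And>w. w \<in> carrier ?F \<Longrightarrow> word_eval K k w = \<one>\<^bsub>K\<^esub> \<Longrightarrow> w \<in> normal_closure ?F R"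
    using K(2) K.generate_reduced_words unfolding presentation_def by auto
  interpret k: group_hom ?F K "word_eval K k"
    using K.word_eval_free_group_hom[OF k] by unfold_locales
  interpret l: group_hom ?F L "word_eval L b"
    using L.word_eval_free_group_hom[OF L(2)] by unfold_locales
  define h where "h x = word_eval L b (SOME w. w \<in> carrier ?F \<and> word_eval K k w = x)" for x
  have h: "h (word_eval K k w) = word_eval L b w" if "w \<in> carrier ?F" for w
  proof -
    define v where "v = (SOME v. v \<in> carrier ?F \<and> word_eval K k v = word_eval K k w)"
    have v: "v \<in> carrier ?F" "word_eval K k v = word_eval K k w"
      using someI[of "\<lambda>v. v \<in> carrier ?F \<and> word_eval K k v = word_eval K k w" w] that
      unfolding v_def by auto
    have "word_eval K k (w \<otimes>\<^bsub>?F\<^esub> inv\<^bsub>?F\<^esub> v) = \<one>\<^bsub>K\<^esub>" using v that by simp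
    then have "word_eval L b (w \<otimes>\<^bsub>?F\<^esub> inv\<^bsub>?F\<^esub> v) = \<one>\<^bsub>L\<^esub>"
      using v that by (intro L.word_eval_normal_closure[OF L(2) RF R] ker) auto
    then have "word_eval L b w = word_eval L b v"
      using v that by (simp add: L.inv_solve_right' l.hom_closed)
    then show ?thesis by (simp add: h_def v_def)
  qed
  show ?thesis
  proof (rule that[of h])
    show "h \<in> hom K L"
    proof (rule homI)
      fix x assume "x \<in> carrier K"
      then show "h x \<in> carrier L" by (auto simp: gen h)
    next
      fix x y assume "x \<in> carrier K" "y \<in> carrier K"
      then obtain u v where "u \<in> carrier ?F" "v \<in> carrier ?F" "x = word_eval K k u" "y = word_eval K k v"
        by (auto simp: gen)
      then show "h (x \<otimes>\<^bsub>K\<^esub> y) = h x \<otimes>\<^bsub>L\<^esub> h y"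
        by (simp flip: k.hom_mult add: h)
    qed
  next
    fix w assume w: "w \<in> words_over n"
    let ?w = "foldr cons_reduce w []"
    have "?w \<in> carrier ?F" using w by (auto simp: free_group_simps reduced_foldr foldr_cons_reduce_words_over)
    from h[OF this] show "h (word_eval K k w) = word_eval L b w"
      using w K.word_eval_foldr_cons_reduce[OF k w, of "[]"] L.word_eval_foldr_cons_reduce[OF L(2) w, of "[]"]
        K.word_eval_closed[OF k w] L.word_eval_closed[OF L(2) w] by auto
  qed
qed

lemma carrier_Mod: "carrier (G Mod N) = (\<lambda>x. N #>\<^bsub>G\<^esub> x) ` carrier G"
  by (auto simp: FactGroup_def RCOSETS_def)

lemma presentation_of_iso:
  assumes K: "group K" and R: "R \<subseteq> carrier (free_group n)"
    and f: "f \<in> iso (free_group n Mod normal_closure (free_group n) R) K"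
  shows "\<exists>k. presentation K n R k"
proof -
  let ?F = "free_group n" and ?N = "normal_closure (free_group n) R"
  interpret K: group K by fact
  interpret F: group ?F by (rule group_free_group)
  interpret N: normal ?N ?F by (rule normal_closure_normal[OF group_free_group R])
  define g where "g w = f (?N #>\<^bsub>?F\<^esub> w)" for w
  have fhom: "f \<in> hom (?F Mod ?N) K" and finj: "inj_on f (carrier (?F Mod ?N))"
    and fsurj: "f ` carrier (?F Mod ?N) = carrier K"
    using f by (auto simp: iso_def bij_betw_def)
  have g: "g \<in> hom ?F K"
    using hom_compose[OF N.r_coset_hom_Mod fhom] by (simp add: g_def[abs_def] comp_def)
  interpret g: group_hom ?F K g by unfold_locales (rule g)
  have gker: "g w = \<one>\<^bsub>K\<^esub> \<longleftrightarrow> w \<in> ?N" if w: "w \<in> carrier ?F" for w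
  proof -
    have "f ?N = \<one>\<^bsub>K\<^esub>" using g.hom_one by (simp add: g_def F.coset_mult_one N.subset)
    moreover have "?N \<in> carrier (?F Mod ?N)" "?N #>\<^bsub>?F\<^esub> w \<in> carrier (?F Mod ?N)"
      using w N.subgroup_in_rcosets[OF F.is_group] by (auto simp: FactGroup_def RCOSETS_def)
    ultimately have "g w = \<one>\<^bsub>K\<^esub> \<longleftrightarrow> ?N #>\<^bsub>?F\<^esub> w = ?N"
      using inj_on_eq_iff[OF finj] unfolding g_def by metis
    also have "\<dots> \<longleftrightarrow> w \<in> ?N"
      using w by (metis F.coset_join1 F.coset_join2 N.subgroup_axioms)
    finally show ?thesis .
  qed
  have gsurj: "g ` carrier ?F = carrier K"
    unfolding g_def fsurj[symmetric] carrier_Mod image_image ..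
  define k where "k i = g [(i, True)]" for i
  have gens: "(\<lambda>i. [(i, True)]) ` {..<n} \<subseteq> carrier ?F"
    by (auto simp: free_group_simps reduced_Cons)
  have eval: "word_eval K k w = g w" if "w \<in> carrier ?F" for w
    using word_eval_hom[OF F.is_group K g gens, of w] word_eval_free_group[OF that] that
    by (simp add: k_def[abs_def] free_group_simps)
  have k: "k ` {..<n} \<subseteq> carrier K" using gens by (auto simp: k_def)
  have "generate K (k ` {..<n}) = g ` carrier ?F"
    unfolding K.generate_reduced_words[OF k] by (rule image_cong[OF refl eval])
  then have "presentation K n R k"
    unfolding presentation_def using k gsurj R by (simp add: eval gker)
  then show ?thesis by blast
qed

lemma finitely_presented_presentation:
  assumes "group K" "finitely_presented K"
  obtains n R k where "finite R" "presentation K n R k"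
proof -
  obtain n R where R: "finite R" "R \<subseteq> carrier (free_group n)"
    "K \<cong> free_group n Mod normal_closure (free_group n) R"
    using assms(2) unfolding finitely_presented_def by blast
  then obtain f where "f \<in> iso (free_group n Mod normal_closure (free_group n) R) K"
    using group.iso_sym[OF assms(1)] by (auto simp: is_iso_def)
  from presentation_of_iso[OF assms(1) R(2) this] R(1) that show ?thesis by blast
qed

lemma image_group_iso:
  assumes "group G" "inj_on f (carrier G)"
  shows "group (image_group f G)" "f \<in> iso G (image_group f G)"
  using group.inj_imp_image_group_is_group[OF assms] inj_imp_image_group_iso[OF assms(2)]
  by this+

text \<open>
  The quotient of a free group consists of sets of words; being countable, it has a copy
  whose elements are natural numbers.
\<close>

lemma finitely_presented_nat_group:
  assumes "finite R" "R \<subseteq> carrier (free_group n)"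
  obtains G :: "nat monoid" and k where "group G" "finitely_presented G" "presentation G n R k"
proof -
  let ?F = "free_group n" and ?N = "normal_closure (free_group n) R"
  interpret N: normal ?N ?F by (rule normal_closure_normal[OF group_free_group assms(2)])
  have "countable (carrier (?F Mod ?N))"
    unfolding carrier_Mod by (rule countable_image) (rule countableI_type)
  then obtain f :: "gword set \<Rightarrow> nat" where f: "inj_on f (carrier (?F Mod ?N))"
    unfolding countable_def by blast
  let ?G = "image_group f (?F Mod ?N)"
  have G: "group ?G" "f \<in> iso (?F Mod ?N) ?G"
    using image_group_iso[OF N.factorgroup_is_group f] by auto
  have "?G \<cong> ?F Mod ?N"
    using G group.iso_sym[OF N.factorgroup_is_group] by (auto simp: is_iso_def)
  then have "finitely_presented ?G" using assms unfolding finitely_presented_def by blast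
  with presentation_of_iso[OF G(1) assms(2) G(2)] G(1) that show ?thesis by blast
qed

section \<open>Direct products\<close>

lemma group_hom_subgroup_image:
  assumes "group_hom M G f" "subgroup K M"
  shows "f \<in> epi (M\<lparr>carrier := K\<rparr>) (G\<lparr>carrier := f ` K\<rparr>)" "subgroup (f ` K) G"
proof -
  interpret group_hom M G f by fact
  show "subgroup (f ` K) G" by (rule subgroup_img_is_subgroup[OF assms(2)])
  show "f \<in> epi (M\<lparr>carrier := K\<rparr>) (G\<lparr>carrier := f ` K\<rparr>)"
    using subgroup.subset[OF assms(2)] by (auto simp: epi_def subset_iff intro!: homI)
qed

lemma finitely_generated_image:
  assumes "group K" "group L" "f \<in> epi K L" "finitely_generated K"
  shows "finitely_generated L"
proof -
  interpret group_hom K L f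
    using assms by (auto simp: group_hom_def group_hom_axioms_def epi_def)
  obtain S where S: "S \<subseteq> carrier K" "finite S" "generate K S = carrier K"
    using assms(4) unfolding finitely_generated_def by blast
  have "generate L (f ` S) = carrier L"
    using generate_img[OF S(1)] S(3) assms(3) by (auto simp: epi_def)
  with S show ?thesis unfolding finitely_generated_def by (intro exI[of _ "f ` S"]) auto
qed

text \<open>
  The kernel of the composite $K \to L \to L / N \cong \mathbf{Z}$ is the required normal subgroup.
\<close>

lemma infinite_cyclic_quotient_pullback:
  assumes "group K" "group L" "f \<in> epi K L" "N \<lhd> L" "L Mod N \<cong> integer_group"
  shows "\<exists>N'. N' \<lhd> K \<and> K Mod N' \<cong> integer_group"
proof -
  interpret N: normal N L by fact
  obtain \<phi> where \<phi>: "\<phi> \<in> iso (L Mod N) integer_group" using assms(5) by (auto simp: is_iso_def)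
  define g where "g = \<phi> \<circ> (\<lambda>x. N #>\<^bsub>L\<^esub> x) \<circ> f"
  have f: "f \<in> hom K L" "f ` carrier K = carrier L" using assms(3) by (auto simp: epi_def)
  have "g \<in> hom K integer_group"
    unfolding g_def using \<phi> N.r_coset_hom_Mod f by (intro hom_compose) (auto simp: iso_def)
  then interpret g: group_hom K integer_group g
    using assms(1) by (simp add: group_hom_def group_hom_axioms_def)
  have "g ` carrier K = \<phi> ` carrier (L Mod N)"
    unfolding g_def image_comp[symmetric] f(2) carrier_Mod ..
  also have "\<dots> = carrier integer_group" using \<phi> by (auto simp: iso_def bij_betw_def)
  finally show ?thesis using g.FactGroup_iso g.normal_kernel by blast
qed

lemma locally_indicable_pullback:
  assumes f: "group_hom M G f" and G: "locally_indicable G"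
    and K: "subgroup K M" "finitely_generated (M\<lparr>carrier := K\<rparr>)" and x: "x \<in> K" "f x \<noteq> \<one>\<^bsub>G\<^esub>"
  shows "\<exists>N. N \<lhd> M\<lparr>carrier := K\<rparr> \<and> M\<lparr>carrier := K\<rparr> Mod N \<cong> integer_group"
proof -
  interpret group_hom M G f by fact
  let ?K = "M\<lparr>carrier := K\<rparr>" and ?L = "G\<lparr>carrier := f ` K\<rparr>"
  have e: "f \<in> epi ?K ?L" "subgroup (f ` K) G" using group_hom_subgroup_image[OF f K(1)] .
  have grp: "group ?K" "group ?L"
    using G.subgroup_imp_group[OF K(1)] H.subgroup_imp_group[OF e(2)] by auto
  have "finitely_generated ?L" by (rule finitely_generated_image[OF grp e(1) K(2)])
  moreover have "f ` K \<noteq> {\<one>\<^bsub>G\<^esub>}" using x by auto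
  ultimately obtain N where "N \<lhd> ?L" "?L Mod N \<cong> integer_group"
    using G e(2) unfolding locally_indicable_def by blast
  from infinite_cyclic_quotient_pullback[OF grp e(1) this] show ?thesis .
qed

lemma no_free_subgroup_hom:
  assumes f: "group_hom (free_group 2) G f" and G: "no_free_subgroup G"
  shows "\<exists>u\<in>carrier (free_group 2). u \<noteq> \<one>\<^bsub>free_group 2\<^esub> \<and> f u = \<one>\<^bsub>G\<^esub>"
proof (rule ccontr)
  interpret group_hom "free_group 2" G f by fact
  assume *: "\<not> ?thesis"
  then have "inj_on f (carrier (free_group 2))"
    by (intro inj_on_one_iff[THEN iffD2]) auto
  then have "f \<in> iso (free_group 2) (G\<lparr>carrier := f ` carrier (free_group 2)\<rparr>)"
    by (auto simp: iso_def bij_betw_def hom_def)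
  then have "G\<lparr>carrier := f ` carrier (free_group 2)\<rparr> \<cong> free_group 2"
    using G.iso_sym by (auto simp: is_iso_def)
  with G img_is_subgroup show False unfolding no_free_subgroup_def by blast
qed

text \<open>
  If the letter $c$ is neither the inverse of the first letter of $u$ nor equal to its last
  letter, then $c u c^{-1}$ is reduced as it stands. Among the four letters there are suitable letters $c$
  for $u$ and $d \neq c$ for $v$. The products of $c u c^{-1}$ and $d v d^{-1}$ in either order are then
  reduced words, and they start with different letters.
\<close>

lemma free_group_2_noncommuting_conjugates:
  assumes u: "u \<in> carrier (free_group 2)" "u \<noteq> \<one>\<^bsub>free_group 2\<^esub>"
    and v: "v \<in> carrier (free_group 2)" "v \<noteq> \<one>\<^bsub>free_group 2\<^esub>"
  shows "\<exists>c\<in>carrier (free_group 2). \<exists>d\<in>carrier (free_group 2).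
    (c \<otimes>\<^bsub>free_group 2\<^esub> u \<otimes>\<^bsub>free_group 2\<^esub> inv\<^bsub>free_group 2\<^esub> c) \<otimes>\<^bsub>free_group 2\<^esub>
    (d \<otimes>\<^bsub>free_group 2\<^esub> v \<otimes>\<^bsub>free_group 2\<^esub> inv\<^bsub>free_group 2\<^esub> d) \<noteq>
    (d \<otimes>\<^bsub>free_group 2\<^esub> v \<otimes>\<^bsub>free_group 2\<^esub> inv\<^bsub>free_group 2\<^esub> d) \<otimes>\<^bsub>free_group 2\<^esub>
    (c \<otimes>\<^bsub>free_group 2\<^esub> u \<otimes>\<^bsub>free_group 2\<^esub> inv\<^bsub>free_group 2\<^esub> c)"
proof -
  define L where "L = {..<2::nat} \<times> (UNIV :: bool set)"
  have card_L: "card L = 4" and fin: "finite L" by (auto simp: L_def card_cartesian_product)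
  have pick: "\<exists>l\<in>L. l \<notin> set ls" if "length ls \<le> 3" for ls :: "letter list"
  proof -
    have "card (set ls) \<le> 3" using card_length[of ls] that by linarith
    with card_L have "\<not> L \<subseteq> set ls" using card_mono[of "set ls" L] by fastforce
    then show ?thesis by blast
  qed
  obtain c where c: "c \<in> L" "c \<noteq> inv_letter (hd u)" "c \<noteq> last u"
    using pick[of "[inv_letter (hd u), last u]"] by auto
  obtain d where d: "d \<in> L" "d \<noteq> inv_letter (hd v)" "d \<noteq> last v" "d \<noteq> c"
    using pick[of "[inv_letter (hd v), last v, c]"] by auto
  have conj: "[c] \<otimes>\<^bsub>free_group 2\<^esub> u \<otimes>\<^bsub>free_group 2\<^esub> inv\<^bsub>free_group 2\<^esub> [c] = c # u @ [inv_letter c]"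
    "reduced (c # u @ [inv_letter c])"
    if "u \<in> carrier (free_group 2)" "u \<noteq> []" "c \<in> L" "c \<noteq> inv_letter (hd u)" "c \<noteq> last u" for c u
  proof -
    have red: "reduced u" using that by (simp add: free_group_simps)
    have "hd u \<noteq> inv_letter c" using that(4) inv_letter_inv_letter by metis
    with red that show 1: "reduced (c # u @ [inv_letter c])"
      by (auto simp: reduced_Cons reduced_append)
    have "inv\<^bsub>free_group 2\<^esub> [c] = [inv_letter c]"
      using that(3) inv_free_group_letter[of "fst c" 2 "snd c"] by (auto simp: L_def)
    moreover have "foldr cons_reduce [c] u = c # u"
      using foldr_cons_reduce_reduced[of "[c]" u] 1 that(2) by (auto simp: reduced_Cons reduced_append)
    moreover have "foldr cons_reduce (c # u) [inv_letter c] = c # u @ [inv_letter c]"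
      using foldr_cons_reduce_reduced[of "c # u" "[inv_letter c]"] 1 by simp
    ultimately show "[c] \<otimes>\<^bsub>free_group 2\<^esub> u \<otimes>\<^bsub>free_group 2\<^esub> inv\<^bsub>free_group 2\<^esub> [c] = c # u @ [inv_letter c]"
      by (simp add: mult_free_group del: foldr.simps)
  qed
  let ?u = "c # u @ [inv_letter c]" and ?v = "d # v @ [inv_letter d]"
  have ne: "u \<noteq> []" "v \<noteq> []" using u v by (auto simp: one_free_group)
  note cu = conj[OF u(1) ne(1) c] and dv = conj[OF v(1) ne(2) d(1-3)]
  have "reduced (?u @ ?v)" "reduced (?v @ ?u)"
    unfolding reduced_append[of ?u ?v] reduced_append[of ?v ?u] using cu(2) dv(2) d(4) by auto
  then have "?u \<otimes>\<^bsub>free_group 2\<^esub> ?v = ?u @ ?v" "?v \<otimes>\<^bsub>free_group 2\<^esub> ?u = ?v @ ?u"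
    using foldr_cons_reduce_reduced by (auto simp only: mult_free_group)
  then have "?u \<otimes>\<^bsub>free_group 2\<^esub> ?v \<noteq> ?v \<otimes>\<^bsub>free_group 2\<^esub> ?u" using d(4) by simp
  moreover have "[c] \<in> carrier (free_group 2)" "[d] \<in> carrier (free_group 2)"
    using c d by (auto simp: carrier_free_group reduced_Cons L_def words_over_def)
  ultimately show ?thesis using cu(1) dv(1) by metis
qed

lemma words_over_bound: "\<exists>n. w \<in> words_over n"
proof -
  have "finite (fst ` set w)" by simp
  then obtain n where "\<forall>i\<in>fst ` set w. i < n" using finite_nat_set_iff_bounded by blast
  then show ?thesis by (intro exI[of _ n]) (force simp: words_over_def)
qed

text \<open>
  The permutation $(a, b) \mapsto (\sigma a, \tau b)$ of the pairs with $a < n$ and $b < m$, where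
  $(a, b)$ is coded by $a m + b$.
\<close>

definition prod_perm :: "nat \<Rightarrow> nat \<Rightarrow> (nat \<Rightarrow> nat) \<Rightarrow> (nat \<Rightarrow> nat) \<Rightarrow> nat \<Rightarrow> nat" where
  "prod_perm n m \<sigma> \<tau> i = (if i < n * m then \<sigma> (i div m) * m + \<tau> (i mod m) else i)"

lemma encode_less: "a < n \<Longrightarrow> b < m \<Longrightarrow> a * m + b < n * (m :: nat)"
proof -
  assume "a < n" "b < m"
  then have "a * m + b < Suc a * m" by simp
  also have "\<dots> \<le> n * m" using \<open>a < n\<close> by (intro mult_le_mono) auto
  finally show ?thesis .
qed

lemma decode_less: "i < n * m \<Longrightarrow> i div m < n" "i < n * m \<Longrightarrow> i mod m < (m :: nat)"
  by (simp add: less_mult_imp_div_less) (cases "m = 0"; simp)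

lemma encode_eq_iff: "b < m \<Longrightarrow> d < m \<Longrightarrow> a * m + b = c * m + d \<longleftrightarrow> a = c \<and> b = (d :: nat)"
proof
  assume lt: "b < m" "d < m" and e: "a * m + b = c * m + d"
  have "(a * m + b) div m = a" "(a * m + b) mod m = b" "(c * m + d) div m = c" "(c * m + d) mod m = d"
    using lt by auto
  with e show "a = c \<and> b = d" by metis
qed simp

lemma permutes_lessThan: "\<sigma> permutes {..<n} \<Longrightarrow> i < n \<Longrightarrow> \<sigma> i < (n :: nat)"
  using permutes_in_image[of \<sigma> "{..<n}" i] by simp

lemma prod_perm_less:
  assumes "\<sigma> permutes {..<n}" "\<tau> permutes {..<m}" "i < n * m"
  shows "prod_perm n m \<sigma> \<tau> i < n * m"
proof -
  have "\<sigma> (i div m) < n" "\<tau> (i mod m) < m"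
    by (rule permutes_lessThan[OF assms(1) decode_less(1)[OF assms(3)]]
      permutes_lessThan[OF assms(2) decode_less(2)[OF assms(3)]])+
  with assms(3) show ?thesis by (simp add: prod_perm_def encode_less)
qed

lemma prod_perm_eq_iff:
  assumes "\<tau> permutes {..<m}" "\<tau>' permutes {..<m}" "i < n * m" "j < n * m"
  shows "prod_perm n m \<sigma> \<tau> i = prod_perm n m \<sigma>' \<tau>' j \<longleftrightarrow>
    \<sigma> (i div m) = \<sigma>' (j div m) \<and> \<tau> (i mod m) = \<tau>' (j mod m)"
proof -
  have "\<tau> (i mod m) < m" "\<tau>' (j mod m) < m"
    by (rule permutes_lessThan[OF assms(1) decode_less(2)[OF assms(3)]]
      permutes_lessThan[OF assms(2) decode_less(2)[OF assms(4)]])+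
  with assms(3,4) show ?thesis by (simp add: prod_perm_def encode_eq_iff)
qed

lemma prod_perm_permutes:
  assumes "\<sigma> permutes {..<n}" "\<tau> permutes {..<m}"
  shows "prod_perm n m \<sigma> \<tau> permutes {..<n * m}"
proof (rule bij_imp_permutes)
  have "inj_on (prod_perm n m \<sigma> \<tau>) {..<n * m}"
  proof (rule inj_onI)
    fix i j assume "i \<in> {..<n * m}" "j \<in> {..<n * m}" "prod_perm n m \<sigma> \<tau> i = prod_perm n m \<sigma> \<tau> j"
    then have "\<sigma> (i div m) = \<sigma> (j div m)" "\<tau> (i mod m) = \<tau> (j mod m)"
      using prod_perm_eq_iff[OF assms(2,2), of i n j \<sigma> \<sigma>] by simp_all
    then have "i div m = j div m" "i mod m = j mod m"
      using injD[OF permutes_inj[OF assms(1)]] injD[OF permutes_inj[OF assms(2)]] by blast+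
    then show "i = j" by (metis div_mult_mod_eq)
  qed
  then show "bij_betw (prod_perm n m \<sigma> \<tau>) {..<n * m} {..<n * m}"
    using prod_perm_less[OF assms] by (intro bij_betw_imageI endo_inj_surj) auto
qed (simp add: prod_perm_def)

lemma prod_perm_comp:
  assumes "\<sigma> permutes {..<n}" "\<tau> permutes {..<m}"
  shows "prod_perm n m \<sigma>' \<tau>' \<circ> prod_perm n m \<sigma> \<tau> = prod_perm n m (\<sigma>' \<circ> \<sigma>) (\<tau>' \<circ> \<tau>)"
proof
  fix i
  show "(prod_perm n m \<sigma>' \<tau>' \<circ> prod_perm n m \<sigma> \<tau>) i = prod_perm n m (\<sigma>' \<circ> \<sigma>) (\<tau>' \<circ> \<tau>) i"
  proof (cases "i < n * m")
    case True
    have "\<tau> (i mod m) < m" by (rule permutes_lessThan[OF assms(2) decode_less(2)[OF True]])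
    with True prod_perm_less[OF assms True] show ?thesis by (simp add: prod_perm_def)
  qed (simp add: prod_perm_def)
qed

lemma card_div_mod:
  "card {i. i < n * m \<and> Q (i div m) (i mod m)} = card {(a, b). a < n \<and> b < (m :: nat) \<and> Q a b}"
proof (rule bij_betw_same_card)
  show "bij_betw (\<lambda>i. (i div m, i mod m)) {i. i < n * m \<and> Q (i div m) (i mod m)} {(a, b). a < n \<and> b < m \<and> Q a b}"
    by (rule bij_betw_byWitness[where f' = "\<lambda>(a, b). a * m + b"])
      (auto simp: decode_less(1) encode_less dest: decode_less(2))
qed

lemma hamming_dist_prod_perm:
  assumes "\<tau> permutes {..<m}" "\<tau>' permutes {..<m}"
  shows "hamming_dist (n * m) (prod_perm n m \<sigma> \<tau>) (prod_perm n m \<sigma>' \<tau>') =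
    card {(a, b). a < n \<and> b < m \<and> (\<sigma> a \<noteq> \<sigma>' a \<or> \<tau> b \<noteq> \<tau>' b)} / real (n * m)"
proof -
  have "{i. i < n * m \<and> prod_perm n m \<sigma> \<tau> i \<noteq> prod_perm n m \<sigma>' \<tau>' i} =
    {i. i < n * m \<and> (\<sigma> (i div m) \<noteq> \<sigma>' (i div m) \<or> \<tau> (i mod m) \<noteq> \<tau>' (i mod m))}"
    by (rule Collect_cong) (simp add: prod_perm_eq_iff[OF assms] cong: conj_cong)
  then show ?thesis
    unfolding hamming_dist_def
    using card_div_mod[of n m "\<lambda>a b. \<sigma> a \<noteq> \<sigma>' a \<or> \<tau> b \<noteq> \<tau>' b"] by simp
qed

text \<open>
  A pair is moved differently only if one of its components is.
\<close>

lemma hamming_dist_prod_perm_le: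
  assumes "n > 0" "m > 0" "\<tau> permutes {..<m}" "\<tau>' permutes {..<m}"
  shows "hamming_dist (n * m) (prod_perm n m \<sigma> \<tau>) (prod_perm n m \<sigma>' \<tau>') \<le>
    hamming_dist n \<sigma> \<sigma>' + hamming_dist m \<tau> \<tau>'"
proof -
  let ?A = "{a. a < n \<and> \<sigma> a \<noteq> \<sigma>' a}" and ?B = "{b. b < m \<and> \<tau> b \<noteq> \<tau>' b}"
  have "card {(a, b). a < n \<and> b < m \<and> (\<sigma> a \<noteq> \<sigma>' a \<or> \<tau> b \<noteq> \<tau>' b)} \<le> card (?A \<times> {..<m} \<union> {..<n} \<times> ?B)"
    by (rule card_mono) auto
  also have "\<dots> \<le> card ?A * m + n * card ?B"
    using card_Un_le[of "?A \<times> {..<m}" "{..<n} \<times> ?B"] by (simp add: card_cartesian_product)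
  finally have "real (card {(a, b). a < n \<and> b < m \<and> (\<sigma> a \<noteq> \<sigma>' a \<or> \<tau> b \<noteq> \<tau>' b)}) / real (n * m) \<le>
      real (card ?A * m + n * card ?B) / real (n * m)"
    by (intro divide_right_mono) (simp_all only: of_nat_le_iff of_nat_0_le_iff)
  also have "\<dots> = card ?A / n + card ?B / m" using assms by (simp add: field_simps)
  finally show ?thesis
    unfolding hamming_dist_prod_perm[OF assms(3,4)] hamming_dist_def[of n] hamming_dist_def[of m] .
qed

lemma hamming_dist_prod_perm_ge:
  assumes "n > 0" "m > 0" "\<sigma> permutes {..<n}" "\<sigma>' permutes {..<n}" "\<tau> permutes {..<m}" "\<tau>' permutes {..<m}"
  shows "hamming_dist n \<sigma> \<sigma>' \<le> hamming_dist (n * m) (prod_perm n m \<sigma> \<tau>) (prod_perm n m \<sigma>' \<tau>')"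
    and "hamming_dist m \<tau> \<tau>' \<le> hamming_dist (n * m) (prod_perm n m \<sigma> \<tau>) (prod_perm n m \<sigma>' \<tau>')"
proof -
  let ?A = "{a. a < n \<and> \<sigma> a \<noteq> \<sigma>' a}" and ?B = "{b. b < m \<and> \<tau> b \<noteq> \<tau>' b}"
  let ?C = "{(a, b). a < n \<and> b < m \<and> (\<sigma> a \<noteq> \<sigma>' a \<or> \<tau> b \<noteq> \<tau>' b)}"
  have fin: "finite ?C" by (rule finite_subset[of _ "{..<n} \<times> {..<m}"]) auto
  have "card (?A \<times> {..<m}) \<le> card ?C" "card ({..<n} \<times> ?B) \<le> card ?C"
    by (rule card_mono[OF fin]; force)+
  then have "card ?A * m \<le> card ?C" "n * card ?B \<le> card ?C" by (simp_all add: card_cartesian_product)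
  then have "real (card ?A * m) / (n * m) \<le> card ?C / (n * m)" "real (n * card ?B) / (n * m) \<le> card ?C / (n * m)"
    by (intro divide_right_mono; simp only: of_nat_le_iff of_nat_0_le_iff)+
  then show "hamming_dist n \<sigma> \<sigma>' \<le> hamming_dist (n * m) (prod_perm n m \<sigma> \<tau>) (prod_perm n m \<sigma>' \<tau>')"
    "hamming_dist m \<tau> \<tau>' \<le> hamming_dist (n * m) (prod_perm n m \<sigma> \<tau>) (prod_perm n m \<sigma>' \<tau>')"
    unfolding hamming_dist_prod_perm[OF assms(5,6)] using assms(1,2) by (simp_all add: hamming_dist_def)
qed

lemma soficE:
  assumes G: "sofic G" and F: "finite F" "F \<subseteq> carrier G" "\<epsilon> > 0"
  obtains n \<phi> where "n > 0" "\<And>g. g \<in> carrier G \<Longrightarrow> \<phi> g permutes {..<n}"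
    "\<And>g h. g \<in> F \<Longrightarrow> h \<in> F \<Longrightarrow> hamming_dist n (\<phi> (g \<otimes>\<^bsub>G\<^esub> h)) (\<phi> g \<circ> \<phi> h) < \<epsilon>"
    "\<And>g. g \<in> F - {\<one>\<^bsub>G\<^esub>} \<Longrightarrow> hamming_dist n (\<phi> g) id > 1 - \<epsilon>"
proof -
  have "\<exists>n>0. \<exists>\<phi>. (\<forall>g\<in>carrier G. \<phi> g permutes {..<n}) \<and>
      (\<forall>g\<in>F. \<forall>h\<in>F. hamming_dist n (\<phi> (g \<otimes>\<^bsub>G\<^esub> h)) (\<phi> g \<circ> \<phi> h) < \<epsilon>) \<and>
      (\<forall>g\<in>F - {\<one>\<^bsub>G\<^esub>}. hamming_dist n (\<phi> g) id > 1 - \<epsilon>)"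
    using G[unfolded sofic_def, THEN spec, THEN spec, THEN mp] F by blast
  then obtain n \<phi> where "n > 0" and 1: "\<forall>g\<in>carrier G. \<phi> g permutes {..<n}"
    and 2: "\<forall>g\<in>F. \<forall>h\<in>F. hamming_dist n (\<phi> (g \<otimes>\<^bsub>G\<^esub> h)) (\<phi> g \<circ> \<phi> h) < \<epsilon>"
    and 3: "\<forall>g\<in>F - {\<one>\<^bsub>G\<^esub>}. hamming_dist n (\<phi> g) id > 1 - \<epsilon>" by blast
  show ?thesis
    by (rule that[OF \<open>n > 0\<close>]) (use 1 2 3 in \<open>blast+\<close>)
qed

definition invariant_mean :: "('a, 'b) monoid_scheme \<Rightarrow> (('a \<Rightarrow> real) \<Rightarrow> real) \<Rightarrow> bool" where
  "invariant_mean G m \<longleftrightarrow> (let B = {f :: 'a \<Rightarrow> real. bounded (f ` carrier G)} in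
      (\<forall>f\<in>B. \<forall>h\<in>B. m (\<lambda>x. f x + h x) = m f + m h) \<and>
      (\<forall>f\<in>B. \<forall>c. m (\<lambda>x. c * f x) = c * m f) \<and>
      (\<forall>f\<in>B. (\<forall>x\<in>carrier G. 0 \<le> f x) \<longrightarrow> 0 \<le> m f) \<and>
      m (\<lambda>x. 1) = 1 \<and>
      (\<forall>f\<in>B. \<forall>g\<in>carrier G. m (\<lambda>x. f (g \<otimes>\<^bsub>G\<^esub> x)) = m f))"

lemma amenable_iff: "amenable G \<longleftrightarrow> (\<exists>m. invariant_mean G m)"
  by (simp add: amenable_def invariant_mean_def)

context
  fixes G (structure) and m
  assumes m: "invariant_mean G m"
begin

lemma mean_add: "bounded (f ` carrier G) \<Longrightarrow> bounded (h ` carrier G) \<Longrightarrow> m (\<lambda>x. f x + h x) = m f + m h"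
  and mean_scale: "bounded (f ` carrier G) \<Longrightarrow> m (\<lambda>x. c * f x) = c * m f"
  and mean_nonneg: "bounded (f ` carrier G) \<Longrightarrow> (\<And>x. x \<in> carrier G \<Longrightarrow> 0 \<le> f x) \<Longrightarrow> 0 \<le> m f"
  and mean_one: "m (\<lambda>x. 1) = 1"
  and mean_invariant: "bounded (f ` carrier G) \<Longrightarrow> g \<in> carrier G \<Longrightarrow> m (\<lambda>x. f (g \<otimes> x)) = m f"
  using m unfolding invariant_mean_def Let_def by auto

lemma mean_mono:
  assumes "bounded (f ` carrier G)" "bounded (h ` carrier G)" "\<And>x. x \<in> carrier G \<Longrightarrow> f x \<le> h x"
  shows "m f \<le> m h"
proof -
  have b: "bounded ((\<lambda>x. (-1) * f x) ` carrier G)" using assms(1) by (auto simp: bounded_iff)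
  have "0 \<le> m (\<lambda>x. h x + (-1) * f x)"
    by (rule mean_nonneg[OF bounded_plus_comp[OF assms(2) b]]) (use assms(3) in auto)
  also have "\<dots> = m h - m f"
    unfolding mean_add[OF assms(2) b] mean_scale[OF assms(1)] by simp
  finally show ?thesis by simp
qed

lemma mean_cong:
  assumes "bounded (f ` carrier G)" "\<And>x. x \<in> carrier G \<Longrightarrow> f x = h x"
  shows "m f = m h"
proof -
  have "f ` carrier G = h ` carrier G" using assms(2) by (intro image_cong) auto
  with assms show ?thesis by (intro antisym mean_mono) auto
qed

lemma mean_abs_le:
  assumes "\<And>x. x \<in> carrier G \<Longrightarrow> \<bar>f x\<bar> \<le> C"
  shows "\<bar>m f\<bar> \<le> C"
proof -
  have const: "m (\<lambda>x. c) = c" for c using mean_scale[of "\<lambda>x. 1" c] mean_one by (simp add: image_constant_conv)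
  have bc: "bounded ((\<lambda>x. c) ` carrier G)" for c :: real by (simp add: image_constant_conv)
  have bf: "bounded (f ` carrier G)" using assms by (auto simp: bounded_iff)
  have "m f \<le> C" using mean_mono[OF bf bc[of C]] assms const by fastforce
  moreover have "- C \<le> m f" using mean_mono[OF bc[of "- C"] bf] assms const by fastforce
  ultimately show ?thesis by linarith
qed

end

lemma unique_productE:
  assumes "unique_product G" "finite X \<and> X \<noteq> {} \<and> X \<subseteq> carrier G \<and> finite Y \<and> Y \<noteq> {} \<and> Y \<subseteq> carrier G"
  obtains a b where "a \<in> X" "b \<in> Y"
    "\<And>a' b'. a' \<in> X \<Longrightarrow> b' \<in> Y \<Longrightarrow> a' \<otimes>\<^bsub>G\<^esub> b' = a \<otimes>\<^bsub>G\<^esub> b \<Longrightarrow> a' = a \<and> b' = b"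
proof -
  obtain z where "\<exists>!u. u \<in> X \<times> Y \<and> fst u \<otimes>\<^bsub>G\<^esub> snd u = z"
    using assms(1)[unfolded unique_product_def, THEN spec, THEN spec, THEN mp, OF assms(2)] ..
  then obtain u where u: "u \<in> X \<times> Y \<and> fst u \<otimes>\<^bsub>G\<^esub> snd u = z"
    and unique: "\<And>v. v \<in> X \<times> Y \<and> fst v \<otimes>\<^bsub>G\<^esub> snd v = z \<Longrightarrow> v = u"
    by (elim ex1E) blast
  show ?thesis
  proof (rule that[of "fst u" "snd u"])
    fix a b assume "a \<in> X" "b \<in> Y" "a \<otimes>\<^bsub>G\<^esub> b = fst u \<otimes>\<^bsub>G\<^esub> snd u"
    then have "(a, b) = u" using u by (intro unique) simp
    then show "a = fst u \<and> b = snd u" by auto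
  qed (use u in \<open>auto simp: mem_Times_iff\<close>)
qed

text \<open>
  The two homomorphisms embed \<open>M\<close> in the direct product of \<open>G\<close> and \<open>H\<close>. Working with them in
  place of the product itself makes the results below apply to isomorphic copies of products
  as well, in particular to copies on the natural numbers.
\<close>

locale joint_embedding =
  M: group M + G: group G + H: group H + p: group_hom M G p + q: group_hom M H q
  for M (structure) and G (structure) and H (structure) and p and q +
  assumes joint_kernel: "\<lbrakk>x \<in> carrier M; p x = \<one>\<^bsub>G\<^esub>; q x = \<one>\<^bsub>H\<^esub>\<rbrakk> \<Longrightarrow> x = \<one>\<^bsub>M\<^esub>"
begin

lemma joint_inj:
  assumes "x \<in> carrier M" "y \<in> carrier M" "p x = p y" "q x = q y"
  shows "x = y"
proof -
  have "x \<otimes>\<^bsub>M\<^esub> inv\<^bsub>M\<^esub> y = \<one>\<^bsub>M\<^esub>"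
    by (rule joint_kernel) (use assms in auto)
  with assms show ?thesis by (simp add: M.inv_solve_right')
qed

lemma torsion_free:
  assumes "torsion_free G" "torsion_free H"
  shows "torsion_free M"
  unfolding torsion_free_def
proof (intro ballI allI impI)
  fix x and n :: nat assume x: "x \<in> carrier M" and n: "n > 0 \<and> x [^]\<^bsub>M\<^esub> n = \<one>\<^bsub>M\<^esub>"
  then have "p x [^]\<^bsub>G\<^esub> n = \<one>\<^bsub>G\<^esub>" "q x [^]\<^bsub>H\<^esub> n = \<one>\<^bsub>H\<^esub>"
    by (simp_all flip: p.hom_nat_pow q.hom_nat_pow)
  then have "p x = \<one>\<^bsub>G\<^esub>" "q x = \<one>\<^bsub>H\<^esub>"
    using assms[unfolded torsion_free_def, rule_format, of _ n] x n p.hom_closed q.hom_closed by blast+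
  with x show "x = \<one>\<^bsub>M\<^esub>" by (rule joint_kernel)
qed

text \<open>
  A unique product is chosen for the images under \<open>p\<close>, and then one for the images under \<open>q\<close> of those
  elements of \<open>X\<close> and \<open>Y\<close> that lie over its two factors.
\<close>

lemma unique_product:
  assumes G: "unique_product G" and H: "unique_product H"
  shows "unique_product M"
  unfolding unique_product_def
proof (intro allI impI)
  fix X Y
  assume XY: "finite X \<and> X \<noteq> {} \<and> X \<subseteq> carrier M \<and> finite Y \<and> Y \<noteq> {} \<and> Y \<subseteq> carrier M"
  then have "finite (p ` X) \<and> p ` X \<noteq> {} \<and> p ` X \<subseteq> carrier G \<and> finite (p ` Y) \<and> p ` Y \<noteq> {} \<and> p ` Y \<subseteq> carrier G"
    by auto
  then obtain a b where ab: "a \<in> p ` X" "b \<in> p ` Y"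
    and ab_unique: "\<And>a' b'. a' \<in> p ` X \<Longrightarrow> b' \<in> p ` Y \<Longrightarrow> a' \<otimes>\<^bsub>G\<^esub> b' = a \<otimes>\<^bsub>G\<^esub> b \<Longrightarrow> a' = a \<and> b' = b"
    by (rule unique_productE[OF G]) blast
  define X' where "X' = {x \<in> X. p x = a}"
  define Y' where "Y' = {y \<in> Y. p y = b}"
  have "finite (q ` X') \<and> q ` X' \<noteq> {} \<and> q ` X' \<subseteq> carrier H \<and> finite (q ` Y') \<and> q ` Y' \<noteq> {} \<and> q ` Y' \<subseteq> carrier H"
    using XY ab by (auto simp: X'_def Y'_def)
  then obtain c d where cd: "c \<in> q ` X'" "d \<in> q ` Y'"
    and cd_unique: "\<And>c' d'. c' \<in> q ` X' \<Longrightarrow> d' \<in> q ` Y' \<Longrightarrow> c' \<otimes>\<^bsub>H\<^esub> d' = c \<otimes>\<^bsub>H\<^esub> d \<Longrightarrow> c' = c \<and> d' = d"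
    by (rule unique_productE[OF H]) blast
  then obtain x y where xy: "x \<in> X'" "y \<in> Y'" "c = q x" "d = q y" by blast
  show "\<exists>z. \<exists>!u. u \<in> X \<times> Y \<and> fst u \<otimes>\<^bsub>M\<^esub> snd u = z"
  proof (rule exI[of _ "x \<otimes>\<^bsub>M\<^esub> y"], rule ex1I[of _ "(x, y)"])
    show "(x, y) \<in> X \<times> Y \<and> fst (x, y) \<otimes>\<^bsub>M\<^esub> snd (x, y) = x \<otimes>\<^bsub>M\<^esub> y"
      using xy by (auto simp: X'_def Y'_def)
  next
    fix u assume u: "u \<in> X \<times> Y \<and> fst u \<otimes>\<^bsub>M\<^esub> snd u = x \<otimes>\<^bsub>M\<^esub> y"
    obtain x' y' where u': "u = (x', y')" by force
    have in_X: "x \<in> X" "p x = a" "y \<in> Y" "p y = b" using xy by (auto simp: X'_def Y'_def)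
    have carr: "x \<in> carrier M" "y \<in> carrier M" "x' \<in> carrier M" "y' \<in> carrier M"
      using u u' in_X XY by auto
    have e: "x' \<otimes>\<^bsub>M\<^esub> y' = x \<otimes>\<^bsub>M\<^esub> y" using u u' by simp
    have "p x' \<otimes>\<^bsub>G\<^esub> p y' = a \<otimes>\<^bsub>G\<^esub> b"
      using arg_cong[OF e, of p] carr in_X by simp
    then have p': "p x' = a" "p y' = b" using ab_unique[of "p x'" "p y'"] u u' by auto
    then have "x' \<in> X'" "y' \<in> Y'" using u u' by (auto simp: X'_def Y'_def)
    moreover have "q x' \<otimes>\<^bsub>H\<^esub> q y' = c \<otimes>\<^bsub>H\<^esub> d"
      using arg_cong[OF e, of q] carr xy by simp
    ultimately have q': "q x' = c" "q y' = d" using cd_unique[of "q x'" "q y'"] by blast+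
    show "u = (x, y)"
      using joint_inj[of x' x] joint_inj[of y' y] carr p' q' in_X xy u' by simp
  qed
qed

text \<open>
  A nontrivial subgroup has a nontrivial image in one of the factors, and infinite cyclic quotients of
  the image are quotients of the subgroup.
\<close>

lemma locally_indicable:
  assumes "locally_indicable G" "locally_indicable H"
  shows "locally_indicable M"
  unfolding locally_indicable_def
proof (intro allI impI)
  fix K assume K: "subgroup K M \<and> finitely_generated (M\<lparr>carrier := K\<rparr>) \<and> K \<noteq> {\<one>\<^bsub>M\<^esub>}"
  have "\<one>\<^bsub>M\<^esub> \<in> K" "K \<subseteq> carrier M"
    using K subgroup.one_closed[of K M] subgroup.subset[of K M] by auto
  with K obtain x where x: "x \<in> K" "x \<noteq> \<one>\<^bsub>M\<^esub>" "x \<in> carrier M" by blast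
  then consider "p x \<noteq> \<one>\<^bsub>G\<^esub>" | "q x \<noteq> \<one>\<^bsub>H\<^esub>" using joint_kernel by blast
  then show "\<exists>N. N \<lhd> M\<lparr>carrier := K\<rparr> \<and> M\<lparr>carrier := K\<rparr> Mod N \<cong> integer_group"
  proof cases
    case 1
    with K x show ?thesis using locally_indicable_pullback[OF p.group_hom_axioms assms(1)] by blast
  next
    case 2
    with K x show ?thesis using locally_indicable_pullback[OF q.group_hom_axioms assms(2)] by blast
  qed
qed

definition lex_order where
  "lex_order R S = {(x, y). x \<in> carrier M \<and> y \<in> carrier M \<and>
    (if p x = p y then (q x, q y) \<in> S else (p x, p y) \<in> R)}"

lemma linear_order_lex_order:
  assumes R: "linear_order_on (carrier G) R" and S: "linear_order_on (carrier H) S"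
  shows "linear_order_on (carrier M) (lex_order R S)"
proof -
  have R': "trans R" "antisym R" "total_on (carrier G) R" "refl_on (carrier G) R"
    and S': "trans S" "antisym S" "total_on (carrier H) S" "refl_on (carrier H) S"
    using R S by (auto simp: order_on_defs)
  have "trans (lex_order R S)"
  proof (rule transI)
    fix x y z assume "(x, y) \<in> lex_order R S" "(y, z) \<in> lex_order R S"
    then show "(x, z) \<in> lex_order R S"
      using transD[OF R'(1), of "p x" "p y" "p z"] transD[OF S'(1), of "q x" "q y" "q z"]
        antisymD[OF R'(2), of "p x" "p y"]
      by (auto simp: lex_order_def split: if_splits)
  qed
  moreover have "antisym (lex_order R S)"
  proof (rule antisymI)
    fix x y assume "(x, y) \<in> lex_order R S" "(y, x) \<in> lex_order R S"
    then show "x = y"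
      using antisymD[OF R'(2), of "p x" "p y"] antisymD[OF S'(2), of "q x" "q y"] joint_inj[of x y]
      by (auto simp: lex_order_def split: if_splits)
  qed
  moreover have "total_on (carrier M) (lex_order R S)"
  proof (rule total_onI)
    fix x y assume xy: "x \<in> carrier M" "y \<in> carrier M" "x \<noteq> y"
    show "(x, y) \<in> lex_order R S \<or> (y, x) \<in> lex_order R S"
    proof (cases "p x = p y")
      case True
      with xy have "q x \<noteq> q y" using joint_inj by blast
      with xy True show ?thesis using S'(3) by (auto simp: lex_order_def total_on_def)
    next
      case False
      with xy show ?thesis using R'(3) by (auto simp: lex_order_def total_on_def)
    qed
  qed
  moreover have "refl_on (carrier M) (lex_order R S)"
    using S'(4) by (auto simp: lex_order_def refl_on_def)
  moreover have "lex_order R S \<subseteq> carrier M \<times> carrier M"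
    by (auto simp: lex_order_def)
  ultimately show ?thesis by (simp add: order_on_defs)
qed

lemma left_orderable:
  assumes "left_orderable G" "left_orderable H"
  shows "left_orderable M"
proof -
  obtain R S where R: "linear_order_on (carrier G) R" and S: "linear_order_on (carrier H) S"
    and R': "\<And>a b c. \<lbrakk>a \<in> carrier G; b \<in> carrier G; c \<in> carrier G; (a, b) \<in> R\<rbrakk> \<Longrightarrow> (c \<otimes>\<^bsub>G\<^esub> a, c \<otimes>\<^bsub>G\<^esub> b) \<in> R"
    and S': "\<And>a b c. \<lbrakk>a \<in> carrier H; b \<in> carrier H; c \<in> carrier H; (a, b) \<in> S\<rbrakk> \<Longrightarrow> (c \<otimes>\<^bsub>H\<^esub> a, c \<otimes>\<^bsub>H\<^esub> b) \<in> S"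
    using assms unfolding left_orderable_def by blast
  show ?thesis unfolding left_orderable_def
    by (intro exI[of _ "lex_order R S"] conjI linear_order_lex_order[OF R S] ballI impI)
      (auto simp: lex_order_def R' S' split: if_splits)
qed

lemma biorderable:
  assumes "biorderable G" "biorderable H"
  shows "biorderable M"
proof -
  obtain R S where R: "linear_order_on (carrier G) R" and S: "linear_order_on (carrier H) S"
    and R': "\<And>a b c. \<lbrakk>a \<in> carrier G; b \<in> carrier G; c \<in> carrier G; (a, b) \<in> R\<rbrakk> \<Longrightarrow>
      (c \<otimes>\<^bsub>G\<^esub> a, c \<otimes>\<^bsub>G\<^esub> b) \<in> R \<and> (a \<otimes>\<^bsub>G\<^esub> c, b \<otimes>\<^bsub>G\<^esub> c) \<in> R"
    and S': "\<And>a b c. \<lbrakk>a \<in> carrier H; b \<in> carrier H; c \<in> carrier H; (a, b) \<in> S\<rbrakk> \<Longrightarrow>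
      (c \<otimes>\<^bsub>H\<^esub> a, c \<otimes>\<^bsub>H\<^esub> b) \<in> S \<and> (a \<otimes>\<^bsub>H\<^esub> c, b \<otimes>\<^bsub>H\<^esub> c) \<in> S"
    using assms unfolding biorderable_def by blast
  show ?thesis unfolding biorderable_def
    by (intro exI[of _ "lex_order R S"] conjI linear_order_lex_order[OF R S] ballI impI)
      (auto simp: lex_order_def R' S' split: if_splits)
qed

text \<open>
  If \<open>M\<close> contains a copy of the free group and neither projection is injective on it, then there are
  nontrivial elements $u$ and $v$ that are killed by \<open>p\<close> and by \<open>q\<close>, respectively. Each conjugate of $u$
  commutes with each conjugate of $v$ in both factors, hence in \<open>M\<close>, which is impossible in a
  free group of rank two.
\<close>

lemma no_free_subgroup:
  assumes "no_free_subgroup G" "no_free_subgroup H"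
  shows "no_free_subgroup M"
  unfolding no_free_subgroup_def
proof
  let ?F = "free_group 2"
  interpret F: group ?F by (rule group_free_group)
  assume "\<exists>K. subgroup K M \<and> M\<lparr>carrier := K\<rparr> \<cong> ?F"
  then obtain K where K: "subgroup K M" "M\<lparr>carrier := K\<rparr> \<cong> ?F" by blast
  then obtain f where f: "f \<in> iso ?F (M\<lparr>carrier := K\<rparr>)"
    using group.iso_sym[OF M.subgroup_imp_group[OF K(1)]] by (auto simp: is_iso_def)
  have fhom: "f \<in> hom ?F M" and finj: "inj_on f (carrier ?F)"
    using f subgroup.subset[OF K(1)] by (auto simp: iso_def bij_betw_def hom_def)
  interpret f: group_hom ?F M f by unfold_locales (rule fhom)
  interpret pf: group_hom ?F G "p \<circ> f" by unfold_locales (rule hom_compose[OF fhom p.homh])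
  interpret qf: group_hom ?F H "q \<circ> f" by unfold_locales (rule hom_compose[OF fhom q.homh])
  obtain u where u: "u \<in> carrier ?F" "u \<noteq> \<one>\<^bsub>?F\<^esub>" "p (f u) = \<one>\<^bsub>G\<^esub>"
    using no_free_subgroup_hom[OF pf.group_hom_axioms assms(1)] by auto
  obtain v where v: "v \<in> carrier ?F" "v \<noteq> \<one>\<^bsub>?F\<^esub>" "q (f v) = \<one>\<^bsub>H\<^esub>"
    using no_free_subgroup_hom[OF qf.group_hom_axioms assms(2)] by auto
  obtain c d where cd: "c \<in> carrier ?F" "d \<in> carrier ?F"
    and nc: "(c \<otimes>\<^bsub>?F\<^esub> u \<otimes>\<^bsub>?F\<^esub> inv\<^bsub>?F\<^esub> c) \<otimes>\<^bsub>?F\<^esub> (d \<otimes>\<^bsub>?F\<^esub> v \<otimes>\<^bsub>?F\<^esub> inv\<^bsub>?F\<^esub> d)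
      \<noteq> (d \<otimes>\<^bsub>?F\<^esub> v \<otimes>\<^bsub>?F\<^esub> inv\<^bsub>?F\<^esub> d) \<otimes>\<^bsub>?F\<^esub> (c \<otimes>\<^bsub>?F\<^esub> u \<otimes>\<^bsub>?F\<^esub> inv\<^bsub>?F\<^esub> c)" (is "?l \<noteq> ?r")
    using free_group_2_noncommuting_conjugates[OF u(1,2) v(1,2)] by blast
  have "p (f ?l) = p (f ?r)" "q (f ?l) = q (f ?r)"
    using u v cd by simp_all
  then have "f ?l = f ?r" by (rule joint_inj[rotated 2]) (use u v cd in auto)
  with nc show False using inj_onD[OF finj] u v cd by blast
qed

text \<open>
  The product action of two approximations: the defects of multiplicativity add up, and the distance from
  the identity is at least the distance in either coordinate. Hence $\varepsilon / 2$ in both factors suffices.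
\<close>

lemma sofic:
  assumes G: "sofic G" and H: "sofic H"
  shows "sofic M"
  unfolding sofic_def
proof (intro allI impI)
  fix F and \<epsilon> :: real assume F: "finite F \<and> F \<subseteq> carrier M \<and> \<epsilon> > 0"
  obtain n \<phi> where n: "n > 0" and \<phi>: "\<And>g. g \<in> carrier G \<Longrightarrow> \<phi> g permutes {..<n}"
    and \<phi>mult: "\<And>g h. g \<in> p ` F \<Longrightarrow> h \<in> p ` F \<Longrightarrow> hamming_dist n (\<phi> (g \<otimes>\<^bsub>G\<^esub> h)) (\<phi> g \<circ> \<phi> h) < \<epsilon> / 2"
    and \<phi>ne: "\<And>g. g \<in> p ` F - {\<one>\<^bsub>G\<^esub>} \<Longrightarrow> hamming_dist n (\<phi> g) id > 1 - \<epsilon> / 2"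
    by (rule soficE[OF G, of "p ` F" "\<epsilon> / 2"]) (use F in auto)
  obtain m \<psi> where m: "m > 0" and \<psi>: "\<And>g. g \<in> carrier H \<Longrightarrow> \<psi> g permutes {..<m}"
    and \<psi>mult: "\<And>g h. g \<in> q ` F \<Longrightarrow> h \<in> q ` F \<Longrightarrow> hamming_dist m (\<psi> (g \<otimes>\<^bsub>H\<^esub> h)) (\<psi> g \<circ> \<psi> h) < \<epsilon> / 2"
    and \<psi>ne: "\<And>g. g \<in> q ` F - {\<one>\<^bsub>H\<^esub>} \<Longrightarrow> hamming_dist m (\<psi> g) id > 1 - \<epsilon> / 2"
    by (rule soficE[OF H, of "q ` F" "\<epsilon> / 2"]) (use F in auto)
  define \<theta> where "\<theta> x = prod_perm n m (\<phi> (p x)) (\<psi> (q x))" for x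
  have perm: "\<theta> x permutes {..<n * m}" if "x \<in> carrier M" for x
    unfolding \<theta>_def using that by (intro prod_perm_permutes \<phi> \<psi>) auto
  have mult: "hamming_dist (n * m) (\<theta> (x \<otimes>\<^bsub>M\<^esub> y)) (\<theta> x \<circ> \<theta> y) < \<epsilon>" if xy: "x \<in> F" "y \<in> F" for x y
  proof -
    have carr: "x \<in> carrier M" "y \<in> carrier M" using F xy by auto
    have "hamming_dist (n * m) (\<theta> (x \<otimes>\<^bsub>M\<^esub> y)) (\<theta> x \<circ> \<theta> y) \<le>
      hamming_dist n (\<phi> (p x \<otimes>\<^bsub>G\<^esub> p y)) (\<phi> (p x) \<circ> \<phi> (p y)) +
      hamming_dist m (\<psi> (q x \<otimes>\<^bsub>H\<^esub> q y)) (\<psi> (q x) \<circ> \<psi> (q y))"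
      unfolding \<theta>_def using carr n m
      by (subst prod_perm_comp) (auto intro!: hamming_dist_prod_perm_le \<phi> \<psi> permutes_compose)
    also have "\<dots> < \<epsilon> / 2 + \<epsilon> / 2"
      using xy by (intro add_strict_mono \<phi>mult \<psi>mult) auto
    finally show ?thesis by simp
  qed
  have ne: "hamming_dist (n * m) (\<theta> x) id > 1 - \<epsilon>" if x: "x \<in> F - {\<one>\<^bsub>M\<^esub>}" for x
  proof -
    have carr: "x \<in> carrier M" using F x by auto
    have id: "id = prod_perm n m id id" by (auto simp: prod_perm_def)
    have ge: "hamming_dist (n * m) (\<theta> x) id \<ge> hamming_dist n (\<phi> (p x)) id"
      "hamming_dist (n * m) (\<theta> x) id \<ge> hamming_dist m (\<psi> (q x)) id"
      unfolding \<theta>_def using hamming_dist_prod_perm_ge[OF n m \<phi> permutes_id \<psi> permutes_id, of "p x" "q x", folded id] carr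
      by auto
    have "p x \<noteq> \<one>\<^bsub>G\<^esub> \<or> q x \<noteq> \<one>\<^bsub>H\<^esub>" using joint_kernel[OF carr] x by auto
    with \<phi>ne[of "p x"] \<psi>ne[of "q x"] x ge F show ?thesis by auto
  qed
  show "\<exists>n>0. \<exists>\<phi>. (\<forall>g\<in>carrier M. \<phi> g permutes {..<n}) \<and>
      (\<forall>g\<in>F. \<forall>h\<in>F. hamming_dist n (\<phi> (g \<otimes>\<^bsub>M\<^esub> h)) (\<phi> g \<circ> \<phi> h) < \<epsilon>) \<and>
      (\<forall>g\<in>F - {\<one>\<^bsub>M\<^esub>}. hamming_dist n (\<phi> g) id > 1 - \<epsilon>)"
    using n m by (intro exI[of _ "n * m"] conjI exI[of _ \<theta>] ballI perm mult ne) simp_all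
qed

end

locale direct_product = joint_embedding +
  assumes joint_surj: "\<lbrakk>g \<in> carrier G; h \<in> carrier H\<rbrakk> \<Longrightarrow> \<exists>x\<in>carrier M. p x = g \<and> q x = h"
begin

lemma satisfies_no_law:
  assumes "satisfies_no_law G"
  shows "satisfies_no_law M"
  unfolding satisfies_no_law_def
proof (intro allI impI)
  fix w :: gword assume "reduced w \<and> w \<noteq> []"
  then obtain a where a: "range a \<subseteq> carrier G" "word_eval G a w \<noteq> \<one>\<^bsub>G\<^esub>"
    using assms unfolding satisfies_no_law_def by meson
  have "\<forall>i. \<exists>x\<in>carrier M. p x = a i" using joint_surj[of "a _" "\<one>\<^bsub>H\<^esub>"] a(1) by blast
  then obtain b where b: "\<And>i. b i \<in> carrier M" "\<And>i. p (b i) = a i" by metis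
  obtain n where n: "w \<in> words_over n" using words_over_bound by blast
  have "p (word_eval M b w) = word_eval G a w"
    using word_eval_hom[OF M.is_group G.is_group p.homh _ n, of b] b by auto
  with a(2) b(1) show "\<exists>a. range a \<subseteq> carrier M \<and> word_eval M a w \<noteq> \<one>\<^bsub>M\<^esub>"
    by (intro exI[of _ b]) auto
qed

text \<open>
  The mean of a function is obtained by averaging over \<open>H\<close> in each fibre and then over \<open>G\<close>. Inverting the
  pair of projections by \<open>\<xi>\<close> allows functions on \<open>M\<close> to be treated as functions of two variables.
\<close>

lemma amenable:
  assumes "amenable G" "amenable H"
  shows "amenable M"
proof -
  obtain m\<^sub>G where G: "invariant_mean G m\<^sub>G" using assms(1) unfolding amenable_iff by blast
  obtain m\<^sub>H where H: "invariant_mean H m\<^sub>H" using assms(2) unfolding amenable_iff by blast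
  define \<xi> where "\<xi> g h = (SOME x. x \<in> carrier M \<and> p x = g \<and> q x = h)" for g h
  have \<xi>: "\<xi> g h \<in> carrier M" "p (\<xi> g h) = g" "q (\<xi> g h) = h" if "g \<in> carrier G" "h \<in> carrier H" for g h
    using someI_ex[of "\<lambda>x. x \<in> carrier M \<and> p x = g \<and> q x = h"] joint_surj[OF that] unfolding \<xi>_def by blast+
  define m where "m f = m\<^sub>G (\<lambda>g. m\<^sub>H (\<lambda>h. f (\<xi> g h)))" for f
  have bH: "bounded ((\<lambda>h. f (\<xi> g h)) ` carrier H)" if f: "bounded (f ` carrier M)" and g: "g \<in> carrier G" for f :: "'a \<Rightarrow> real" and g
    by (rule bounded_subset[OF f]) (use \<xi>(1)[OF g] in auto)
  have bG: "bounded ((\<lambda>g. m\<^sub>H (\<lambda>h. f (\<xi> g h))) ` carrier G)" if f: "bounded (f ` carrier M)" for f :: "'a \<Rightarrow> real"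
  proof -
    obtain C where C: "\<And>x. x \<in> carrier M \<Longrightarrow> \<bar>f x\<bar> \<le> C" using f unfolding bounded_iff by auto
    have "\<bar>m\<^sub>H (\<lambda>h. f (\<xi> g h))\<bar> \<le> C" if "g \<in> carrier G" for g
      using that C \<xi>(1)[OF that] by (intro mean_abs_le[OF H]) auto
    then show ?thesis unfolding bounded_iff by auto
  qed
  have "invariant_mean M m"
    unfolding invariant_mean_def Let_def
  proof (intro conjI ballI allI impI; (unfold mem_Collect_eq)?)
    fix f h :: "'a \<Rightarrow> real" assume fh: "bounded (f ` carrier M)" "bounded (h ` carrier M)"
    have "m (\<lambda>x. f x + h x) = m\<^sub>G (\<lambda>g. m\<^sub>H (\<lambda>y. f (\<xi> g y)) + m\<^sub>H (\<lambda>y. h (\<xi> g y)))"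
      unfolding m_def by (rule mean_cong[OF G]) (auto intro!: mean_add[OF H] bH fh bG bounded_plus_comp)
    also have "\<dots> = m f + m h"
      unfolding m_def by (rule mean_add[OF G]) (auto intro!: bG fh)
    finally show "m (\<lambda>x. f x + h x) = m f + m h" .
  next
    fix f :: "'a \<Rightarrow> real" and c :: real assume f: "bounded (f ` carrier M)"
    have "bounded ((\<lambda>x. c * f x) ` carrier M)"
      using bounded_scaling[OF f, of c] by (simp add: image_image)
    then have "m (\<lambda>x. c * f x) = m\<^sub>G (\<lambda>g. c * m\<^sub>H (\<lambda>y. f (\<xi> g y)))"
      unfolding m_def by (intro mean_cong[OF G] bG mean_scale[OF H] bH f)
    also have "\<dots> = c * m f"
      unfolding m_def by (rule mean_scale[OF G]) (auto intro!: bG f)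
    finally show "m (\<lambda>x. c * f x) = c * m f" .
  next
    fix f :: "'a \<Rightarrow> real" assume f: "bounded (f ` carrier M)" "\<forall>x\<in>carrier M. 0 \<le> f x"
    show "0 \<le> m f" unfolding m_def
      by (intro mean_nonneg[OF G] mean_nonneg[OF H] bG bH f) (use f(2) \<xi>(1) in auto)
  next
    show "m (\<lambda>x. 1) = 1" unfolding m_def by (simp add: mean_one[OF H] mean_one[OF G])
  next
    fix f :: "'a \<Rightarrow> real" and x assume f: "bounded (f ` carrier M)" and x: "x \<in> carrier M"
    have "m\<^sub>H (\<lambda>h. f (x \<otimes>\<^bsub>M\<^esub> \<xi> g h)) = m\<^sub>H (\<lambda>h. f (\<xi> (p x \<otimes>\<^bsub>G\<^esub> g) h))" if g: "g \<in> carrier G" for g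
    proof -
      have "x \<otimes>\<^bsub>M\<^esub> \<xi> g h = \<xi> (p x \<otimes>\<^bsub>G\<^esub> g) (q x \<otimes>\<^bsub>H\<^esub> h)" if "h \<in> carrier H" for h
        using x g that by (intro joint_inj) (auto simp: \<xi>)
      moreover have "bounded ((\<lambda>h. f (x \<otimes>\<^bsub>M\<^esub> \<xi> g h)) ` carrier H)"
        by (rule bounded_subset[OF f]) (use x g \<xi>(1) in auto)
      ultimately have "m\<^sub>H (\<lambda>h. f (x \<otimes>\<^bsub>M\<^esub> \<xi> g h)) = m\<^sub>H (\<lambda>h. f (\<xi> (p x \<otimes>\<^bsub>G\<^esub> g) (q x \<otimes>\<^bsub>H\<^esub> h)))"
        by (intro mean_cong[OF H]) auto
      also have "\<dots> = m\<^sub>H (\<lambda>h. f (\<xi> (p x \<otimes>\<^bsub>G\<^esub> g) h))"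
        using x g by (intro mean_invariant[OF H, where f = "\<lambda>h. f (\<xi> (p x \<otimes>\<^bsub>G\<^esub> g) h)"] bH f) auto
      finally show ?thesis .
    qed
    moreover have "bounded ((\<lambda>y. f (x \<otimes>\<^bsub>M\<^esub> y)) ` carrier M)"
      by (rule bounded_subset[OF f]) (use x in auto)
    ultimately have "m (\<lambda>y. f (x \<otimes>\<^bsub>M\<^esub> y)) = m\<^sub>G (\<lambda>g. m\<^sub>H (\<lambda>h. f (\<xi> (p x \<otimes>\<^bsub>G\<^esub> g) h)))"
      unfolding m_def by (intro mean_cong[OF G] bG)
    also have "\<dots> = m f"
      unfolding m_def using x
      by (intro mean_invariant[OF G, where f = "\<lambda>g. m\<^sub>H (\<lambda>h. f (\<xi> g h))"] bG f) auto
    finally show "m (\<lambda>y. f (x \<otimes>\<^bsub>M\<^esub> y)) = m f" .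
  qed
  then show ?thesis unfolding amenable_iff by blast
qed

end

lemma group_properties_direct_product:
  assumes "P \<in> group_properties" "P G" "P H" "direct_product M G H p q"
  shows "P M"
proof -
  interpret direct_product M G H p q by fact
  from assms(1) show ?thesis
    unfolding group_properties_def insert_iff empty_iff
    by (elim disjE FalseE)
      (use assms(2,3) in \<open>simp_all only: amenable no_free_subgroup left_orderable locally_indicable
        biorderable unique_product torsion_free sofic satisfies_no_law\<close>)
qed

section \<open>The word problem of embedded groups\<close>

definition letter_decode :: "nat \<Rightarrow> letter" where
  "letter_decode c = (c div 2, even c)"

lemma letter_decode_code [simp]: "letter_decode (letter_code l) = l"
  by (cases l) (auto simp: letter_decode_def)

lemma letter_code_decode [simp]: "letter_code (letter_decode c) = c"
  by (auto simp: letter_decode_def)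

lemma word_code_inject [simp]: "word_code v = word_code w \<longleftrightarrow> v = w"
proof -
  have "inj letter_code" by (metis injI letter_decode_code)
  then show ?thesis by (simp add: word_code_def list_encode_eq inj_map_eq_map)
qed

lemma word_code_surj: "\<exists>w. c = word_code w"
  by (rule exI[of _ "map letter_decode (list_decode c)"]) (simp add: word_code_def comp_def)

text \<open>
  All letters \<open>(i, b)\<close> with \<open>m \<le> i\<close> share one image, so the substitution is given by a finite table and a default
  value.
\<close>

lemma decidable_set_substitution:
  fixes \<sigma> :: "letter \<Rightarrow> gword"
  assumes dec: "decidable_set (word_code ` V)" and \<sigma>: "\<And>i b. m \<le> i \<Longrightarrow> \<sigma> (i, b) = z"
  shows "decidable_set (word_code ` {w. concat (rev (map \<sigma> w)) \<in> V})"
proof -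
  define T where "T = map (\<lambda>c. map letter_code (\<sigma> (letter_decode c))) [0..<2 * m]"
  let ?U = "\<lambda>c. if c < length T then T ! c else map letter_code z"
  define F where "F c = list_encode (concat (rev (map ?U (list_decode c))))" for c
  have U: "?U c = map letter_code (\<sigma> (letter_decode c))" for c
    using \<sigma>[of "c div 2" "even c"] by (auto simp: T_def letter_decode_def)
  have F: "F (word_code w) = word_code (concat (rev (map \<sigma> w)))" for w
    unfolding F_def U by (simp add: word_code_def map_concat rev_map comp_def)
  have "decidable_set (F -` word_code ` V)"
    by (rule decidable_set_vimage[OF dec]) (unfold F_def, rule recursive_fun_substitute)
  also have "F -` word_code ` V = word_code ` {w. concat (rev (map \<sigma> w)) \<in> V}"
  proof (intro equalityI subsetI)
    fix c assume c: "c \<in> F -` word_code ` V"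
    obtain w where "c = word_code w" using word_code_surj by blast
    with c show "c \<in> word_code ` {w. concat (rev (map \<sigma> w)) \<in> V}" by (auto simp: F)
  qed (auto simp: F)
  finally show ?thesis .
qed

text \<open>
  The generators of \<open>L\<close> are written as words in the generators of \<open>H\<close>, and a word over \<open>L\<close> is
  translated letter by letter.
\<close>

lemma solvable_word_problem_mon:
  assumes L: "group L" "finitely_generated L" and H: "group H" "solvable_word_problem H"
    and g: "g \<in> mon L H"
  shows "solvable_word_problem L"
proof -
  interpret L: group L by fact
  interpret H: group H by fact
  have ghom: "g \<in> hom L H" and ginj: "inj_on g (carrier L)" using g by (auto simp: mon_def)
  interpret g: group_hom L H g by unfold_locales (rule ghom)
  obtain n a where a: "a ` {..<n} \<subseteq> carrier H" "generate H (a ` {..<n}) = carrier H"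
    and dec: "decidable_set (word_code ` {w \<in> words_over n. word_eval H a w = \<one>\<^bsub>H\<^esub>})"
    using H(2) unfolding solvable_word_problem_def by (elim exE conjE) (rule that)
  obtain S where S: "S \<subseteq> carrier L" "finite S" "generate L S = carrier L"
    using L(2) unfolding finitely_generated_def by blast
  obtain bs where bs: "set bs = S" using finite_list[OF S(2)] by blast
  define m where "m = length bs"
  define b where "b i = bs ! i" for i
  have b_img: "b ` {..<m} = S" unfolding bs[symmetric] m_def b_def by (auto simp: set_conv_nth)
  with S have b: "b ` {..<m} \<subseteq> carrier L" "generate L (b ` {..<m}) = carrier L" by auto
  have "\<exists>u. u \<in> words_over n \<and> g (b j) = word_eval H a u" if "j < m" for j
  proof -
    have "b j \<in> carrier L" using b(1) that by auto
    then have "g (b j) \<in> word_eval H a ` words_over n"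
      unfolding H.generate_words[OF a(1), symmetric] a(2) by simp
    then show ?thesis by blast
  qed
  then obtain u where u: "\<And>j. j < m \<Longrightarrow> u j \<in> words_over n" "\<And>j. j < m \<Longrightarrow> g (b j) = word_eval H a (u j)"
    by metis
  (* Generators are sent to inverses, as the substitution reverses the word. A letter that is
     not a generator of L is sent to one that is not a generator of H. *)
  define \<sigma> where "\<sigma> = (\<lambda>(j, t). if j < m then (if t then rev (map inv_letter (u j)) else u j) else [(n, True)])"
  have \<sigma>_word: "\<sigma> (j, t) \<in> words_over n" "word_eval H a (\<sigma> (j, t)) = inv\<^bsub>H\<^esub> (g (if t then b j else inv\<^bsub>L\<^esub> (b j)))"
    if "j < m" for j t
  proof -
    have "b j \<in> carrier L" using b(1) that by auto
    then show "\<sigma> (j, t) \<in> words_over n"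
      "word_eval H a (\<sigma> (j, t)) = inv\<^bsub>H\<^esub> (g (if t then b j else inv\<^bsub>L\<^esub> (b j)))"
      using that u[OF that] H.word_eval_inverse[OF a(1) u(1)[OF that]] H.word_eval_closed[OF a(1) u(1)[OF that]]
      by (auto simp: \<sigma>_def)
  qed
  have eval: "concat (rev (map \<sigma> w)) \<in> words_over n \<and> word_eval H a (concat (rev (map \<sigma> w))) = inv\<^bsub>H\<^esub> (g (word_eval L b w))"
    if "w \<in> words_over m" for w
    using that
  proof (induction w)
    case (Cons l w)
    obtain j t where l: "l = (j, t)" by force
    have j: "j < m" "w \<in> words_over m" using Cons.prems l by auto
    then have "b j \<in> carrier L" "word_eval L b w \<in> carrier L"
      using b(1) L.word_eval_closed[OF b(1)] by auto
    moreover have "word_eval H a (concat (rev (map \<sigma> w)) @ \<sigma> (j, t)) =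
      word_eval H a (concat (rev (map \<sigma> w))) \<otimes>\<^bsub>H\<^esub> word_eval H a (\<sigma> (j, t))"
      using Cons.IH[OF j(2)] \<sigma>_word(1)[OF j(1)] by (intro H.word_eval_append[OF a(1)]) auto
    ultimately show ?case
      using Cons.IH[OF j(2)] \<sigma>_word[OF j(1), of t] by (cases t) (simp_all add: l H.inv_mult_group)
  qed simp
  have over: "w \<in> words_over m" if "concat (rev (map \<sigma> w)) \<in> words_over n" for w
  proof (rule ccontr)
    assume "w \<notin> words_over m"
    then obtain l where l: "l \<in> set w" "l \<notin> {..<m} \<times> UNIV" by (auto simp: words_over_def)
    then have "\<not> fst l < m" by (simp add: mem_Times_iff)
    then have "\<sigma> l = [(n, True)]" by (simp add: \<sigma>_def split_beta)
    with l(1) have "(n, True) \<in> set (concat (rev (map \<sigma> w)))" by (auto intro!: bexI[of _ l])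
    with that show False by (auto simp: words_over_def)
  qed
  have iff: "word_eval L b w = \<one>\<^bsub>L\<^esub> \<longleftrightarrow> inv\<^bsub>H\<^esub> (g (word_eval L b w)) = \<one>\<^bsub>H\<^esub>" if "w \<in> words_over m" for w
    using L.word_eval_closed[OF b(1) that] inj_on_eq_iff[OF ginj, of "word_eval L b w" "\<one>\<^bsub>L\<^esub>"]
    by (simp add: H.inv_eq_1_iff)
  have "w \<in> words_over m \<and> word_eval L b w = \<one>\<^bsub>L\<^esub> \<longleftrightarrow>
    concat (rev (map \<sigma> w)) \<in> words_over n \<and> word_eval H a (concat (rev (map \<sigma> w))) = \<one>\<^bsub>H\<^esub>" for w
  proof (cases "w \<in> words_over m")
    case True
    then show ?thesis using eval[OF True] iff[OF True] by simp
  next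
    case False
    then show ?thesis using over by blast
  qed
  then have *: "{w \<in> words_over m. word_eval L b w = \<one>\<^bsub>L\<^esub>} =
    {w. concat (rev (map \<sigma> w)) \<in> {v \<in> words_over n. word_eval H a v = \<one>\<^bsub>H\<^esub>}}"
    by simp
  have "decidable_set (word_code ` {w \<in> words_over m. word_eval L b w = \<one>\<^bsub>L\<^esub>})"
    unfolding * by (rule decidable_set_substitution[OF dec, of m _ "[(n, True)]"]) (simp add: \<sigma>_def)
  with b show ?thesis unfolding solvable_word_problem_def by (intro exI conjI)
qed

section \<open>Open and dense sets of enumerations\<close>

lemma group_of_simps [simp]: "carrier (group_of E) = UNIV" "x \<otimes>\<^bsub>group_of E\<^esub> y = fst E (x, y)"
  "\<one>\<^bsub>group_of E\<^esub> = snd (snd E)"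
  by (auto simp: group_of_def split_beta)

lemma enumerated_groupsD:
  assumes "E \<in> enumerated_groups"
  shows "group (group_of E)" "inv\<^bsub>group_of E\<^esub> x = fst (snd E) x"
  using assms by (auto simp: enumerated_groups_def)

text \<open>
  Function spaces carry the topology of pointwise convergence. So evaluating a function that
  varies continuously is continuous if the argument is locally constant.
\<close>

lemma continuous_on_fun_apply:
  fixes f :: "'x::topological_space \<Rightarrow> 'i \<Rightarrow> 'y::topological_space"
  assumes f: "continuous_on S f" and g: "\<And>x. x \<in> S \<Longrightarrow> eventually (\<lambda>y. g y = g x) (at x within S)"
  shows "continuous_on S (\<lambda>x. f x (g x))"
  unfolding continuous_on_def
proof
  fix x assume x: "x \<in> S"
  have "((\<lambda>y. f y (g x)) \<longlongrightarrow> f x (g x)) (at x within S)"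
    using continuous_on_product_then_coordinatewise[OF f, of "g x"] x by (simp add: continuous_on_def)
  then show "((\<lambda>y. f y (g y)) \<longlongrightarrow> f x (g x)) (at x within S)"
    by (rule Lim_transform_eventually) (use g[OF x] in \<open>auto elim: eventually_mono\<close>)
qed

lemma eventually_eq_discrete:
  fixes f :: "'x::topological_space \<Rightarrow> 'y::discrete_topology"
  assumes "continuous_on S f" "x \<in> S"
  shows "eventually (\<lambda>y. f y = f x) (at x within S)"
proof -
  have "(f \<longlongrightarrow> f x) (at x within S)" using assms by (auto simp: continuous_on_def)
  from topological_tendstoD[OF this open_discrete, of "{f x}"] show ?thesis by simp
qed

text \<open>
  Evaluation at a word of positive length looks up the multiplication at arguments that
  themselves depend on the group. As they are natural numbers, they are locally constant.
\<close>

lemma continuous_on_word_eval: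
  assumes "S \<subseteq> enumerated_groups"
  shows "continuous_on S (\<lambda>E. word_eval (group_of E) b w)"
proof (induction w)
  case Nil
  show ?case by (simp add: continuous_on_snd continuous_on_id)
next
  case (Cons l w)
  obtain i t where l: "l = (i, t)" by force
  let ?v = "\<lambda>E :: enumeration. if t then b i else fst (snd E) (b i)"
  have inv: "continuous_on S ?v"
    by (cases t) (auto intro!: continuous_on_product_then_coordinatewise continuous_on_fst continuous_on_snd continuous_on_id)
  have "continuous_on S (\<lambda>E. fst E (?v E, word_eval (group_of E) b w))"
  proof (rule continuous_on_fun_apply[where f = fst and g = "\<lambda>E. (?v E, word_eval (group_of E) b w)"])
    show "continuous_on S (fst :: enumeration \<Rightarrow> _)" by (intro continuous_on_fst continuous_on_id)
    show "eventually (\<lambda>F. (?v F, word_eval (group_of F) b w) = (?v E, word_eval (group_of E) b w)) (at E within S)"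
      if "E \<in> S" for E
      using eventually_eq_discrete[OF inv that] eventually_eq_discrete[OF Cons that]
      by eventually_elim simp
  qed
  then show ?case
    unfolding l by (rule continuous_on_eq) (use assms in \<open>auto simp: enumerated_groupsD\<close>)
qed

lemma openin_finite_conj:
  assumes "\<And>x. x \<in> set xs \<Longrightarrow> openin (top_of_set S) {E \<in> S. Q x E}"
  shows "openin (top_of_set S) {E \<in> S. \<forall>x\<in>set xs. Q x E}"
  using assms
proof (induction xs)
  case (Cons x xs)
  have "{E \<in> S. \<forall>y\<in>set (x # xs). Q y E} = {E \<in> S. Q x E} \<inter> {E \<in> S. \<forall>y\<in>set xs. Q y E}" by auto
  with Cons show ?case by (simp add: openin_Int)
qed simp

definition solving_set :: "enumeration set \<Rightarrow> gword list \<Rightarrow> gword list \<Rightarrow> enumeration set" where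
  "solving_set S R T = {E \<in> S. \<exists>b. (\<forall>r\<in>set R. word_eval (group_of E) b r = \<one>\<^bsub>group_of E\<^esub>) \<and>
    (\<forall>t\<in>set T. word_eval (group_of E) b t \<noteq> \<one>\<^bsub>group_of E\<^esub>)}"

lemma openin_relation_discrete:
  fixes f :: "'x::topological_space \<Rightarrow> 'y::discrete_topology" and g :: "'x \<Rightarrow> 'z::discrete_topology"
  assumes "continuous_on S f" "continuous_on S g"
  shows "openin (top_of_set S) {x \<in> S. Q (f x) (g x)}"
proof -
  have "{x \<in> S. Q (f x) (g x)} = (\<Union>(c, d)\<in>{(c, d). Q c d}. (S \<inter> f -` {c}) \<inter> (S \<inter> g -` {d}))"
    by auto
  then show ?thesis
    using assms by (auto intro!: openin_Union openin_Int continuous_openin_preimage_gen open_discrete)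
qed

lemma openin_word_eval:
  assumes "S \<subseteq> enumerated_groups"
  shows "openin (top_of_set S) {E \<in> S. word_eval (group_of E) b w = x}"
    and "openin (top_of_set S) {E \<in> S. word_eval (group_of E) b w = \<one>\<^bsub>group_of E\<^esub>}"
    and "openin (top_of_set S) {E \<in> S. word_eval (group_of E) b w \<noteq> \<one>\<^bsub>group_of E\<^esub>}"
proof -
  note * = openin_relation_discrete[OF continuous_on_word_eval[OF assms, of b w] continuous_on_word_eval[OF assms, of b "[]"]]
  show "openin (top_of_set S) {E \<in> S. word_eval (group_of E) b w = x}"
    using *[of "\<lambda>y z. y = x"] by simp
  show "openin (top_of_set S) {E \<in> S. word_eval (group_of E) b w = \<one>\<^bsub>group_of E\<^esub>}"
    using *[of "\<lambda>y z. y = z"] by simp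
  show "openin (top_of_set S) {E \<in> S. word_eval (group_of E) b w \<noteq> \<one>\<^bsub>group_of E\<^esub>}"
    using *[of "\<lambda>y z. y \<noteq> z"] by simp
qed

lemma openin_solving_set:
  assumes "S \<subseteq> enumerated_groups"
  shows "openin (top_of_set S) (solving_set S R T)"
proof -
  have "solving_set S R T = (\<Union>b. {E \<in> S. \<forall>r\<in>set R. word_eval (group_of E) b r = \<one>\<^bsub>group_of E\<^esub>} \<inter>
    {E \<in> S. \<forall>t\<in>set T. word_eval (group_of E) b t \<noteq> \<one>\<^bsub>group_of E\<^esub>})"
    unfolding solving_set_def by blast
  then show ?thesis
    by (auto simp del: group_of_simps intro!: openin_Union openin_Int openin_finite_conj openin_word_eval assms)
qed

lemma open_fun_finite_support:
  fixes A :: "('i \<Rightarrow> 'b::topological_space) set"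
  assumes "open A" "m \<in> A"
  obtains J where "finite J" "\<And>m'. (\<And>j. j \<in> J \<Longrightarrow> m' j = m j) \<Longrightarrow> m' \<in> A"
proof -
  obtain X where X: "m \<in> (\<Pi>\<^sub>E i\<in>UNIV. X i)" "finite {i. X i \<noteq> UNIV}" "(\<Pi>\<^sub>E i\<in>UNIV. X i) \<subseteq> A"
    using product_topology_open_contains_basis[of "\<lambda>i. euclidean" UNIV A m] assms unfolding open_fun_def by auto
  show ?thesis
  proof (rule that[OF X(2)])
    fix m' assume *: "\<And>j. j \<in> {i. X i \<noteq> UNIV} \<Longrightarrow> m' j = m j"
    have "m' i \<in> X i" for i using *[of i] X(1) by (cases "X i = UNIV") auto
    with X(3) show "m' \<in> A" by auto
  qed
qed

text \<open>
  The sets of enumerated groups that agree with \<open>E\<close> below \<open>N\<close>, for varying \<open>N\<close>, form a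
  neighbourhood base at \<open>E\<close> in a space of enumerated groups.
\<close>

definition agree_below :: "nat \<Rightarrow> enumeration \<Rightarrow> enumeration \<Rightarrow> bool" where
  "agree_below N E F \<longleftrightarrow> (\<forall>x<N. \<forall>y<N. fst E (x, y) = fst F (x, y)) \<and>
    (\<forall>x<N. fst (snd E) x = fst (snd F) x) \<and> snd (snd E) = snd (snd F)"

lemma openin_agree_below:
  assumes U: "openin (top_of_set S) U" and E: "E \<in> U"
  obtains N where "\<And>F. F \<in> S \<Longrightarrow> agree_below N E F \<Longrightarrow> F \<in> U"
proof -
  obtain V where V: "open V" "U = S \<inter> V" using U by (auto simp: openin_open)
  obtain m i e where [simp]: "E = (m, i, e)" by (cases E)
  obtain A B where A: "open A" "open B" "(m, i, e) \<in> A \<times> B" "A \<times> B \<subseteq> V"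
    by (rule open_prod_elim[OF V(1), of "(m, i, e)"]) (use E V(2) in auto)
  obtain C D where C: "open C" "open D" "(i, e) \<in> C \<times> D" "C \<times> D \<subseteq> B"
    by (rule open_prod_elim[OF A(2), of "(i, e)"]) (use A(3) in auto)
  obtain J where J: "finite J" "\<And>m'. (\<And>j. j \<in> J \<Longrightarrow> m' j = m j) \<Longrightarrow> m' \<in> A"
    by (rule open_fun_finite_support[OF A(1), of m]) (use A(3) in auto)
  obtain K where K: "finite K" "\<And>i'. (\<And>j. j \<in> K \<Longrightarrow> i' j = i j) \<Longrightarrow> i' \<in> C"
    by (rule open_fun_finite_support[OF C(1), of i]) (use C(3) in auto)
  have "finite (fst ` J \<union> snd ` J \<union> K)" using J K by auto
  from finite_nat_set_iff_bounded[THEN iffD1, OF this]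
  obtain N where N: "\<forall>x\<in>fst ` J \<union> snd ` J \<union> K. x < N" ..
  show ?thesis
  proof (rule that[of N])
    fix F assume F: "F \<in> S" "agree_below N E F"
    obtain m' i' e' where [simp]: "F = (m', i', e')" by (cases F)
    have "m' \<in> A"
    proof (rule J(2))
      fix j assume "j \<in> J"
      then have "fst j < N" "snd j < N" using N by auto
      then show "m' j = m j" using F(2) by (cases j) (auto simp: agree_below_def)
    qed
    moreover have "i' \<in> C" by (rule K(2)) (use F(2) N in \<open>auto simp: agree_below_def\<close>)
    moreover have "e' \<in> D" using F(2) C(3) by (auto simp: agree_below_def)
    ultimately have "F \<in> V" using A(4) C(4) by auto
    with F show "F \<in> U" by (simp add: V(2))
  qed
qed

lemma agree_below_mono: "agree_below N E F \<Longrightarrow> M \<le> N \<Longrightarrow> agree_below M E F"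
  by (auto simp: agree_below_def)

lemma enumeration_support_bound:
  fixes E :: enumeration
  obtains N' where "N \<le> N'" "\<And>x y. x < N \<Longrightarrow> y < N \<Longrightarrow> fst E (x, y) < N'"
    "\<And>x. x < N \<Longrightarrow> fst (snd E) x < N'" "snd (snd E) < N'"
proof -
  let ?X = "{..<N} \<union> fst E ` ({..<N} \<times> {..<N}) \<union> fst (snd E) ` {..<N} \<union> {snd (snd E)}"
  have "finite ?X" by auto
  from finite_nat_set_iff_bounded[THEN iffD1, OF this] obtain k where "\<forall>x\<in>?X. x < k" ..
  then show ?thesis by (intro that[of "max N k"]) (auto simp: less_max_iff_disj)
qed

lemma extend_to_bijection:
  assumes C: "countable C" "infinite C" and \<theta>: "inj_on \<theta> {..<n}" "\<theta> ` {..<n} \<subseteq> C"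
  obtains \<xi> :: "'a \<Rightarrow> nat" where "bij_betw \<xi> C UNIV" "\<And>x. x < n \<Longrightarrow> \<xi> (\<theta> x) = x"
proof -
  let ?A = "\<theta> ` {..<n}"
  let ?g = "\<lambda>x. to_nat_on (C - ?A) x + n"
  define \<xi> where "\<xi> x = (if x \<in> ?A then inv_into {..<n} \<theta> x else ?g x)" for x
  have "bij_betw (to_nat_on (C - ?A)) (C - ?A) UNIV"
    by (rule to_nat_on_infinite) (use C in auto)
  moreover have "bij_betw (\<lambda>x. x + n) UNIV {n..}"
    by (rule bij_betw_byWitness[where f' = "\<lambda>x. x - n"]) auto
  ultimately have "bij_betw ((\<lambda>x. x + n) \<circ> to_nat_on (C - ?A)) (C - ?A) {n..}" by (rule bij_betw_trans)
  then have "bij_betw ?g (C - ?A) {n..}" by (simp add: comp_def)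
  moreover have "bij_betw (inv_into {..<n} \<theta>) ?A {..<n}"
    by (rule bij_betw_inv_into) (use \<theta> in \<open>auto simp: bij_betw_def\<close>)
  ultimately have "bij_betw (\<lambda>x. if x \<in> ?A then inv_into {..<n} \<theta> x else ?g x) (?A \<union> (C - ?A)) ({..<n} \<union> {n..})"
    by (intro bij_betw_disjoint_Un) auto
  moreover have "?A \<union> (C - ?A) = C" "{..<n} \<union> {n..} = UNIV" using \<theta>(2) by auto
  ultimately have "bij_betw \<xi> C UNIV" by (simp add: \<xi>_def[abs_def])
  moreover have "\<xi> (\<theta> x) = x" if "x < n" for x using \<theta>(1) that by (simp add: \<xi>_def)
  ultimately show ?thesis by (rule that)
qed

lemma enumeration_of_group:
  fixes G :: "nat monoid"
  assumes "group G" "carrier G = UNIV"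
  obtains E where "E \<in> enumerated_groups" "group_of E = G"
proof -
  let ?E = "(\<lambda>(x, y). x \<otimes>\<^bsub>G\<^esub> y, \<lambda>x. inv\<^bsub>G\<^esub> x, \<one>\<^bsub>G\<^esub>)"
  have "group_of ?E = G" using assms(2) by (simp add: group_of_def)
  with assms(1) show ?thesis by (intro that[of ?E]) (auto simp: enumerated_groups_def)
qed

text \<open>
  Any injective assignment \<open>\<theta>\<close> of elements of $E \times K$ to the names below \<open>N'\<close> that respects the
  multiplication table of \<open>E\<close> extends to an enumeration of the whole group, since the
  remaining elements and the remaining names are both countably infinite. The bound \<open>N'\<close> lies above all values of the
  operations of \<open>E\<close> on names below \<open>N\<close>, so the new enumeration agrees with \<open>E\<close> there. Unit
  and inverses agree because they are determined by the multiplication.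
\<close>

lemma extend_partial_enumeration:
  assumes P: "P \<in> group_properties" and E: "E \<in> enumerated_groups_with P" and K: "group K" "P K"
    and bound: "\<And>x y. x < N \<Longrightarrow> y < N \<Longrightarrow> fst E (x, y) < N'" "\<And>x. x < N \<Longrightarrow> fst (snd E) x < N'"
      "snd (snd E) < N'" "N \<le> N'"
    and \<theta>: "inj_on \<theta> {..<N'}" "\<theta> ` {..<N'} \<subseteq> carrier (group_of E \<times>\<times> K)"
    and hom: "\<And>x y. \<lbrakk>x < N'; y < N'; fst E (x, y) < N'\<rbrakk> \<Longrightarrow> \<theta> (fst E (x, y)) = \<theta> x \<otimes>\<^bsub>group_of E \<times>\<times> K\<^esub> \<theta> y"
  obtains F \<xi> where "F \<in> enumerated_groups_with P" "\<xi> \<in> iso (group_of E \<times>\<times> K) (group_of F)"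
    "\<And>x. x < N' \<Longrightarrow> \<xi> (\<theta> x) = x" "agree_below N E F"
proof -
  let ?M = "group_of E \<times>\<times> K"
  have E': "E \<in> enumerated_groups" "P (group_of E)" using E by (auto simp: enumerated_groups_with_def)
  interpret G: group "group_of E" by (rule enumerated_groupsD(1)[OF E'(1)])
  interpret K: group K by fact
  interpret M: group ?M by (rule DirProd_group) unfold_locales
  have carr: "carrier ?M = UNIV \<times> carrier K" by (simp add: DirProd_def)
  have "infinite (carrier ?M)"
    unfolding carr using K.one_closed by (auto simp: finite_cartesian_product_iff)
  then obtain \<xi> where \<xi>: "bij_betw \<xi> (carrier ?M) UNIV" and \<xi>\<theta>: "\<And>x. x < N' \<Longrightarrow> \<xi> (\<theta> x) = x"
    using extend_to_bijection[OF countableI_type _ \<theta>] by blast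
  have inj: "inj_on \<xi> (carrier ?M)" using \<xi> by (simp add: bij_betw_def)
  let ?L = "image_group \<xi> ?M"
  have L: "group ?L" "\<xi> \<in> iso ?M ?L" using image_group_iso[OF M.is_group inj] by auto
  have "carrier ?L = UNIV" using \<xi> by (simp add: image_group_carrier bij_betw_def)
  with L(1) obtain F where F: "F \<in> enumerated_groups" "group_of F = ?L" by (rule enumeration_of_group)
  let ?\<eta> = "inv_into (carrier ?M) \<xi>"
  have \<eta>: "?\<eta> \<in> iso (group_of F) ?M" unfolding F(2) by (rule M.iso_set_sym[OF L(2)])
  then have \<eta>hom: "?\<eta> \<in> hom (group_of F) ?M" and \<eta>bij: "bij_betw ?\<eta> (carrier (group_of F)) (carrier ?M)"
    by (auto simp: iso_def)
  interpret F: group "group_of F" by (rule enumerated_groupsD(1)[OF F(1)])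
  interpret \<xi>: group_hom ?M "group_of F" \<xi> by unfold_locales (use L(2) F(2) in \<open>simp add: iso_def\<close>)
  have fst_hom: "(\<lambda>x. fst (?\<eta> x)) \<in> hom (group_of F) (group_of E)"
    and snd_hom: "(\<lambda>x. snd (?\<eta> x)) \<in> hom (group_of F) K"
    using \<eta>hom by (auto simp: hom_def Pi_iff mem_Times_iff mult_DirProd')
  have "direct_product (group_of F) (group_of E) K (\<lambda>x. fst (?\<eta> x)) (\<lambda>x. snd (?\<eta> x))"
  proof (unfold_locales)
    show "(\<lambda>x. fst (?\<eta> x)) \<in> hom (group_of F) (group_of E)" by (rule fst_hom)
    show "(\<lambda>x. snd (?\<eta> x)) \<in> hom (group_of F) K" by (rule snd_hom)
  next
    fix x assume x: "x \<in> carrier (group_of F)" "fst (?\<eta> x) = \<one>\<^bsub>group_of E\<^esub>" "snd (?\<eta> x) = \<one>\<^bsub>K\<^esub>"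
    then have "?\<eta> x = \<one>\<^bsub>?M\<^esub>" by (auto simp: DirProd_def prod_eq_iff)
    also have "\<dots> = ?\<eta> \<one>\<^bsub>group_of F\<^esub>" using hom_one[OF \<eta>hom F.is_group M.is_group] by simp
    finally show "x = \<one>\<^bsub>group_of F\<^esub>" using \<eta>bij x(1) by (auto simp: bij_betw_def dest: inj_onD)
  next
    fix g h assume "g \<in> carrier (group_of E)" "h \<in> carrier K"
    then have "(g, h) \<in> ?\<eta> ` carrier (group_of F)" using \<eta>bij by (auto simp: bij_betw_def carr)
    then obtain x where "(g, h) = ?\<eta> x" "x \<in> carrier (group_of F)" by (rule imageE)
    then show "\<exists>x\<in>carrier (group_of F). fst (?\<eta> x) = g \<and> snd (?\<eta> x) = h"
      by (metis fst_conv snd_conv)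
  qed
  then have "P (group_of F)" by (rule group_properties_direct_product[OF P E'(2) K(2)])
  with F(1) have FP: "F \<in> enumerated_groups_with P" by (simp add: enumerated_groups_with_def)
  have mult: "fst F (x, y) = fst E (x, y)" if "x < N'" "y < N'" "fst E (x, y) < N'" for x y
  proof -
    have "\<theta> x \<in> carrier ?M" "\<theta> y \<in> carrier ?M" using \<theta>(2) that by auto
    then have "\<xi> (\<theta> x \<otimes>\<^bsub>?M\<^esub> \<theta> y) = fst F (\<xi> (\<theta> x), \<xi> (\<theta> y))" using \<xi>.hom_mult by simp
    then show ?thesis using that by (simp add: \<xi>\<theta> flip: hom)
  qed
  (* the unit is the only idempotent *)
  have one: "snd (snd F) = snd (snd E)"
  proof -
    let ?e = "snd (snd E)"
    have "fst E (?e, ?e) = ?e" using G.r_one[of ?e] by simp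
    then have "fst F (?e, ?e) = ?e" using mult[of ?e ?e] bound(3) by simp
    then show ?thesis using F.l_cancel_one[of ?e ?e] by simp
  qed
  have "agree_below N E F"
    unfolding agree_below_def
  proof (intro conjI allI impI)
    fix x assume x: "x < N"
    let ?i = "fst (snd E) x"
    have "fst E (?i, x) = snd (snd E)"
      using G.l_inv[of x] enumerated_groupsD(2)[OF E'(1), of x] by simp
    then have "fst F (?i, x) = snd (snd F)" using mult[of ?i x] bound x one by simp
    then have "inv\<^bsub>group_of F\<^esub> x = ?i" using F.inv_equality[of ?i x] by simp
    then show "?i = fst (snd F) x" using enumerated_groupsD(2)[OF F(1)] by simp
  qed (use mult bound one in auto)
  moreover have "\<xi> \<in> iso ?M (group_of F)" using L(2) F(2) by simp
  ultimately show ?thesis using that[OF FP _ \<xi>\<theta>] by blast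
qed

lemma second_factor_mon:
  assumes "group G" "group K" "group L" "\<xi> \<in> iso (G \<times>\<times> K) L"
  shows "(\<lambda>x. \<xi> (\<one>\<^bsub>G\<^esub>, x)) \<in> mon K L"
proof -
  interpret G: group G by fact
  have \<xi>: "\<xi> \<in> hom (G \<times>\<times> K) L" "inj_on \<xi> (carrier (G \<times>\<times> K))"
    using assms(4) by (auto simp: iso_def bij_betw_def)
  have "(\<lambda>x. (\<one>\<^bsub>G\<^esub>, x)) \<in> hom K (G \<times>\<times> K)"
    by (intro homI) (auto simp: DirProd_def)
  from hom_compose[OF this \<xi>(1)] have "(\<lambda>x. \<xi> (\<one>\<^bsub>G\<^esub>, x)) \<in> hom K L" by (simp add: comp_def)
  moreover have "inj_on (\<lambda>x. \<xi> (\<one>\<^bsub>G\<^esub>, x)) (carrier K)"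
  proof (rule inj_onI)
    fix x y assume "x \<in> carrier K" "y \<in> carrier K" "\<xi> (\<one>\<^bsub>G\<^esub>, x) = \<xi> (\<one>\<^bsub>G\<^esub>, y)"
    then show "x = y" using inj_onD[OF \<xi>(2), of "(\<one>\<^bsub>G\<^esub>, x)" "(\<one>\<^bsub>G\<^esub>, y)"] by simp
  qed
  ultimately show ?thesis by (simp add: mon_def)
qed

text \<open>
  The tuple that solves the system in \<open>K\<close> is carried over to the second factor of $E \times K$, where
  the names needed for the neighbourhood of \<open>E\<close> are given to the elements of the first factor.
\<close>

lemma dense_solving_set:
  assumes P: "P \<in> group_properties" and K: "group K" "P K" "k ` {..<n} \<subseteq> carrier K"
    and words: "set R \<subseteq> words_over n" "set T \<subseteq> words_over n"
    and sat: "\<And>r. r \<in> set R \<Longrightarrow> word_eval K k r = \<one>\<^bsub>K\<^esub>" "\<And>t. t \<in> set T \<Longrightarrow> word_eval K k t \<noteq> \<one>\<^bsub>K\<^esub>"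
  shows "top_of_set (enumerated_groups_with P) closure_of solving_set (enumerated_groups_with P) R T =
    enumerated_groups_with P"
proof -
  let ?S = "enumerated_groups_with P"
  have "solving_set ?S R T \<inter> U \<noteq> {}" if U: "openin (top_of_set ?S) U" "U \<noteq> {}" for U
  proof -
    obtain E where E: "E \<in> U" using U(2) by blast
    then have ES: "E \<in> ?S" using openin_subset[OF U(1)] by auto
    then have E': "E \<in> enumerated_groups" by (simp add: enumerated_groups_with_def)
    interpret G: group "group_of E" by (rule enumerated_groupsD(1)[OF E'])
    interpret K: group K by fact
    interpret M: group "group_of E \<times>\<times> K" by (rule DirProd_group) unfold_locales
    obtain N where N: "\<And>F. F \<in> ?S \<Longrightarrow> agree_below N E F \<Longrightarrow> F \<in> U"
      by (rule openin_agree_below[OF U(1) E]) blast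
    obtain N' where N': "N \<le> N'" "\<And>x y. x < N \<Longrightarrow> y < N \<Longrightarrow> fst E (x, y) < N'"
      "\<And>x. x < N \<Longrightarrow> fst (snd E) x < N'" "snd (snd E) < N'"
      by (rule enumeration_support_bound[where N = N and E = E]) (rule that)
    let ?\<theta> = "\<lambda>x. (x, \<one>\<^bsub>K\<^esub>)"
    have \<theta>: "inj_on ?\<theta> {..<N'}" "?\<theta> ` {..<N'} \<subseteq> carrier (group_of E \<times>\<times> K)"
      by (auto simp: inj_on_def DirProd_def)
    have hom: "?\<theta> (fst E (x, y)) = ?\<theta> x \<otimes>\<^bsub>group_of E \<times>\<times> K\<^esub> ?\<theta> y" for x y
      by (simp add: mult_DirProd')
    obtain F \<xi> where F: "F \<in> ?S" "\<xi> \<in> iso (group_of E \<times>\<times> K) (group_of F)" "agree_below N E F"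
      by (rule extend_partial_enumeration[OF P ES K(1,2) N'(2,3,4,1) \<theta> hom]) (assumption | (rule that; assumption))+
    have F': "group (group_of F)" using F(1) enumerated_groupsD(1) by (simp add: enumerated_groups_with_def)
    interpret F: group "group_of F" by fact
    define j where "j x = \<xi> (\<one>\<^bsub>group_of E\<^esub>, x)" for x
    have "j \<in> mon K (group_of F)"
      unfolding j_def[abs_def] by (rule second_factor_mon[OF G.is_group K(1) F' F(2)])
    then have jhom: "j \<in> hom K (group_of F)" and jinj: "inj_on j (carrier K)" by (auto simp: mon_def)
    interpret j: group_hom K "group_of F" j by unfold_locales (rule jhom)
    have j_one: "j x = \<one>\<^bsub>group_of F\<^esub> \<longleftrightarrow> x = \<one>\<^bsub>K\<^esub>" if "x \<in> carrier K" for x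
      using inj_on_eq_iff[OF jinj that K.one_closed] j.hom_one by simp
    have "word_eval (group_of F) (\<lambda>i. j (k i)) w = \<one>\<^bsub>group_of F\<^esub> \<longleftrightarrow> word_eval K k w = \<one>\<^bsub>K\<^esub>"
      if "w \<in> words_over n" for w
      using word_eval_hom[OF K(1) F' jhom K(3) that] j_one[OF K.word_eval_closed[OF K(3) that]] by simp
    then have "F \<in> solving_set ?S R T"
      unfolding solving_set_def using F(1) sat words
      by (intro CollectI conjI exI[of _ "\<lambda>i. j (k i)"] ballI) (blast dest: subsetD)+
    with N[OF F(1,3)] show ?thesis by blast
  qed
  then show ?thesis
    using dense_intersects_open[of "top_of_set ?S" "solving_set ?S R T"] by simp
qed

section \<open>Embedding finitely presented data generically\<close>

text \<open>
  The kernel of \<open>h\<close> on the simple group \<open>S\<close> is a normal subgroup that misses \<open>x\<close>, so it is trivial.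
\<close>

lemma simple_subgroup_inj:
  assumes h: "group_hom K L h" and S: "subgroup S K" and simple: "is_simple_grp (K\<lparr>carrier := S\<rparr>)"
    and x: "x \<in> S" "h x \<noteq> \<one>\<^bsub>L\<^esub>"
  shows "inj_on h S"
proof -
  interpret group_hom K L h by fact
  let ?S = "K\<lparr>carrier := S\<rparr>"
  have SK: "S \<subseteq> carrier K" by (rule subgroup.subset[OF S])
  interpret S: group_hom ?S L h
    by (intro group_hom.intro group_hom_axioms.intro G.subgroup_imp_group[OF S] H.is_group homI)
      (use SK in \<open>auto simp: subset_iff\<close>)
  have "kernel ?S L h \<noteq> S" using x by (auto simp: kernel_def)
  then have "kernel ?S L h = {\<one>\<^bsub>?S\<^esub>}"
    using simple S.normal_kernel unfolding is_simple_grp_def by auto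
  then show ?thesis using S.inj_iff_trivial_ker by simp
qed

lemma presentation_relators:
  assumes "presentation K n R k"
  shows "R \<subseteq> words_over n" "\<And>r. r \<in> R \<Longrightarrow> word_eval K k r = \<one>\<^bsub>K\<^esub>"
    "k ` {..<n} \<subseteq> carrier K" "R \<subseteq> carrier (free_group n)"
proof -
  show R: "R \<subseteq> carrier (free_group n)" and "k ` {..<n} \<subseteq> carrier K" using assms by (auto simp: presentation_def)
  then show "R \<subseteq> words_over n" by (auto simp: carrier_free_group)
  show "word_eval K k r = \<one>\<^bsub>K\<^esub>" if "r \<in> R" for r
    using assms that R normal_closure_normal(2)[OF group_free_group R] unfolding presentation_def by blast
qed

lemma presentation_words:
  assumes "group K" "presentation K n R k" "x \<in> carrier K"
  shows "\<exists>w\<in>words_over n. word_eval K k w = x"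
proof -
  interpret group K by fact
  have "k ` {..<n} \<subseteq> carrier K" "generate K (k ` {..<n}) = carrier K"
    using assms(2) by (auto simp: presentation_def)
  with generate_words[of k n] assms(3) have "x \<in> word_eval K k ` words_over n" by simp
  then show ?thesis by auto
qed

lemma solvable_word_problem_finitely_generated:
  assumes "solvable_word_problem H"
  shows "finitely_generated H"
proof -
  obtain n and a :: "nat \<Rightarrow> 'a" where "a ` {..<n} \<subseteq> carrier H" "generate H (a ` {..<n}) = carrier H"
    using assms unfolding solvable_word_problem_def by (elim exE conjE) (rule that; assumption)
  then show ?thesis unfolding finitely_generated_def by (intro exI[of _ "a ` {..<n}"]) auto
qed

text \<open>
  This turns an embedding of a simple group, a condition about infinitely many elements, into
  finitely many equations and one inequation about a tuple.
\<close>

lemma nontrivial_solution_embedding: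
  assumes K: "group K" "presentation K n R k" and S: "subgroup S K" "is_simple_grp (K\<lparr>carrier := S\<rparr>)"
    and s: "s \<in> words_over n" "word_eval K k s \<in> S"
    and L: "group L" "b ` {..<n} \<subseteq> carrier L" "\<And>r. r \<in> R \<Longrightarrow> word_eval L b r = \<one>\<^bsub>L\<^esub>"
    and bs: "word_eval L b s \<noteq> \<one>\<^bsub>L\<^esub>"
  obtains h where "h \<in> hom K L" "inj_on h S" "\<And>w. w \<in> words_over n \<Longrightarrow> h (word_eval K k w) = word_eval L b w"
proof -
  obtain h where h: "h \<in> hom K L" "\<And>w. w \<in> words_over n \<Longrightarrow> h (word_eval K k w) = word_eval L b w"
    by (rule von_Dyck[OF K L]) (assumption | rule that)+
  have "group_hom K L h" using K(1) L(1) h(1) by (simp add: group_hom_def group_hom_axioms_def)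
  then have "inj_on h S"
    by (rule simple_subgroup_inj[OF _ S s(2)]) (use h(2)[OF s(1)] bs in simp)
  with h that show ?thesis by blast
qed

lemma boone_higman_presentation:
  assumes "boone_higman P" "group H" "solvable_word_problem H" "P H"
  obtains K :: "nat monoid" and n R k S s j where "group K" "P K" "finite R" "presentation K n R k"
    "subgroup S K" "is_simple_grp (K\<lparr>carrier := S\<rparr>)" "s \<in> words_over n" "word_eval K k s \<in> S"
    "word_eval K k s \<noteq> \<one>\<^bsub>K\<^esub>" "j \<in> mon H K" "j ` carrier H \<subseteq> S"
proof -
  obtain K S where K: "group K" "finitely_presented K" "P K" and S: "subgroup S K"
    and simple: "is_simple_grp (K\<lparr>carrier := S\<rparr>)" and j: "mon H (K\<lparr>carrier := S\<rparr>) \<noteq> {}"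
    using assms solvable_word_problem_finitely_generated[OF assms(3)] unfolding boone_higman_def by metis
  obtain j where j: "j \<in> mon H (K\<lparr>carrier := S\<rparr>)" using j by blast
  have SK: "S \<subseteq> carrier K" by (rule subgroup.subset[OF S])
  have jS: "j ` carrier H \<subseteq> S" using j by (auto simp: mon_def hom_def)
  have jK: "j \<in> mon H K" using j SK by (auto simp: mon_def hom_def Pi_iff)
  obtain n R k where R: "finite R" "presentation K n R k"
    by (rule finitely_presented_presentation[OF K(1,2)])
  have "S \<noteq> {\<one>\<^bsub>K\<^esub>}" "\<one>\<^bsub>K\<^esub> \<in> S" using simple subgroup.one_closed[OF S] by (auto simp: is_simple_grp_def)
  then obtain x where x: "x \<in> S" "x \<noteq> \<one>\<^bsub>K\<^esub>" by blast
  then obtain s where s: "s \<in> words_over n" "word_eval K k s = x"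
    using presentation_words[OF K(1) R(2), of x] SK by blast
  show ?thesis
    by (rule that[OF K(1,3) R S simple s(1) _ _ jK jS]) (use s x in auto)
qed

lemma iso_type_eqI:
  assumes "group H" "group K" "H \<cong> K"
  shows "iso_type H = iso_type K"
  unfolding iso_type_def using assms group.iso_sym iso_trans by blast

lemma mon_imp_fg_subgroup_type:
  assumes H: "group H" "finitely_generated H" and G: "group G" and f: "f \<in> mon H G"
  shows "iso_type H \<in> fg_subgroup_types G"
proof -
  interpret f: group_hom H G f using assms by (simp add: group_hom_def group_hom_axioms_def mon_def)
  let ?K = "f ` carrier H"
  have K: "subgroup ?K G" by (rule f.img_is_subgroup)
  have epi: "f \<in> epi H (G\<lparr>carrier := ?K\<rparr>)" by (auto simp: epi_def intro!: homI)
  have GK: "group (G\<lparr>carrier := ?K\<rparr>)" by (rule f.H.subgroup_imp_group[OF K])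
  have "f \<in> iso H (G\<lparr>carrier := ?K\<rparr>)" using epi f by (auto simp: iso_def epi_def mon_def bij_betw_def)
  then have "iso_type H = iso_type (G\<lparr>carrier := ?K\<rparr>)"
    by (intro iso_type_eqI H GK) (auto simp: is_iso_def)
  moreover have "finitely_generated (G\<lparr>carrier := ?K\<rparr>)"
    by (rule finitely_generated_image[OF H(1) GK epi H(2)])
  ultimately show ?thesis unfolding fg_subgroup_types_def using K by blast
qed

lemma generic_embedding:
  assumes P: "P \<in> group_properties" "boone_higman P"
    and H: "group H" "solvable_word_problem H" "P H"
  obtains R T where
    "top_of_set (enumerated_groups_with P) closure_of solving_set (enumerated_groups_with P) R T = enumerated_groups_with P"
    "\<And>E. E \<in> solving_set (enumerated_groups_with P) R T \<Longrightarrow> mon H (group_of E) \<noteq> {}"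
proof -
  obtain K :: "nat monoid" and n R k S s j where K: "group K" "P K" and R: "finite R" "presentation K n R k"
    and S: "subgroup S K" "is_simple_grp (K\<lparr>carrier := S\<rparr>)"
    and s: "s \<in> words_over n" "word_eval K k s \<in> S" "word_eval K k s \<noteq> \<one>\<^bsub>K\<^esub>"
    and j: "j \<in> mon H K" "j ` carrier H \<subseteq> S"
    by (rule boone_higman_presentation[OF P(2) H])
  obtain Rs where Rs: "set Rs = R" using finite_list[OF R(1)] by blast
  note rel = presentation_relators[OF R(2)]
  show ?thesis
  proof (rule that[of Rs "[s]"])
    show "top_of_set (enumerated_groups_with P) closure_of solving_set (enumerated_groups_with P) Rs [s] = enumerated_groups_with P"
      by (rule dense_solving_set[OF P(1) K rel(3)]) (use rel s Rs in auto)
  next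
    fix E assume E: "E \<in> solving_set (enumerated_groups_with P) Rs [s]"
    then have "E \<in> enumerated_groups" by (simp add: solving_set_def enumerated_groups_with_def)
    then have G: "group (group_of E)" by (rule enumerated_groupsD(1))
    obtain b where b: "\<forall>r\<in>set Rs. word_eval (group_of E) b r = \<one>\<^bsub>group_of E\<^esub>"
      "\<forall>t\<in>set [s]. word_eval (group_of E) b t \<noteq> \<one>\<^bsub>group_of E\<^esub>"
      using E unfolding solving_set_def by blast
    have bc: "b ` {..<n} \<subseteq> carrier (group_of E)" by simp
    have br: "word_eval (group_of E) b r = \<one>\<^bsub>group_of E\<^esub>" if "r \<in> R" for r using b(1) Rs that by blast
    have bs: "word_eval (group_of E) b s \<noteq> \<one>\<^bsub>group_of E\<^esub>" using b(2) by simp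
    obtain h where h: "h \<in> hom K (group_of E)" "inj_on h S"
      by (rule nontrivial_solution_embedding[OF K(1) R(2) S s(1,2) G bc br bs])
    have jhom: "j \<in> hom H K" and jinj: "inj_on j (carrier H)" using j(1) by (auto simp: mon_def)
    have "h \<circ> j \<in> mon H (group_of E)"
      unfolding mon_def using hom_compose[OF jhom h(1)] comp_inj_on[OF jinj inj_on_subset[OF h(2) j(2)]] by simp
    then show "mon H (group_of E) \<noteq> {}" by blast
  qed
qed

lemma generic_unsolvable_subgroup:
  assumes P: "P \<in> group_properties" "subgroup_inherited P" and su: "strongly_undecidable P"
  obtains R T where
    "top_of_set (enumerated_groups_with P) closure_of solving_set (enumerated_groups_with P) R T = enumerated_groups_with P"
    "\<And>E. E \<in> solving_set (enumerated_groups_with P) R T \<Longrightarrow>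
      fg_subgroup_types (group_of E) \<inter> unsolvable_fg_types P \<noteq> {}"
proof -
  obtain G :: "nat monoid" and X where G: "group G" "finitely_presented G" and X: "finite X" "X \<subseteq> carrier G"
    and ex: "\<exists>H \<phi>. group H \<and> P H \<and> \<phi> \<in> epi G H \<and> inj_on \<phi> X"
    and un: "\<forall>H. group H \<and> P H \<and> (\<exists>\<phi>. \<phi> \<in> epi G H \<and> inj_on \<phi> X) \<longrightarrow> \<not> solvable_word_problem H"
    using su unfolding strongly_undecidable_def by (elim exE conjE) (rule that; blast)
  obtain H \<phi> where H: "group H" "P H" and \<phi>: "\<phi> \<in> epi G H" "inj_on \<phi> X" using ex by blast
  obtain n R k where R: "finite R" "presentation G n R k"
    by (rule finitely_presented_presentation[OF G])
  interpret G: group G by fact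
  note rel = presentation_relators[OF R(2)]
  obtain Rs where Rs: "set Rs = R" using finite_list[OF R(1)] by blast
  have "\<forall>x\<in>X. \<exists>w. w \<in> words_over n \<and> word_eval G k w = x"
    using presentation_words[OF G(1) R(2)] X(2) by blast
  then obtain u where u: "\<And>x. x \<in> X \<Longrightarrow> u x \<in> words_over n" "\<And>x. x \<in> X \<Longrightarrow> word_eval G k (u x) = x"
    by metis
  (* this word is nontrivial if and only if x and y have different images *)
  let ?d = "\<lambda>(x, y). u x @ rev (map inv_letter (u y))"
  let ?X2 = "{(x, y). x \<in> X \<and> y \<in> X \<and> x \<noteq> y}"
  have "finite ?X2" by (rule finite_subset[of _ "X \<times> X"]) (use X in auto)
  then obtain Ts where Ts: "set Ts = ?d ` ?X2" using finite_list[of "?d ` ?X2"] by blast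
  have d_words: "?d z \<in> words_over n" if "z \<in> ?X2" for z
    using that u(1) words_over_inverse by auto
  have d_eval: "word_eval L b (?d (x, y)) = \<one>\<^bsub>L\<^esub> \<longleftrightarrow> h x = h y"
    if L: "group L" "b ` {..<n} \<subseteq> carrier L" and xy: "x \<in> X" "y \<in> X"
      and h: "\<And>w. w \<in> words_over n \<Longrightarrow> h (word_eval G k w) = word_eval L b w" for L :: "nat monoid" and b h x y
  proof -
    interpret L: group L by fact
    have e: "h x = word_eval L b (u x)" "h y = word_eval L b (u y)" using h[OF u(1)] u(2) xy by metis+
    have c: "h x \<in> carrier L" "h y \<in> carrier L" unfolding e using L.word_eval_closed[OF L(2) u(1)] xy by auto
    have "word_eval L b (?d (x, y)) = h x \<otimes>\<^bsub>L\<^esub> inv\<^bsub>L\<^esub> (h y)"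
      using L.word_eval_append[OF L(2) u(1)[OF xy(1)] words_over_inverse[OF u(1)[OF xy(2)]]]
        L.word_eval_inverse(1)[OF L(2) u(1)[OF xy(2)]] by (simp add: e)
    then show ?thesis using c by (simp add: L.inv_solve_right')
  qed
  have \<phi>hom: "\<phi> \<in> hom G H" using \<phi> by (simp add: epi_def)
  interpret \<phi>: group_hom G H \<phi> using G(1) H(1) \<phi>hom by (simp add: group_hom_def group_hom_axioms_def)
  let ?k = "\<lambda>i. \<phi> (k i)"
  have kH: "?k ` {..<n} \<subseteq> carrier H" using rel(3) by auto
  have \<phi>eval: "\<phi> (word_eval G k w) = word_eval H ?k w" if "w \<in> words_over n" for w
    by (rule word_eval_hom[OF G(1) H(1) \<phi>hom rel(3) that])
  show ?thesis
  proof (rule that[of Rs Ts])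
    show "top_of_set (enumerated_groups_with P) closure_of solving_set (enumerated_groups_with P) Rs Ts = enumerated_groups_with P"
    proof (rule dense_solving_set[OF P(1) H kH])
      show "set Rs \<subseteq> words_over n" using Rs rel(1) by simp
      show "set Ts \<subseteq> words_over n" unfolding Ts using d_words by blast
      show "word_eval H ?k r = \<one>\<^bsub>H\<^esub>" if "r \<in> set Rs" for r
        using that Rs rel(1,2) \<phi>eval[of r] by auto
      show "word_eval H ?k t \<noteq> \<one>\<^bsub>H\<^esub>" if t: "t \<in> set Ts" for t
      proof -
        obtain x y where xy: "t = ?d (x, y)" "x \<in> X" "y \<in> X" "x \<noteq> y" using t unfolding Ts by blast
        then show ?thesis
          using d_eval[OF H(1) kH xy(2,3) \<phi>eval] inj_onD[OF \<phi>(2)] by blast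
      qed
    qed
  next
    fix E assume E: "E \<in> solving_set (enumerated_groups_with P) Rs Ts"
    then have E': "E \<in> enumerated_groups" "P (group_of E)" by (simp_all add: solving_set_def enumerated_groups_with_def)
    have L: "group (group_of E)" by (rule enumerated_groupsD(1)[OF E'(1)])
    obtain b where b: "\<forall>r\<in>set Rs. word_eval (group_of E) b r = \<one>\<^bsub>group_of E\<^esub>"
      "\<forall>t\<in>set Ts. word_eval (group_of E) b t \<noteq> \<one>\<^bsub>group_of E\<^esub>"
      using E unfolding solving_set_def by blast
    have bc: "b ` {..<n} \<subseteq> carrier (group_of E)" by simp
    have br: "word_eval (group_of E) b r = \<one>\<^bsub>group_of E\<^esub>" if "r \<in> R" for r using b(1) Rs that by blast
    obtain h where h: "h \<in> hom G (group_of E)" "\<And>w. w \<in> words_over n \<Longrightarrow> h (word_eval G k w) = word_eval (group_of E) b w"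
      by (rule von_Dyck[OF G(1) R(2) L bc br]) (assumption | rule that)+
    have "inj_on h X"
    proof (rule inj_onI, rule ccontr)
      fix x y assume xy: "x \<in> X" "y \<in> X" "h x = h y" "x \<noteq> y"
      then have "?d (x, y) \<in> set Ts" unfolding Ts by blast
      with b(2) d_eval[OF L bc xy(1,2) h(2)] xy(3) show False by blast
    qed
    moreover have hom: "group_hom G (group_of E) h" using G(1) L h(1) by (simp add: group_hom_def group_hom_axioms_def)
    let ?K = "h ` carrier G"
    let ?L = "(group_of E)\<lparr>carrier := ?K\<rparr>"
    have K: "subgroup ?K (group_of E)" and epi: "h \<in> epi G ?L"
      using group_hom_subgroup_image[OF hom G.subgroup_self] by simp_all
    have grp: "group ?L" by (rule group.subgroup_imp_group[OF L K])
    have PL: "P ?L" using P(2) L E'(2) K unfolding subgroup_inherited_def by blast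
    ultimately have uns: "\<not> solvable_word_problem ?L" using un grp epi by blast
    have "finitely_generated G"
      unfolding finitely_generated_def using R(2) by (intro exI[of _ "k ` {..<n}"]) (auto simp: presentation_def)
    then have fg: "finitely_generated ?L" by (rule finitely_generated_image[OF G(1) grp epi])
    have "iso_type ?L \<in> fg_subgroup_types (group_of E)" unfolding fg_subgroup_types_def using K fg by blast
    moreover have "iso_type ?L \<in> unsolvable_fg_types P" unfolding unsolvable_fg_types_def using grp fg PL uns by blast
    ultimately show "fg_subgroup_types (group_of E) \<inter> unsolvable_fg_types P \<noteq> {}" by blast
  qed
qed

section \<open>Generic solvability of the word problem\<close>

lemma inv_into_mon:
  assumes "group H" "group G" "f \<in> mon H G" "subgroup K G" "K \<subseteq> f ` carrier H"
  shows "inv_into (carrier H) f \<in> mon (G\<lparr>carrier := K\<rparr>) H"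
proof -
  interpret f: group_hom H G f using assms by (simp add: group_hom_def group_hom_axioms_def mon_def)
  have inj: "inj_on f (carrier H)" using assms(3) by (simp add: mon_def)
  show ?thesis
    unfolding mon_def
  proof (intro CollectI conjI homI)
    fix x assume "x \<in> carrier (G\<lparr>carrier := K\<rparr>)"
    then show "inv_into (carrier H) f x \<in> carrier H" using assms(5) by (auto intro: inv_into_into)
  next
    fix x y assume "x \<in> carrier (G\<lparr>carrier := K\<rparr>)" "y \<in> carrier (G\<lparr>carrier := K\<rparr>)"
    then have "x \<in> f ` carrier H" "y \<in> f ` carrier H" using assms(5) by auto
    then obtain a b where "a \<in> carrier H" "b \<in> carrier H" "x = f a" "y = f b" by blast
    then show "inv_into (carrier H) f (x \<otimes>\<^bsub>G\<lparr>carrier := K\<rparr>\<^esub> y) = inv_into (carrier H) f x \<otimes>\<^bsub>H\<^esub> inv_into (carrier H) f y"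
      using inj by (simp flip: f.hom_mult)
  next
    show "inj_on (inv_into (carrier H) f) (carrier (G\<lparr>carrier := K\<rparr>))"
      using inj_on_inv_into[OF assms(5)] by simp
  qed
qed

text \<open>
  The part of the multiplication table of \<open>E\<close> that only involves names below \<open>N\<close>, read as relators. The words
  are freely reduced, because a product $x y = y$ would otherwise give a word that is not
  in the free group.
\<close>

definition multiplication_relators :: "nat \<Rightarrow> enumeration \<Rightarrow> gword set" where
  "multiplication_relators N E = (\<lambda>(x, y). foldr cons_reduce [(x, True), (y, True), (fst E (x, y), False)] []) `
    {(x, y). x < N \<and> y < N \<and> fst E (x, y) < N}"

lemma multiplication_relators:
  shows "finite (multiplication_relators N E)" "multiplication_relators N E \<subseteq> carrier (free_group N)"
proof -
  have "finite {(x, y). x < N \<and> y < N \<and> fst E (x, y) < N}"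
    by (rule finite_subset[of _ "{..<N} \<times> {..<N}"]) auto
  then show "finite (multiplication_relators N E)" by (simp add: multiplication_relators_def)
  show "multiplication_relators N E \<subseteq> carrier (free_group N)"
    unfolding multiplication_relators_def carrier_free_group
    by (auto simp: reduced_foldr foldr_cons_reduce_words_over simp del: foldr.simps)
qed

lemma (in group) word_eval_multiplication_relator:
  assumes "a ` {..<N} \<subseteq> carrier G" "x < N" "y < N" "z < N"
  shows "word_eval G a (foldr cons_reduce [(x, True), (y, True), (z, False)] []) = \<one> \<longleftrightarrow> a x \<otimes> a y = a z"
proof -
  have "a x \<in> carrier G" "a y \<in> carrier G" "a z \<in> carrier G" using assms by auto
  moreover have "word_eval G a (foldr cons_reduce [(x, True), (y, True), (z, False)] []) =
    word_eval G a [(x, True), (y, True), (z, False)]"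
    using word_eval_foldr_cons_reduce[OF assms(1), of "[(x, True), (y, True), (z, False)]" "[]"] assms(2-4) calculation
    by (simp del: foldr.simps)
  ultimately show ?thesis by (simp add: m_assoc[symmetric] inv_solve_right')
qed

text \<open>
  The names below \<open>N\<close> generate a subgroup of \<open>E\<close> with \<open>P\<close>, and it is a quotient of the group presented by
  the table in which these names remain distinct. If all quotients of this kind had an unsolvable word
  problem, the presented group would witness that \<open>P\<close> is strongly undecidable.
\<close>

lemma solvable_approximation:
  assumes P: "P \<in> group_properties" "subgroup_inherited P" and nsu: "\<not> strongly_undecidable P"
    and E: "E \<in> enumerated_groups_with P"
  obtains H :: "nat monoid" and a where "group H" "P H" "solvable_word_problem H"
    "a ` {..<N} \<subseteq> carrier H" "inj_on a {..<N}"
    "\<And>x y. x < N \<Longrightarrow> y < N \<Longrightarrow> fst E (x, y) < N \<Longrightarrow> a (fst E (x, y)) = a x \<otimes>\<^bsub>H\<^esub> a y"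
proof -
  let ?R = "multiplication_relators N E"
  have E': "E \<in> enumerated_groups" "P (group_of E)" using E by (simp_all add: enumerated_groups_with_def)
  have L: "group (group_of E)" by (rule enumerated_groupsD(1)[OF E'(1)])
  obtain G :: "nat monoid" and k where G: "group G" "finitely_presented G" "presentation G N ?R k"
    by (rule finitely_presented_nat_group[OF multiplication_relators])
  interpret G: group G by fact
  note rel = presentation_relators[OF G(3)]
  have kc: "k i \<in> carrier G" if "i < N" for i using rel(3) that by auto
  have kmult: "k (fst E (x, y)) = k x \<otimes>\<^bsub>G\<^esub> k y" if "x < N" "y < N" "fst E (x, y) < N" for x y
  proof -
    have "foldr cons_reduce [(x, True), (y, True), (fst E (x, y), False)] [] \<in> ?R"
      unfolding multiplication_relators_def using that by (intro image_eqI[of _ _ "(x, y)"]) auto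
    from rel(2)[OF this] show ?thesis
      using G.word_eval_multiplication_relator[OF rel(3) that] by simp
  qed
  have "word_eval (group_of E) (\<lambda>i. i) r = \<one>\<^bsub>group_of E\<^esub>" if r: "r \<in> ?R" for r
  proof -
    obtain x y where xy: "r = foldr cons_reduce [(x, True), (y, True), (fst E (x, y), False)] []"
      "x < N" "y < N" "fst E (x, y) < N"
      using r unfolding multiplication_relators_def by (auto simp del: foldr.simps)
    show ?thesis unfolding xy(1)
      using group.word_eval_multiplication_relator[OF L, of "\<lambda>i. i" N, OF _ xy(2-4)] by simp
  qed
  then obtain h where h: "h \<in> hom G (group_of E)"
    "\<And>w. w \<in> words_over N \<Longrightarrow> h (word_eval G k w) = word_eval (group_of E) (\<lambda>i. i) w"
    by (rule von_Dyck[OF G(1,3) L, of "\<lambda>i. i", rotated]) (auto intro: that)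
  have hk: "h (k i) = i" if "i < N" for i
    using h(2)[of "[(i, True)]"] that kc[OF that] monoid.r_one[OF group.is_monoid[OF L], of i] by simp
  have hom: "group_hom G (group_of E) h" using G(1) L h(1) by (simp add: group_hom_def group_hom_axioms_def)
  let ?K = "h ` carrier G"
  let ?L = "(group_of E)\<lparr>carrier := ?K\<rparr>"
  have K: "subgroup ?K (group_of E)" and epi: "h \<in> epi G ?L"
    using group_hom_subgroup_image[OF hom G.subgroup_self] by simp_all
  have grp: "group ?L" by (rule group.subgroup_imp_group[OF L K])
  have PL: "P ?L" using P(2) L E'(2) K unfolding subgroup_inherited_def by blast
  have inj: "inj_on h (k ` {..<N})" by (rule inj_onI) (auto simp: hk)
  have "\<exists>H \<phi>. group H \<and> P H \<and> \<phi> \<in> epi G H \<and> inj_on \<phi> (k ` {..<N}) \<and> solvable_word_problem H"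
  proof (rule ccontr)
    assume neg: "\<not> ?thesis"
    then have none: "\<forall>H. group H \<and> P H \<and> (\<exists>\<phi>. \<phi> \<in> epi G H \<and> inj_on \<phi> (k ` {..<N})) \<longrightarrow> \<not> solvable_word_problem H"
      by blast
    have some: "\<exists>H \<phi>. group H \<and> P H \<and> \<phi> \<in> epi G H \<and> inj_on \<phi> (k ` {..<N})"
      using grp PL epi inj by blast
    have "strongly_undecidable P"
      unfolding strongly_undecidable_def
      by (rule exI[of _ G], rule exI[of _ "k ` {..<N}"])
        (intro conjI G(1,2) rel(3) finite_imageI finite_lessThan some none)
    with nsu show False by blast
  qed
  then obtain H \<phi> where H: "group H" "P H" "solvable_word_problem H" and \<phi>: "\<phi> \<in> epi G H" "inj_on \<phi> (k ` {..<N})"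
    by blast
  have \<phi>hom: "\<phi> \<in> hom G H" using \<phi>(1) by (simp add: epi_def)
  have kinj: "inj_on k {..<N}" by (rule inj_onI) (metis hk lessThan_iff)
  show ?thesis
  proof (rule that[OF H, of "\<lambda>i. \<phi> (k i)"])
    show "(\<lambda>i. \<phi> (k i)) ` {..<N} \<subseteq> carrier H" using \<phi>hom kc by (auto simp: hom_def)
    show "inj_on (\<lambda>i. \<phi> (k i)) {..<N}" using comp_inj_on[OF kinj \<phi>(2)] by (simp add: comp_def)
    show "\<phi> (k (fst E (x, y))) = \<phi> (k x) \<otimes>\<^bsub>H\<^esub> \<phi> (k y)" if "x < N" "y < N" "fst E (x, y) < N" for x y
      using kmult[OF that] hom_mult[OF \<phi>hom kc kc] that by simp
  qed
qed

section \<open>Generic groups\<close>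

abbreviation initial_subgroup :: "nat \<Rightarrow> enumeration \<Rightarrow> nat monoid" where
  "initial_subgroup N E \<equiv> (group_of E)\<lparr>carrier := generate (group_of E) {..<N}\<rparr>"

text \<open>
  Solvability of the word problem of the subgroup generated by the names below \<open>N\<close> need not be
  an open condition, so the interior of the set of groups with this property is taken.
\<close>

definition interior_solvable :: "enumeration set \<Rightarrow> nat \<Rightarrow> enumeration set" where
  "interior_solvable S N = \<Union>{U. openin (top_of_set S) U \<and> (\<forall>E\<in>U. solvable_word_problem (initial_subgroup N E))}"

lemma openin_interior_solvable: "openin (top_of_set S) (interior_solvable S N)"
  unfolding interior_solvable_def by (rule openin_Union) blast

lemma interior_solvableD:
  "E \<in> interior_solvable S N \<Longrightarrow> solvable_word_problem (initial_subgroup N E)"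
  by (auto simp: interior_solvable_def)

text \<open>
  The neighbourhood of \<open>E\<close> is entered with a copy of $E \times K$ in which the names that matter are given
  to elements of the second factor. There they form a copy of the generators of the approximating group
  \<open>H\<close>, which lies in a simple subgroup of \<open>K\<close>.
\<close>

lemma dense_interior_solvable:
  assumes P: "P \<in> group_properties" "boone_higman P" "subgroup_inherited P"
    and nsu: "\<not> strongly_undecidable P"
  shows "top_of_set (enumerated_groups_with P) closure_of interior_solvable (enumerated_groups_with P) N =
    enumerated_groups_with P"
proof -
  let ?S = "enumerated_groups_with P"
  have S: "?S \<subseteq> enumerated_groups" by (auto simp: enumerated_groups_with_def)
  have "interior_solvable ?S N \<inter> U \<noteq> {}" if U: "openin (top_of_set ?S) U" "U \<noteq> {}" for U
  proof -
    obtain E where E: "E \<in> U" using U(2) by blast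
    then have ES: "E \<in> ?S" using openin_subset[OF U(1)] by auto
    then have E': "E \<in> enumerated_groups" using S by blast
    interpret G: group "group_of E" by (rule enumerated_groupsD(1)[OF E'])
    obtain N0 where N0: "\<And>F. F \<in> ?S \<Longrightarrow> agree_below N0 E F \<Longrightarrow> F \<in> U"
      by (rule openin_agree_below[OF U(1) E]) blast
    define M where "M = max N N0"
    obtain M' where M': "M \<le> M'" "\<And>x y. x < M \<Longrightarrow> y < M \<Longrightarrow> fst E (x, y) < M'"
      "\<And>x. x < M \<Longrightarrow> fst (snd E) x < M'" "snd (snd E) < M'"
      by (rule enumeration_support_bound[where N = M and E = E]) (rule that)
    obtain H :: "nat monoid" and a where H: "group H" "P H" "solvable_word_problem H"
      and a: "a ` {..<M'} \<subseteq> carrier H" "inj_on a {..<M'}"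
      and amult: "\<And>x y. x < M' \<Longrightarrow> y < M' \<Longrightarrow> fst E (x, y) < M' \<Longrightarrow> a (fst E (x, y)) = a x \<otimes>\<^bsub>H\<^esub> a y"
      by (rule solvable_approximation[OF P(1,3) nsu ES, where N = M']) (rule that; assumption)
    obtain K :: "nat monoid" and n R k T s j where K: "group K" "P K" and R: "finite R" "presentation K n R k"
      and T: "subgroup T K" "is_simple_grp (K\<lparr>carrier := T\<rparr>)"
      and s: "s \<in> words_over n" "word_eval K k s \<in> T" "word_eval K k s \<noteq> \<one>\<^bsub>K\<^esub>"
      and j: "j \<in> mon H K" "j ` carrier H \<subseteq> T"
      by (rule boone_higman_presentation[OF P(2) H(1,3,2)])
    note rel = presentation_relators[OF R(2)]
    obtain Rs where Rs: "set Rs = R" using finite_list[OF R(1)] by blast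
    have jhom: "j \<in> hom H K" and jinj: "inj_on j (carrier H)" using j(1) by (auto simp: mon_def)
    interpret H: group H by fact
    interpret K: group K by fact
    have ac: "a x \<in> carrier H" if "x < M'" for x using a(1) that by auto
    have jc: "j (a x) \<in> carrier K" if "x < M'" for x using jhom ac[OF that] by (auto simp: hom_def)
    let ?\<theta> = "\<lambda>x. (\<one>\<^bsub>group_of E\<^esub>, j (a x))"
    have \<theta>: "inj_on ?\<theta> {..<M'}" "?\<theta> ` {..<M'} \<subseteq> carrier (group_of E \<times>\<times> K)"
    proof -
      have "inj_on (j \<circ> a) {..<M'}" by (rule comp_inj_on[OF a(2) inj_on_subset[OF jinj a(1)]])
      then show "inj_on ?\<theta> {..<M'}" by (auto simp: inj_on_def)
      show "?\<theta> ` {..<M'} \<subseteq> carrier (group_of E \<times>\<times> K)" using jc by (auto simp: DirProd_def)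
    qed
    have \<theta>hom: "?\<theta> (fst E (x, y)) = ?\<theta> x \<otimes>\<^bsub>group_of E \<times>\<times> K\<^esub> ?\<theta> y"
      if "x < M'" "y < M'" "fst E (x, y) < M'" for x y
      using amult[OF that] hom_mult[OF jhom ac[OF that(1)] ac[OF that(2)]] G.r_one[of "\<one>\<^bsub>group_of E\<^esub>"]
      by (simp add: mult_DirProd')
    obtain F \<xi> where F: "F \<in> ?S" "\<xi> \<in> iso (group_of E \<times>\<times> K) (group_of F)"
      and \<xi>\<theta>: "\<And>x. x < M' \<Longrightarrow> \<xi> (?\<theta> x) = x" and agree: "agree_below M E F"
      by (rule extend_partial_enumeration[OF P(1) ES K M'(2,3,4,1) \<theta> \<theta>hom]) (assumption | (rule that; assumption))+
    have FU: "F \<in> U"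
      by (rule N0[OF F(1) agree_below_mono[OF agree]]) (simp add: M_def)
    have F': "group (group_of F)" using F(1) S enumerated_groupsD(1) by blast
    define \<iota> where "\<iota> x = \<xi> (\<one>\<^bsub>group_of E\<^esub>, x)" for x
    have "\<iota> \<in> mon K (group_of F)"
      unfolding \<iota>_def[abs_def] by (rule second_factor_mon[OF G.is_group K(1) F' F(2)])
    then have \<iota>hom: "\<iota> \<in> hom K (group_of F)" and \<iota>inj: "inj_on \<iota> (carrier K)" by (auto simp: mon_def)
    interpret \<iota>: group_hom K "group_of F" \<iota> using K(1) F' \<iota>hom by (simp add: group_hom_def group_hom_axioms_def)
    define c where "c i = \<iota> (k i)" for i
    have c_eval: "word_eval (group_of F) c w = \<iota> (word_eval K k w)" if "w \<in> words_over n" for w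
      using word_eval_hom[OF K(1) F' \<iota>hom rel(3) that] by (simp add: c_def[abs_def])
    have "\<exists>w. w \<in> words_over n \<and> word_eval K k w = j (a x)" if "x < M'" for x
      using presentation_words[OF K(1) R(2) jc[OF that]] by blast
    then obtain w where w: "\<And>x. x < M' \<Longrightarrow> w x \<in> words_over n" "\<And>x. x < M' \<Longrightarrow> word_eval K k (w x) = j (a x)"
      by metis
    have NM: "x < M'" if "x < N" for x using that M'(1) by (simp add: M_def)
    (* The tuple c generates the copy of K. The last condition says that the names below N are
       the values at c of words for elements of H; it keeps them in the image of H. *)
    define V where "V = U \<inter> {E \<in> ?S. \<forall>r\<in>set Rs. word_eval (group_of E) c r = \<one>\<^bsub>group_of E\<^esub>} \<inter>
      {E \<in> ?S. word_eval (group_of E) c s \<noteq> \<one>\<^bsub>group_of E\<^esub>} \<inter>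
      {E \<in> ?S. \<forall>x\<in>set [0..<N]. word_eval (group_of E) c (w x) = x}"
    have "openin (top_of_set ?S) V"
      unfolding V_def
      by (intro openin_Int U(1) openin_finite_conj openin_word_eval[OF S])
    moreover have "solvable_word_problem (initial_subgroup N E)" if E: "E \<in> V" for E
    proof -
      have L: "group (group_of E)" using E S enumerated_groupsD(1) unfolding V_def by blast
      interpret L: group "group_of E" by fact
      have cc: "c ` {..<n} \<subseteq> carrier (group_of E)" by simp
      have cr: "word_eval (group_of E) c r = \<one>\<^bsub>group_of E\<^esub>" if "r \<in> R" for r
        using E that Rs unfolding V_def by blast
      have cs: "word_eval (group_of E) c s \<noteq> \<one>\<^bsub>group_of E\<^esub>" using E unfolding V_def by blast
      obtain h where h: "h \<in> hom K (group_of E)" "inj_on h T"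
        "\<And>w. w \<in> words_over n \<Longrightarrow> h (word_eval K k w) = word_eval (group_of E) c w"
        by (rule nontrivial_solution_embedding[OF K(1) R(2) T s(1,2) L cc cr cs]) (assumption | (rule that; assumption))+
      have f: "h \<circ> j \<in> mon H (group_of E)"
        unfolding mon_def using hom_compose[OF jhom h(1)] comp_inj_on[OF jinj inj_on_subset[OF h(2) j(2)]] by simp
      interpret f: group_hom H "group_of E" "h \<circ> j"
        using f H(1) L by (simp add: group_hom_def group_hom_axioms_def mon_def)
      have "x \<in> (h \<circ> j) ` carrier H" if x: "x < N" for x
      proof -
        have "h (j (a x)) = word_eval (group_of E) c (w x)" using h(3)[OF w(1)] w(2) NM[OF x] by metis
        also have "\<dots> = x" using E x unfolding V_def by simp
        finally show ?thesis using ac[OF NM[OF x]] by (intro image_eqI[of _ _ "a x"]) auto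
      qed
      then have "{..<N} \<subseteq> (h \<circ> j) ` carrier H" by blast
      then have sub: "generate (group_of E) {..<N} \<subseteq> (h \<circ> j) ` carrier H"
        by (rule L.generate_subgroup_incl[OF _ f.img_is_subgroup])
      have gen: "subgroup (generate (group_of E) {..<N}) (group_of E)" by (rule L.generate_is_subgroup) simp
      have "finitely_generated (initial_subgroup N E)"
        unfolding finitely_generated_def
        using L.generate_consistent[OF _ gen, of "{..<N}"] generate.incl[of _ "{..<N}" "group_of E"]
        by (intro exI[of _ "{..<N}"]) auto
      then show ?thesis
        by (rule solvable_word_problem_mon[OF L.subgroup_imp_group[OF gen] _ H(1,3)
          inv_into_mon[OF H(1) L f gen sub]])
    qed
    ultimately have "V \<subseteq> interior_solvable ?S N"
      unfolding interior_solvable_def by blast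
    moreover have "F \<in> V"
    proof -
      have "word_eval (group_of F) c r = \<one>\<^bsub>group_of F\<^esub>" if "r \<in> set Rs" for r
        using c_eval[of r] rel(1,2) that Rs \<iota>.hom_one by auto
      moreover have "word_eval (group_of F) c s \<noteq> \<one>\<^bsub>group_of F\<^esub>"
      proof
        assume "word_eval (group_of F) c s = \<one>\<^bsub>group_of F\<^esub>"
        then have "\<iota> (word_eval K k s) = \<iota> \<one>\<^bsub>K\<^esub>" using c_eval[OF s(1)] \<iota>.hom_one by simp
        then show False using inj_onD[OF \<iota>inj] s(3) K.word_eval_closed[OF rel(3) s(1)] K.one_closed by blast
      qed
      moreover have "word_eval (group_of F) c (w x) = x" if "x < N" for x
        using c_eval[OF w(1)] w(2) \<xi>\<theta> NM[OF that] by (simp add: \<iota>_def)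
      ultimately show ?thesis unfolding V_def using FU F(1) by auto
    qed
    moreover have "V \<subseteq> U" by (auto simp: V_def)
    ultimately show ?thesis by blast
  qed
  then show ?thesis
    using dense_intersects_open[of "top_of_set ?S" "interior_solvable ?S N"] by simp
qed

text \<open>
  The groups in which every system that is solvable in a dense set of groups is solvable.
\<close>

definition generic_solutions :: "(nat monoid \<Rightarrow> bool) \<Rightarrow> enumeration set" where
  "generic_solutions P = enumerated_groups_with P \<inter>
    \<Inter>{solving_set (enumerated_groups_with P) R T | R T.
      top_of_set (enumerated_groups_with P) closure_of solving_set (enumerated_groups_with P) R T =
        enumerated_groups_with P}"

text \<open>
  The family need not be indexed by numbers; pairs of lists of words and disjoint sums occur as
  index types.
\<close>

lemma comeager_in_Inter:
  fixes U :: "'i::countable \<Rightarrow> 'a set"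
  assumes "\<And>i. openin X (U i)" "\<And>i. X closure_of U i = topspace X"
  shows "comeager_in X (topspace X \<inter> (\<Inter>i. U i))"
  unfolding comeager_in_def
proof (intro conjI exI[of _ "\<lambda>n. U (from_nat n)"] allI assms)
  show "(\<Inter>n. U (from_nat n)) \<subseteq> topspace X \<inter> (\<Inter>i. U i)"
  proof
    fix x assume x: "x \<in> (\<Inter>n. U (from_nat n))"
    have "x \<in> U i" for i using x by (metis INT_E UNIV_I from_nat_to_nat)
    moreover have "U i \<subseteq> topspace X" for i by (rule openin_subset[OF assms(1)])
    ultimately show "x \<in> topspace X \<inter> (\<Inter>i. U i)" by blast
  qed
qed auto

lemma comeager_in_mono:
  assumes "comeager_in X A" "A \<subseteq> B" "B \<subseteq> topspace X"
  shows "comeager_in X B"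
proof -
  obtain U :: "nat \<Rightarrow> 'a set" where U: "\<forall>n. openin X (U n) \<and> X closure_of U n = topspace X" "(\<Inter>n. U n) \<subseteq> A"
    using assms(1) unfolding comeager_in_def by blast
  show ?thesis
    unfolding comeager_in_def by (intro conjI exI[of _ U] assms(3) U(1) order_trans[OF U(2) assms(2)])
qed

lemma comeager_in_Int:
  assumes "comeager_in X A" "comeager_in X B"
  shows "comeager_in X (A \<inter> B)"
proof -
  obtain U V :: "nat \<Rightarrow> 'a set" where U: "\<And>n. openin X (U n) \<and> X closure_of U n = topspace X" "(\<Inter>n. U n) \<subseteq> A"
    and V: "\<And>n. openin X (V n) \<and> X closure_of V n = topspace X" "(\<Inter>n. V n) \<subseteq> B"
    using assms unfolding comeager_in_def by blast
  have sub: "A \<subseteq> topspace X" using assms unfolding comeager_in_def by blast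
  have "comeager_in X (topspace X \<inter> (\<Inter>i. case i of Inl n \<Rightarrow> U n | Inr n \<Rightarrow> V n))"
    by (rule comeager_in_Inter) (use U(1) V(1) in \<open>auto split: sum.splits\<close>)
  moreover have "topspace X \<inter> (\<Inter>i. case i of Inl n \<Rightarrow> U n | Inr n \<Rightarrow> V n) \<subseteq> A \<inter> B"
  proof
    fix x assume "x \<in> topspace X \<inter> (\<Inter>i. case i of Inl n \<Rightarrow> U n | Inr n \<Rightarrow> V n)"
    then have x: "x \<in> (case i of Inl n \<Rightarrow> U n | Inr n \<Rightarrow> V n)" for i by blast
    have "x \<in> U n" "x \<in> V n" for n using x[of "Inl n"] x[of "Inr n"] by auto
    then show "x \<in> A \<inter> B" by (intro IntI subsetD[OF U(2)] subsetD[OF V(2)] INT_I)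
  qed
  ultimately show ?thesis by (rule comeager_in_mono) (use sub in auto)
qed

lemma comeager_generic_solutions:
  "comeager_in (top_of_set (enumerated_groups_with P)) (generic_solutions P)"
proof -
  let ?S = "enumerated_groups_with P"
  let ?X = "top_of_set ?S"
  define U where "U = (\<lambda>(R, T). if ?X closure_of solving_set ?S R T = ?S then solving_set ?S R T else ?S)"
  have S: "?S \<subseteq> enumerated_groups" by (auto simp: enumerated_groups_with_def)
  have "comeager_in ?X (topspace ?X \<inter> (\<Inter>i. U i))"
  proof (rule comeager_in_Inter)
    fix i show "openin ?X (U i)"
      using openin_solving_set[OF S] openin_topspace[of ?X] by (cases i) (simp add: U_def)
    show "?X closure_of U i = topspace ?X"
      using closure_of_topspace[of ?X] by (cases i) (simp add: U_def)
  qed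
  also have "topspace ?X \<inter> (\<Inter>i. U i) = generic_solutions P"
  proof (intro equalityI subsetI)
    fix E assume "E \<in> topspace ?X \<inter> (\<Inter>i. U i)"
    then have E: "E \<in> ?S" "\<And>R T. E \<in> U (R, T)" by auto
    have "E \<in> solving_set ?S R T" if "?X closure_of solving_set ?S R T = ?S" for R T
      using E(2)[of R T] that by (simp add: U_def)
    with E(1) show "E \<in> generic_solutions P" unfolding generic_solutions_def by blast
  next
    fix E assume E: "E \<in> generic_solutions P"
    then have "E \<in> ?S" by (simp add: generic_solutions_def)
    moreover have "E \<in> U (R, T)" for R T
    proof (cases "?X closure_of solving_set ?S R T = ?S")
      case True
      then show ?thesis using E unfolding generic_solutions_def U_def by auto
    next
      case False
      then show ?thesis using \<open>E \<in> ?S\<close> by (simp add: U_def)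
    qed
    ultimately show "E \<in> topspace ?X \<inter> (\<Inter>i. U i)" by auto
  qed
  finally show ?thesis .
qed

lemma generic_solutionsD:
  assumes "E \<in> generic_solutions P"
    "top_of_set (enumerated_groups_with P) closure_of solving_set (enumerated_groups_with P) R T =
      enumerated_groups_with P"
  shows "E \<in> solving_set (enumerated_groups_with P) R T"
  using assms unfolding generic_solutions_def by blast

lemma generic_solutions_contain_solvable:
  assumes P: "P \<in> group_properties" "boone_higman P" and E: "E \<in> generic_solutions P"
  shows "solvable_fg_types P \<subseteq> fg_subgroup_types (group_of E)"
proof
  fix t assume "t \<in> solvable_fg_types P"
  then obtain H where H: "group H" "finitely_generated H" "P H" "solvable_word_problem H" "t = iso_type H"
    unfolding solvable_fg_types_def by blast
  obtain R T where RT: "top_of_set (enumerated_groups_with P) closure_of solving_set (enumerated_groups_with P) R T =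
      enumerated_groups_with P"
    "\<And>E. E \<in> solving_set (enumerated_groups_with P) R T \<Longrightarrow> mon H (group_of E) \<noteq> {}"
    by (rule generic_embedding[OF P H(1,4,3)]) (rule that; assumption)
  obtain f where "f \<in> mon H (group_of E)" using RT(2)[OF generic_solutionsD[OF E RT(1)]] by blast
  moreover have "group (group_of E)"
    using E enumerated_groupsD(1) by (simp add: generic_solutions_def enumerated_groups_with_def)
  ultimately show "t \<in> fg_subgroup_types (group_of E)"
    unfolding H(5) by (intro mon_imp_fg_subgroup_type[OF H(1,2)])
qed

text \<open>
  A finite set of generators is bounded by some \<open>N\<close>, so the subgroup embeds in the one generated by the
  names below \<open>N\<close>.
\<close>

lemma fg_subgroup_types_solvable:
  assumes P: "subgroup_inherited P" and E: "E \<in> enumerated_groups_with P"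
    and solv: "\<And>N. solvable_word_problem (initial_subgroup N E)"
  shows "fg_subgroup_types (group_of E) \<subseteq> solvable_fg_types P"
proof
  fix t assume "t \<in> fg_subgroup_types (group_of E)"
  then obtain K where K: "subgroup K (group_of E)" "finitely_generated ((group_of E)\<lparr>carrier := K\<rparr>)"
    and t: "t = iso_type ((group_of E)\<lparr>carrier := K\<rparr>)"
    unfolding fg_subgroup_types_def by blast
  let ?K = "(group_of E)\<lparr>carrier := K\<rparr>"
  have E': "group (group_of E)" "P (group_of E)"
    using E enumerated_groupsD(1) by (simp_all add: enumerated_groups_with_def)
  interpret G: group "group_of E" by (rule E'(1))
  obtain S where S: "S \<subseteq> K" "finite S" "generate ?K S = K"
    using K(2) unfolding finitely_generated_def by auto
  from finite_nat_set_iff_bounded[THEN iffD1, OF S(2)] obtain N where N: "\<forall>x\<in>S. x < N" ..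
  let ?L = "generate (group_of E) {..<N}"
  have "K = generate (group_of E) S" using G.generate_consistent[OF S(1) K(1)] S(3) by simp
  also have "\<dots> \<subseteq> ?L" by (rule G.mono_generate) (use N in auto)
  finally have KL: "K \<subseteq> ?L" .
  have L: "subgroup ?L (group_of E)" by (rule G.generate_is_subgroup) simp
  have id: "(\<lambda>x. x) \<in> mon ?K (initial_subgroup N E)"
    using KL by (auto simp: mon_def hom_def)
  have grp: "group ?K" "group (initial_subgroup N E)"
    using G.subgroup_imp_group[OF K(1)] G.subgroup_imp_group[OF L] .
  have "solvable_word_problem ?K"
    by (rule solvable_word_problem_mon[OF grp(1) K(2) grp(2) solv id])
  moreover have "P ?K" using P E' K(1) unfolding subgroup_inherited_def by blast
  ultimately show "t \<in> solvable_fg_types P"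
    unfolding solvable_fg_types_def t using grp(1) K(2) by blast
qed

theorem theorem1p1p3:
  fixes P :: "nat monoid \<Rightarrow> bool"
  assumes "P \<in> group_properties"
    and "boone_higman P"
    and "subgroup_inherited P"
  shows "let
      case1 = (\<not> strongly_undecidable P \<and>
        (\<exists>X. comeager_in (top_of_set (enumerated_groups_with P)) X \<and>
          (\<forall>E\<in>X. fg_subgroup_types (group_of E) = solvable_fg_types P)));
      case2 = (strongly_undecidable P \<and>
        (\<exists>X. comeager_in (top_of_set (enumerated_groups_with P)) X \<and>
          (\<forall>E\<in>X. solvable_fg_types P \<subseteq> fg_subgroup_types (group_of E) \<and>
            fg_subgroup_types (group_of E) \<inter> unsolvable_fg_types P \<noteq> {})))
    in (case1 \<or> case2) \<and> \<not> (case1 \<and> case2)"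
proof -
  let ?S = "enumerated_groups_with P"
  let ?X = "top_of_set ?S"
  have 1: "\<exists>X. comeager_in ?X X \<and> (\<forall>E\<in>X. fg_subgroup_types (group_of E) = solvable_fg_types P)"
    if nsu: "\<not> strongly_undecidable P"
  proof (intro exI[of _ "generic_solutions P \<inter> (topspace ?X \<inter> (\<Inter>N. interior_solvable ?S N))"] conjI ballI)
    show "comeager_in ?X (generic_solutions P \<inter> (topspace ?X \<inter> (\<Inter>N. interior_solvable ?S N)))"
      by (intro comeager_in_Int comeager_generic_solutions comeager_in_Inter openin_interior_solvable)
        (simp add: dense_interior_solvable[OF assms nsu])
  next
    fix E assume E: "E \<in> generic_solutions P \<inter> (topspace ?X \<inter> (\<Inter>N. interior_solvable ?S N))"
    then have "E \<in> interior_solvable ?S N" for N by blast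
    then have "solvable_word_problem (initial_subgroup N E)" for N by (rule interior_solvableD)
    then show "fg_subgroup_types (group_of E) = solvable_fg_types P"
      using E generic_solutions_contain_solvable[OF assms(1,2)] fg_subgroup_types_solvable[OF assms(3)]
      by (intro equalityI) (auto simp: generic_solutions_def)
  qed
  have 2: "\<exists>X. comeager_in ?X X \<and> (\<forall>E\<in>X. solvable_fg_types P \<subseteq> fg_subgroup_types (group_of E) \<and>
      fg_subgroup_types (group_of E) \<inter> unsolvable_fg_types P \<noteq> {})"
    if su: "strongly_undecidable P"
  proof (intro exI[of _ "generic_solutions P"] conjI ballI comeager_generic_solutions)
    fix E assume E: "E \<in> generic_solutions P"
    show "solvable_fg_types P \<subseteq> fg_subgroup_types (group_of E)"
      by (rule generic_solutions_contain_solvable[OF assms(1,2) E])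
    obtain R T where RT: "?X closure_of solving_set ?S R T = ?S"
      "\<And>E. E \<in> solving_set ?S R T \<Longrightarrow> fg_subgroup_types (group_of E) \<inter> unsolvable_fg_types P \<noteq> {}"
      by (rule generic_unsolvable_subgroup[OF assms(1,3) su]) (rule that; assumption)
    show "fg_subgroup_types (group_of E) \<inter> unsolvable_fg_types P \<noteq> {}"
      by (rule RT(2)[OF generic_solutionsD[OF E RT(1)]])
  qed
  from 1 2 show ?thesis unfolding Let_def by blast
qed

end
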